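(* Suppose $\underline\delta$ is related to $\underline\kappa$ by $\delta_j=-\frac{\kappa_j+\kappa_j^{-1}}{\kappa\kappa_j^{-1}+\kappa^{-1}\kappa_j}$ ($j=0,n$), $\delta=-(\kappa+\kappa^{-1})$, and $\beta_0,\beta_1$ are related to $\psi_0,\psi_n$ by $$\beta_0\beta_1=\psi_0^{-1}\psi_n^{-1}\cdot\begin{cases}\frac{(1+\kappa_0\kappa_n^{-1}\psi_0\psi_n)(1+\kappa_0^{-1}\kappa_n\psi_0\psi_n)}{(\kappa\kappa_0^{-1}+\kappa^{-1}\kappa_0)(\kappa\kappa_n^{-1}+\kappa^{-1}\kappa_n)} & n\text{ odd},\\ \frac{(1-\kappa^{-1}\kappa_0\kappa_n\psi_0\psi_n)(1-\kappa\kappa_0^{-1}\kappa_n^{-1}\psi_0\psi_n)}{(\kappa\kappa_0^{-1}+\kappa^{-1}\kappa_0)(\kappa\kappa_n^{-1}+\kappa^{-1}\kappa_n)} & n\text{ even}.\end{cases}$$ Then for generic parameters the linear map $\Psi:\mathbb{C}[\mathcal M]\to(\mathbb{C}^2)^{\otimes n}$, $$\Psi(\mathfrak p)=M(\mathfrak p)\sum_{\vec{\mathfrak p}\in\mathrm{Forg}^{-1}(\mathfrak p)}(-\kappa)^{-\mathrm{or}(\vec{\mathfrak p})}\Bigl(\prod_{j\in\{0,n\}}(-\kappa_j)^{N_{j,0}(\vec{\mathfrak p})-N_{j,1}(\vec{\mathfrak p})}\psi_j^{N_{j,0}(\vec{\mathfrak p})+N_{j,1}(\vec{\mathfrak p})}\Bigr)v(\vec{\mathfrak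 p}),$$ is an isomorphism of $\mathrm{TL}(\underline\delta)$-modules from $(\omega^{\underline\delta}_{\beta_0,\beta_1},\mathbb{C}[\mathcal M])$ to $(\hat\rho^{\underline\kappa}_{\psi_0,\psi_n},(\mathbb{C}^2)^{\otimes n})$.
   Context: $\mathrm{TL}(\underline\delta)$: generators $e_0,\ldots,e_n$, relations $e_i^2=\delta_ie_i$, $e_ie_{i\pm1}e_i=e_i$ ($1\le i<n$), $e_ie_j=e_je_i$ ($|i-j|>1$), with $\delta_1=\cdots=\delta_{n-1}=\delta$. The spin representation $\hat\rho^{\underline\kappa}_{\psi_0,\psi_n}$ on $(\mathbb{C}^2)^{\otimes n}$ (basis $(v_+,v_-)$ of $\mathbb{C}^2$, basis $(v_{++},v_{+-},v_{-+},v_{--})$ of $\mathbb{C}^2\otimes\mathbb{C}^2$, subscripts = tensor legs): $\hat\rho(e_0)=(\kappa\kappa_0^{-1}+\kappa^{-1}\kappa_0)^{-1}\begin{pmatrix}-\kappa_0^{-1}&\psi_0\\ \psi_0^{-1}&-\kappa_0\end{pmatrix}_1$, $\hat\rho(e_i)=\begin{pmatrix}0&0&0&0\\0&-\kappa&1&0\\0&1&-\kappa^{-1}&0\\0&0&0&0\end{pmatrix}_{i,i+1}$, $\hat\rho(e_n)=(\kappa\kappa_n^{-1}+\kappa^{-1}\kappa_n)^{-1}\begin{pmatrix}-\kappa_n&\psi_n^{-1}\\ \psi_n&-\kappa_n^{-1}\end{pmatrix}_n$. $\mathcal M$: two-boundary non-crossing perfect matchings of $[n+1]=\{0,\ldots,n+1\}$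 (sets $\mathfrak p$ of unordered pairs $\{i,j\}$, $i\ne j$, such that each $1\le i\le n$ is in exactly one pair, no $\{i,j\},\{k,l\}$ with $i<k<j<l$, and $\{0,n+1\}\notin\mathfrak p$); $m_i(\mathfrak p)$ the partner of $i$; $\mathfrak p_i$ ($1\le i<n$) is $\mathfrak p$ without pairs containing $i$ or $i+1$, $\mathfrak p_0$ (resp. $\mathfrak p_n$) without the pair containing $1$ (resp. $n$); $\mathrm{pty}(i)\in\{0,1\}$ the parity of $i$. The matchmaker representation $\omega^{\underline\delta}_{\beta_0,\beta_1}$ on $\mathbb{C}[\mathcal M]$: for $1\le i<n$, $e_i\mathfrak p=\delta\mathfrak p$ if $m_i(\mathfrak p)=i+1$; $=\delta_0^{\mathrm{pty}(i-1)}(\mathfrak p_i\cup\{\{i,i+1\}\})$ if $m_i=m_{i+1}=0$; $=\delta_n^{\mathrm{pty}(n+1-i)}(\mathfrak p_i\cup\{\{i,i+1\}\})$ if $m_i=m_{i+1}=n+1$; $=\beta_{\mathrm{pty}(i)}(\mathfrak p_i\cup\{\{i,i+1\}\})$ if $m_i=0,m_{i+1}=n+1$; else $\mathfrak p_i\cup\{\{i,i+1\},\{m_i(\mathfrak p),m_{i+1}(\mathfrak p)\}\}$. $e_0\mathfrak p=\delta_0\mathfrak p$ if $m_1=0$; $\beta_0(\mathfrak p_0\cup\{\{0,1\}\})$ if $m_1=n+1$; else $\mathfrak p_0\cup\{\{0,1\},\{0,m_1(\mathfrak p)\}\}$. $e_n\mathfrak p=\delta_n\mathfrak p$ if $m_n=n+1$;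 $\beta_{\mathrm{pty}(n)}(\mathfrak p_n\cup\{\{n,n+1\}\})$ if $m_n=0$; else $\mathfrak p_n\cup\{\{n,n+1\},\{m_n(\mathfrak p),n+1\}\}$. Normalization: $L_{0,h}(\mathfrak p)=\#\{\{i,0\}\in\mathfrak p:1\le i\le n,\mathrm{pty}(i)=h\}$, $L_{n,h}(\mathfrak p)=\#\{\{i,n+1\}\in\mathfrak p:1\le i\le n,\mathrm{pty}(i)=h\}$, $M(\mathfrak p)=\prod_{j\in\{0,n\}}\prod_{h\in\{0,1\}}M_{j,h}^{L_{j,h}(\mathfrak p)}$ with $M_{j,h}\in\mathbb{C}^*$ satisfying $M_{j,0}M_{j,1}=\psi_j^{-1}(\kappa\kappa_j^{-1}+\kappa^{-1}\kappa_j)^{-1}$ ($j=0,n$) and $M_{0,0}M_{n,1}=\beta_0(1+\kappa_0\kappa_n^{-1}\psi_0\psi_n)^{-1}$ if $n$ odd, $=\beta_0(1-\kappa^{-1}\kappa_0\kappa_n\psi_0\psi_n)^{-1}$ if $n$ even. Orientations: an oriented matching $\vec{\mathfrak p}$ is $\mathfrak p\in\mathcal M$ with an ordering $(i,j)$ of each pair ("oriented from $i$ to $j$"); $\mathrm{Forg}$ forgets orientation. For $1\le i\le n$, $r_i(\vec{\mathfrak p})=+$ if $(i,m_i(\mathfrak p))\in\vec{\mathfrak p}$ and $-$ if $(m_i(\mathfrak p),i)\in\vec{\mathfrak p}$; $v(\vec{\mathfrak p})=v_{r_1(\vec{\mathfrak p})}\otimes\cdots\otimes v_{r_n(\vec{\mathfrak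 p})}$. $N_{0,h}(\vec{\mathfrak p})=\#\{(i,0)\in\vec{\mathfrak p}:1\le i\le n,\mathrm{pty}(i)=h\}$, $N_{n,h}(\vec{\mathfrak p})=\#\{(n+1,i)\in\vec{\mathfrak p}:1\le i\le n,\mathrm{pty}(n+1-i)=h\}$, $\mathrm{or}(\vec{\mathfrak p})=\#\{(j,i)\in\vec{\mathfrak p}:1\le i<j\le n\}+N_{0,0}(\vec{\mathfrak p})+N_{n,0}(\vec{\mathfrak p})$. *)

theory Defs
  imports Complex_Main
begin

type_synonym matching = "nat set set"

definition noncrossing :: "matching \<Rightarrow> bool" where
  "noncrossing p \<longleftrightarrow>
     \<not> (\<exists>i j k l. {i, j} \<in> p \<and> {k, l} \<in> p \<and> i < k \<and> k < j \<and> j < l)"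

definition tb_matchings :: "nat \<Rightarrow> matching set" where
  "tb_matchings n = {p.
      (\<forall>e\<in>p. \<exists>i j. e = {i, j} \<and> i \<noteq> j \<and> i \<le> n + 1 \<and> j \<le> n + 1)
    \<and> (\<forall>i\<in>{1..n}. \<exists>!e\<in>p. i \<in> e)
    \<and> noncrossing p
    \<and> {0, n + 1} \<notin> p}"

definition partner :: "matching \<Rightarrow> nat \<Rightarrow> nat" where
  "partner p i = (THE j. j \<noteq> i \<and> {i, j} \<in> p)"

definition drop_pairs :: "matching \<Rightarrow> nat set \<Rightarrow> matching" where
  "drop_pairs p S = {e \<in> p. e \<inter> S = {}}"

definition pty :: "nat \<Rightarrow> nat" where
  "pty k = k mod 2"

definition mm_gen :: "nat \<Rightarrow> complex \<Rightarrow> complex \<Rightarrow> complex \<Rightarrow> complex \<Rightarrow> complex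
                      \<Rightarrow> nat \<Rightarrow> matching \<Rightarrow> complex \<times> matching" where
  "mm_gen n \<delta> \<delta>0 \<delta>n \<beta>0 \<beta>1 k p =
    (let \<beta> = (\<lambda>h::nat. if h = 0 then \<beta>0 else \<beta>1) in
     if k = 0 then
       (if partner p 1 = 0 then (\<delta>0, p)
        else if partner p 1 = n + 1 then (\<beta>0, drop_pairs p {1} \<union> {{0, 1}})
        else (1, drop_pairs p {1} \<union> {{0, 1}, {0, partner p 1}}))
     else if k = n then
       (if partner p n = n + 1 then (\<delta>n, p)
        else if partner p n = 0 then (\<beta> (pty n), drop_pairs p {n} \<union> {{n, n + 1}})
        else (1, drop_pairs p {n} \<union> {{n, n + 1}, {partner p n, n + 1}}))
     else
       (if partner p k = k + 1 then (\<delta>, p)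
        else if partner p k = 0 \<and> partner p (k + 1) = 0 then
          (\<delta>0 ^ pty (k - 1), drop_pairs p {k, k + 1} \<union> {{k, k + 1}})
        else if partner p k = n + 1 \<and> partner p (k + 1) = n + 1 then
          (\<delta>n ^ pty (n + 1 - k), drop_pairs p {k, k + 1} \<union> {{k, k + 1}})
        else if partner p k = 0 \<and> partner p (k + 1) = n + 1 then
          (\<beta> (pty k), drop_pairs p {k, k + 1} \<union> {{k, k + 1}})
        else (1, drop_pairs p {k, k + 1} \<union> {{k, k + 1}, {partner p k, partner p (k + 1)}})))"

text \<open>Vectors of C[M] are coefficient functions on matchings, supported on tb_matchings n.\<close>
definition mm_space :: "nat \<Rightarrow> (matching \<Rightarrow> complex) set" where
  "mm_space n = {x. \<forall>p. p \<notin> tb_matchings n \<longrightarrow> x p = 0}"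

definition mm_rep :: "nat \<Rightarrow> complex \<Rightarrow> complex \<Rightarrow> complex \<Rightarrow> complex \<Rightarrow> complex
                      \<Rightarrow> nat \<Rightarrow> (matching \<Rightarrow> complex) \<Rightarrow> (matching \<Rightarrow> complex)" where
  "mm_rep n \<delta> \<delta>0 \<delta>n \<beta>0 \<beta>1 k x = (\<lambda>q. \<Sum>p\<in>tb_matchings n.
      (if snd (mm_gen n \<delta> \<delta>0 \<delta>n \<beta>0 \<beta>1 k p) = q
       then fst (mm_gen n \<delta> \<delta>0 \<delta>n \<beta>0 \<beta>1 k p) * x p else 0))"

text \<open>Basis vectors v_{s_1} \<otimes> ... \<otimes> v_{s_n} are indexed by sign words s of length n
  (True = +, False = -; leg i is list position i - 1). Vectors are coefficient functions
  supported on words of length n.\<close>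
definition spin_space :: "nat \<Rightarrow> (bool list \<Rightarrow> complex) set" where
  "spin_space n = {y. \<forall>s. length s \<noteq> n \<longrightarrow> y s = 0}"

definition leg1 :: "nat \<Rightarrow> nat \<Rightarrow> (bool \<Rightarrow> bool \<Rightarrow> complex) \<Rightarrow> (bool list \<Rightarrow> complex) \<Rightarrow> bool list \<Rightarrow> complex" where
  "leg1 n i A y s = (if length s = n then (\<Sum>b\<in>UNIV. A (s ! (i - 1)) b * y (s[i - 1 := b])) else 0)"

definition leg2 :: "nat \<Rightarrow> nat \<Rightarrow> (bool \<times> bool \<Rightarrow> bool \<times> bool \<Rightarrow> complex) \<Rightarrow> (bool list \<Rightarrow> complex) \<Rightarrow> bool list \<Rightarrow> complex" where
  "leg2 n i B y s = (if length s = n then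
     (\<Sum>b\<in>UNIV. \<Sum>c\<in>UNIV. B (s ! (i - 1), s ! i) (b, c) * y (s[i - 1 := b, i := c])) else 0)"

definition mat2 :: "complex \<Rightarrow> complex \<Rightarrow> complex \<Rightarrow> complex \<Rightarrow> bool \<Rightarrow> bool \<Rightarrow> complex" where
  "mat2 a b c d r col = (if r then (if col then a else b) else (if col then c else d))"

definition tl_mat :: "complex \<Rightarrow> bool \<times> bool \<Rightarrow> bool \<times> bool \<Rightarrow> complex" where
  "tl_mat \<kappa> r col =
    (if r = (True, False) \<and> col = (True, False) then - \<kappa>
     else if r = (True, False) \<and> col = (False, True) then 1
     else if r = (False, True) \<and> col = (True, False) then 1
     else if r = (False, True) \<and> col = (False, True) then - inverse \<kappa>
     else 0)"

definition spin_rep :: "nat \<Rightarrow> complex \<Rightarrow> complex \<Rightarrow> complex \<Rightarrow> complex \<Rightarrow> complex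
                        \<Rightarrow> nat \<Rightarrow> (bool list \<Rightarrow> complex) \<Rightarrow> (bool list \<Rightarrow> complex)" where
  "spin_rep n \<kappa> \<kappa>0 \<kappa>n \<psi>0 \<psi>n k y =
    (if k = 0 then
       leg1 n 1 (\<lambda>r col. inverse (\<kappa> * inverse \<kappa>0 + inverse \<kappa> * \<kappa>0) *
                  mat2 (- inverse \<kappa>0) \<psi>0 (inverse \<psi>0) (- \<kappa>0) r col) y
     else if k = n then
       leg1 n n (\<lambda>r col. inverse (\<kappa> * inverse \<kappa>n + inverse \<kappa> * \<kappa>n) *
                  mat2 (- \<kappa>n) (inverse \<psi>n) \<psi>n (- inverse \<kappa>n) r col) y
     else leg2 n k (tl_mat \<kappa>) y)"

text \<open>Oriented matchings with Forg(op) = p: a choice of ordering (i,j) of each pair of p.\<close>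
definition orientations :: "matching \<Rightarrow> (nat \<times> nat) set set" where
  "orientations p = {op. op \<subseteq> {(a, b). {a, b} \<in> p} \<and>
                         (\<forall>e\<in>p. \<exists>!ab\<in>op. {fst ab, snd ab} = e)}"

definition spin_word :: "nat \<Rightarrow> matching \<Rightarrow> (nat \<times> nat) set \<Rightarrow> bool list" where
  "spin_word n p op = map (\<lambda>i. (i, partner p i) \<in> op) [1..<n + 1]"

definition N0 :: "nat \<Rightarrow> nat \<Rightarrow> (nat \<times> nat) set \<Rightarrow> nat" where
  "N0 n h op = card {i. (i, 0) \<in> op \<and> 1 \<le> i \<and> i \<le> n \<and> pty i = h}"

definition Nn :: "nat \<Rightarrow> nat \<Rightarrow> (nat \<times> nat) set \<Rightarrow> nat" where
  "Nn n h op = card {i. (n + 1, i) \<in> op \<and> 1 \<le> i \<and> i \<le> n \<and> pty (n + 1 - i) = h}"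

definition orn :: "nat \<Rightarrow> (nat \<times> nat) set \<Rightarrow> nat" where
  "orn n op = card {(j, i). (j, i) \<in> op \<and> 1 \<le> i \<and> i < j \<and> j \<le> n} + N0 n 0 op + Nn n 0 op"

definition L0 :: "nat \<Rightarrow> nat \<Rightarrow> matching \<Rightarrow> nat" where
  "L0 n h p = card {i. {i, 0} \<in> p \<and> 1 \<le> i \<and> i \<le> n \<and> pty i = h}"

definition Ln :: "nat \<Rightarrow> nat \<Rightarrow> matching \<Rightarrow> nat" where
  "Ln n h p = card {i. {i, n + 1} \<in> p \<and> 1 \<le> i \<and> i \<le> n \<and> pty i = h}"

definition Mnorm :: "nat \<Rightarrow> complex \<Rightarrow> complex \<Rightarrow> complex \<Rightarrow> complex \<Rightarrow> matching \<Rightarrow> complex" where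
  "Mnorm n M00 M01 Mn0 Mn1 p =
     M00 ^ L0 n 0 p * M01 ^ L0 n 1 p * Mn0 ^ Ln n 0 p * Mn1 ^ Ln n 1 p"

definition Psi_basis :: "nat \<Rightarrow> complex \<Rightarrow> complex \<Rightarrow> complex \<Rightarrow> complex \<Rightarrow> complex
    \<Rightarrow> complex \<Rightarrow> complex \<Rightarrow> complex \<Rightarrow> complex \<Rightarrow> matching \<Rightarrow> bool list \<Rightarrow> complex" where
  "Psi_basis n \<kappa> \<kappa>0 \<kappa>n \<psi>0 \<psi>n M00 M01 Mn0 Mn1 p s =
     Mnorm n M00 M01 Mn0 Mn1 p *
     (\<Sum>op\<in>{op \<in> orientations p. spin_word n p op = s}.
        (- \<kappa>) powi (- int (orn n op)) *
        ((- \<kappa>0) powi (int (N0 n 0 op) - int (N0 n 1 op)) * \<psi>0 ^ (N0 n 0 op + N0 n 1 op)) *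
        ((- \<kappa>n) powi (int (Nn n 0 op) - int (Nn n 1 op)) * \<psi>n ^ (Nn n 0 op + Nn n 1 op)))"

definition Psi :: "nat \<Rightarrow> complex \<Rightarrow> complex \<Rightarrow> complex \<Rightarrow> complex \<Rightarrow> complex
    \<Rightarrow> complex \<Rightarrow> complex \<Rightarrow> complex \<Rightarrow> complex \<Rightarrow> (matching \<Rightarrow> complex) \<Rightarrow> bool list \<Rightarrow> complex" where
  "Psi n \<kappa> \<kappa>0 \<kappa>n \<psi>0 \<psi>n M00 M01 Mn0 Mn1 x = (\<lambda>s. \<Sum>p\<in>tb_matchings n.
      x p * Psi_basis n \<kappa> \<kappa>0 \<kappa>n \<psi>0 \<psi>n M00 M01 Mn0 Mn1 p s)"

definition poly_fun :: "nat \<Rightarrow> ((nat \<Rightarrow> complex) \<Rightarrow> complex) \<Rightarrow> bool" where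
  "poly_fun k Q \<longleftrightarrow> (\<exists>A c. finite A \<and> (\<forall>\<alpha>\<in>A. \<forall>i\<ge>k. \<alpha> i = 0) \<and>
      (\<forall>x. Q x = (\<Sum>\<alpha>\<in>A. c \<alpha> * (\<Prod>i<k. x i ^ \<alpha> i))))"

definition is_TL_iso :: "nat \<Rightarrow> complex \<Rightarrow> complex \<Rightarrow> complex \<Rightarrow> complex \<Rightarrow> complex
    \<Rightarrow> complex \<Rightarrow> complex \<Rightarrow> complex \<Rightarrow> complex \<Rightarrow> complex
    \<Rightarrow> ((matching \<Rightarrow> complex) \<Rightarrow> bool list \<Rightarrow> complex) \<Rightarrow> bool" where
  "is_TL_iso n \<delta> \<delta>0 \<delta>n \<beta>0 \<beta>1 \<kappa> \<kappa>0 \<kappa>n \<psi>0 \<psi>n F \<longleftrightarrow>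
     bij_betw F (mm_space n) (spin_space n) \<and>
     (\<forall>k\<in>{0..n}. \<forall>x\<in>mm_space n.
        F (mm_rep n \<delta> \<delta>0 \<delta>n \<beta>0 \<beta>1 k x) = spin_rep n \<kappa> \<kappa>0 \<kappa>n \<psi>0 \<psi>n k (F x))"

end

theory Submission
  imports Defs "Jordan_Normal_Form.Determinant"
begin

text \<open>
  A sign word determines at most one orientation of a given matching, so the coefficient of a word in
  the image of a matching is a product of weights, one for each pair. All pairs which do not meet the
  sites of a generator contribute the same factor on both sides of the intertwining relation. Moreover
  each generator acts by a rank one matrix whose image is spanned by the weight vector of the pair that
  the generator creates. What remains is one scalar identity for each local configuration; there the
  only global input is that the two end points of an arc have opposite parity.

  For bijectivity, let \<open>\<psi>\<^sub>0 = \<psi>\<^sub>n = 0\<close> and \<open>1/\<kappa> \<rightarrow> 0\<close>. Up to normalization, a matching is then sent to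
  the single word which has + at left end points of pairs and - at right end points. Matching
  brackets shows that this is a bijection between matchings and words, so the determinant of the
  map is, after clearing denominators, a nonzero polynomial in the parameters.
\<close>

section \<open>Two-boundary matchings\<close>

text \<open>The conditions on the normalization constants come from the generators. A link may be
  rescaled by a factor that depends on its boundary and on the parity of its site. Capping two
  neighbouring left links, or opening an arc at the left boundary, involves one even and one odd
  site, so only \<open>M00 * M01\<close> enters there; the value \<open>1 / (\<psi>0 * D0)\<close>
  yields both \<open>\<delta>0\<close> and the coefficient 1. The right boundary is the mirror
  image. A string running from one boundary to the other sees \<open>M00 * Mn1\<close> or
  \<open>M01 * Mn0\<close>, and these products give \<open>\<beta>0\<close> and
  \<open>\<beta>1\<close>; the hypothesis on \<open>\<beta>0 * \<beta>1\<close> is the product of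
  the two evaluations. The constants enter the coefficients only through one nonzero factor per
  matching, so the determinant condition is free of them and involves only polynomials in \<kappa>,
  \<kappa>0, \<kappa>n, \<psi>0, \<psi>n.\<close>

text \<open>If \<open>y\<close> were outside the interval from \<open>c\<close> to \<open>d\<close>,
  the two pairs would interleave. This form needs no ordering of \<open>x\<close> and
  \<open>y\<close>; its conclusion is weak because links may share the end points \<open>0\<close>
  and \<open>n + 1\<close>.\<close>

lemma noncrossing_iff_nested:
  "noncrossing p \<longleftrightarrow>
    (\<forall>x y c d. {x, y} \<in> p \<longrightarrow> {c, d} \<in> p \<longrightarrow> c < x \<longrightarrow> x < d \<longrightarrow> c \<le> y \<and> y \<le> d)"
proof
  assume nc: "noncrossing p"
  show "\<forall>x y c d. {x, y} \<in> p \<longrightarrow> {c, d} \<in> p \<longrightarrow> c < x \<longrightarrow> x < d \<longrightarrow> c \<le> y \<and> y \<le> d"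
  proof (intro allI impI)
    fix x y c d
    assume h: "{x, y} \<in> p" "{c, d} \<in> p" "c < x" "x < d"
    then have h': "{y, x} \<in> p" by (simp add: insert_commute)
    from h h' nc show "c \<le> y \<and> y \<le> d"
      unfolding noncrossing_def by (meson leI)
  qed
next
  assume h: "\<forall>x y c d. {x, y} \<in> p \<longrightarrow> {c, d} \<in> p \<longrightarrow> c < x \<longrightarrow> x < d \<longrightarrow> c \<le> y \<and> y \<le> d"
  show "noncrossing p"
    unfolding noncrossing_def
  proof (intro notI, elim exE conjE)
    fix i j k l
    assume "{i, j} \<in> p" "{k, l} \<in> p" "i < k" "k < j" "j < l"
    with h[rule_format, of k l i j] show False by simp
  qed
qed

lemma noncrossing_nested:
  assumes "noncrossing p" "{x, y} \<in> p" "{c, d} \<in> p" "c < x" "x < d"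
  shows "c \<le> y \<and> y \<le> d"
  using assms unfolding noncrossing_iff_nested by blast

lemma noncrossing_subset: "noncrossing q \<Longrightarrow> p \<subseteq> q \<Longrightarrow> noncrossing p"
  unfolding noncrossing_def by blast

text \<open>The last conclusion is what the exclusion of \<open>{0, n + 1}\<close> becomes once the
  pair is ordered.\<close>

lemma tb_edgeE:
  assumes "p \<in> tb_matchings n" "e \<in> p"
  obtains i j where "e = {i, j}" "i < j" "j \<le> n + 1" "0 < i \<or> j \<le> n"
proof -
  from assms obtain i j where ij: "e = {i, j}" "i \<noteq> j" "i \<le> n + 1" "j \<le> n + 1"
    unfolding tb_matchings_def mem_Collect_eq by meson
  have ne: "e \<noteq> {0, n + 1}" using assms unfolding tb_matchings_def by auto
  show ?thesis
  proof (cases "i < j")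
    case True
    then show ?thesis using that[of i j] ij ne by (cases "i = 0"; cases "j = n + 1") auto
  next
    case False
    then show ?thesis using that[of j i] ij ne
      by (cases "j = 0"; cases "i = n + 1") (auto simp: insert_commute)
  qed
qed

lemma tb_pairD:
  assumes "p \<in> tb_matchings n" "{i, j} \<in> p"
  shows "i \<noteq> j" "i \<le> n + 1" "j \<le> n + 1" "0 < i \<or> j \<le> n" "0 < j \<or> i \<le> n"
proof -
  obtain a b where "{i, j} = {a, b}" "a < b" "b \<le> n + 1" "0 < a \<or> b \<le> n"
    using tb_edgeE[OF assms] by metis
  then show "i \<noteq> j" "i \<le> n + 1" "j \<le> n + 1" "0 < i \<or> j \<le> n" "0 < j \<or> i \<le> n"
    by (auto simp: doubleton_eq_iff)
qed

lemma tb_noncrossing: "p \<in> tb_matchings n \<Longrightarrow> noncrossing p"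
  unfolding tb_matchings_def by blast

lemma tb_unique:
  assumes "p \<in> tb_matchings n" "e \<in> p" "f \<in> p" "i \<in> e" "i \<in> f" "1 \<le> i" "i \<le> n"
  shows "e = f"
proof -
  have "\<exists>!e. e \<in> p \<and> i \<in> e"
    using assms(1,6,7) unfolding tb_matchings_def mem_Collect_eq by simp
  with assms(2-5) show ?thesis by blast
qed

lemma tb_cover:
  assumes "p \<in> tb_matchings n" "1 \<le> i" "i \<le> n"
  shows "\<exists>e\<in>p. i \<in> e"
proof -
  have "\<exists>!e. e \<in> p \<and> i \<in> e"
    using assms unfolding tb_matchings_def mem_Collect_eq by simp
  then show ?thesis by blast
qed

lemma tb_matchingsI:
  assumes "\<And>e. e \<in> p \<Longrightarrow> \<exists>i j. e = {i, j} \<and> i < j \<and> j \<le> n + 1 \<and> (0 < i \<or> j \<le> n)"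
    and "\<And>i. 1 \<le> i \<Longrightarrow> i \<le> n \<Longrightarrow> \<exists>e\<in>p. i \<in> e"
    and "\<And>i e f. 1 \<le> i \<Longrightarrow> i \<le> n \<Longrightarrow> e \<in> p \<Longrightarrow> f \<in> p \<Longrightarrow> i \<in> e \<Longrightarrow> i \<in> f \<Longrightarrow> e = f"
    and "noncrossing p"
  shows "p \<in> tb_matchings n"
proof -
  have 1: "\<forall>e\<in>p. \<exists>i j. e = {i, j} \<and> i \<noteq> j \<and> i \<le> n + 1 \<and> j \<le> n + 1"
    using assms(1) by fastforce
  have 2: "\<exists>!e. e \<in> p \<and> i \<in> e" if "i \<in> {1..n}" for i
    using assms(2)[of i] assms(3)[of i] that by auto
  have 3: "{0, n + 1} \<notin> p"
    using assms(1)[of "{0, n + 1}"] by (auto simp: doubleton_eq_iff)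
  show ?thesis unfolding tb_matchings_def using 1 2 3 assms(4) by simp
qed

lemma tb_subset_Pow: "p \<in> tb_matchings n \<Longrightarrow> p \<subseteq> Pow {0..n + 1}"
  by (auto elim!: tb_edgeE)

lemma finite_tb_matching: "p \<in> tb_matchings n \<Longrightarrow> finite p"
  by (rule finite_subset[OF tb_subset_Pow]) auto

lemma finite_tb_matchings: "finite (tb_matchings n)"
  by (rule finite_subset[of _ "Pow (Pow {0..n + 1})"]) (use tb_subset_Pow in auto)

lemma partner_eq:
  assumes p: "p \<in> tb_matchings n" and "{i, j} \<in> p" "1 \<le> i" "i \<le> n"
  shows "partner p i = j"
  unfolding partner_def
proof (rule the_equality)
  show "j \<noteq> i \<and> {i, j} \<in> p" using tb_pairD[OF assms(1,2)] assms by auto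
next
  fix k assume k: "k \<noteq> i \<and> {i, k} \<in> p"
  then have "{i, k} = {i, j}" using tb_unique[OF p, of "{i,k}" "{i,j}" i] assms by auto
  then show "k = j" by (auto simp: doubleton_eq_iff)
qed

lemma partner_edge:
  assumes p: "p \<in> tb_matchings n" and "1 \<le> i" "i \<le> n"
  shows "{i, partner p i} \<in> p"
proof -
  obtain e where e: "e \<in> p" "i \<in> e" using tb_cover[OF assms] by blast
  obtain a b where "e = {a, b}" using tb_edgeE[OF p e(1)] by metis
  with e have "\<exists>j. e = {i, j}" by auto
  with e(1) obtain j where "{i, j} \<in> p" by auto
  with partner_eq[OF p this assms(2,3)] show ?thesis by simp
qed

lemma partner_partner:
  assumes p: "p \<in> tb_matchings n" and "1 \<le> i" "i \<le> n" "1 \<le> partner p i" "partner p i \<le> n"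
  shows "partner p (partner p i) = i"
  using partner_eq[OF p _ assms(4,5), of i] partner_edge[OF assms(1-3)] by (simp add: insert_commute)

lemma edge_at_site:
  assumes p: "p \<in> tb_matchings n" and "e \<in> p" "i \<in> e" "1 \<le> i" "i \<le> n"
  shows "e = {i, partner p i}"
  using tb_unique[OF p assms(2) partner_edge[OF p assms(4,5)] assms(3) _ assms(4,5)] by simp

text \<open>Nesting gives only weak inequalities. Strictness comes from \<open>i\<close> and
  \<open>j\<close> being sites, each in a single pair; for a link this would fail, since boundary
  points are shared.\<close>

lemma partner_inside_arc:
  assumes p: "p \<in> tb_matchings n" and ij: "{i, j} \<in> p" "1 \<le> i" "i < j" "j \<le> n" and x: "i < x" "x < j"
  shows "i < partner p x" "partner p x < j"
proof -
  have e: "{x, partner p x} \<in> p" using partner_edge[OF p, of x] x ij by simp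
  have "i \<le> partner p x \<and> partner p x \<le> j"
    by (rule noncrossing_nested[OF tb_noncrossing[OF p] e ij(1) x])
  moreover have "partner p x \<noteq> i"
    using tb_unique[OF p e ij(1), of i] x ij by (auto simp: doubleton_eq_iff)
  moreover have "partner p x \<noteq> j"
    using tb_unique[OF p e ij(1), of j] x ij by (auto simp: doubleton_eq_iff)
  ultimately show "i < partner p x" "partner p x < j" by auto
qed

text \<open>The sites strictly below an arc are matched among themselves, so their number is even.\<close>

lemma arc_parity:
  assumes p: "p \<in> tb_matchings n" and ij: "{i, j} \<in> p" "1 \<le> i" "i < j" "j \<le> n"
  shows "even i \<longleftrightarrow> odd j"
proof -
  define P where "P = {e \<in> p. e \<subseteq> {i<..<j}}"
  have "{i<..<j} \<subseteq> \<Union> P"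
  proof
    fix x assume x: "x \<in> {i<..<j}"
    then have e: "{x, partner p x} \<in> p" using partner_edge[OF p, of x] ij by auto
    have "i < partner p x" "partner p x < j" using partner_inside_arc[OF p ij, of x] x by auto
    then show "x \<in> \<Union> P" using e x unfolding P_def by fastforce
  qed
  then have U: "\<Union> P = {i<..<j}" unfolding P_def by auto
  have "card (\<Union> P) = sum card P"
  proof (rule card_Union_disjoint)
    show "pairwise disjnt P"
      unfolding pairwise_def disjnt_def P_def
    proof (intro ballI impI)
      fix e f assume e: "e \<in> {e \<in> p. e \<subseteq> {i<..<j}}" and f: "f \<in> {e \<in> p. e \<subseteq> {i<..<j}}" and "e \<noteq> f"
      show "e \<inter> f = {}"
      proof (rule ccontr)
        assume "e \<inter> f \<noteq> {}"
        then obtain x where "x \<in> e" "x \<in> f" by auto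
        with tb_unique[OF p, of e f x] e f \<open>e \<noteq> f\<close> ij show False by auto
      qed
    qed
    show "finite e" if "e \<in> P" for e
      using that unfolding P_def by (auto intro: finite_subset)
  qed
  also have "\<dots> = (\<Sum>e\<in>P. 2)"
  proof (rule sum.cong[OF refl])
    fix e assume "e \<in> P"
    then have "e \<in> p" unfolding P_def by simp
    then obtain a b where "e = {a, b}" "a < b" using tb_edgeE[OF p] by metis
    then show "card e = 2" by simp
  qed
  finally have "j - i - 1 = card P * 2" unfolding U by simp
  with ij show ?thesis by presburger
qed

section \<open>Replacing pairs without creating crossings\<close>

text \<open>Removing all pairs that meet \<open>S\<close> frees certain sites, and
  \<open>cov\<close> demands that \<open>N\<close> covers exactly these. The kept pairs then share
  no site with \<open>N\<close>, which also gives the disjointness needed to split products over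
  pairs.\<close>

lemma tb_surgery:
  assumes p: "p \<in> tb_matchings n"
    and N: "\<And>e. e \<in> N \<Longrightarrow> \<exists>i j. e = {i, j} \<and> i < j \<and> j \<le> n + 1 \<and> (0 < i \<or> j \<le> n)"
    and cov: "\<And>i. 1 \<le> i \<Longrightarrow> i \<le> n \<Longrightarrow> (\<exists>e\<in>p. i \<in> e \<and> e \<inter> S \<noteq> {}) \<longleftrightarrow> (\<exists>e\<in>N. i \<in> e)"
    and un: "\<And>i e f. 1 \<le> i \<Longrightarrow> i \<le> n \<Longrightarrow> e \<in> N \<Longrightarrow> f \<in> N \<Longrightarrow> i \<in> e \<Longrightarrow> i \<in> f \<Longrightarrow> e = f"
    and nc: "noncrossing (drop_pairs p S \<union> N)"
  shows "drop_pairs p S \<union> N \<in> tb_matchings n" and "drop_pairs p S \<inter> N = {}"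
proof -
  have disj: False if "1 \<le> i" "i \<le> n" "e \<in> drop_pairs p S" "f \<in> N" "i \<in> e" "i \<in> f" for i e f
  proof -
    obtain g where "g \<in> p" "i \<in> g" "g \<inter> S \<noteq> {}" using cov[OF \<open>1 \<le> i\<close> \<open>i \<le> n\<close>] \<open>f \<in> N\<close> \<open>i \<in> f\<close> by blast
    moreover from this have "g = e" using tb_unique[OF p, of g e i] that unfolding drop_pairs_def by auto
    ultimately show False using that unfolding drop_pairs_def by auto
  qed
  show "drop_pairs p S \<union> N \<in> tb_matchings n"
  proof (rule tb_matchingsI[OF _ _ _ nc])
    fix e assume "e \<in> drop_pairs p S \<union> N"
    then consider "e \<in> p" | "e \<in> N" unfolding drop_pairs_def by auto
    then show "\<exists>i j. e = {i, j} \<and> i < j \<and> j \<le> n + 1 \<and> (0 < i \<or> j \<le> n)"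
      by cases (meson tb_edgeE[OF p], rule N)
  next
    fix i assume "1 \<le> i" "i \<le> n"
    then show "\<exists>e\<in>drop_pairs p S \<union> N. i \<in> e"
      using cov[of i] tb_cover[OF p, of i] unfolding drop_pairs_def
      by (cases "\<exists>e\<in>N. i \<in> e") auto
  next
    fix i e f
    assume i: "1 \<le> i" "i \<le> n" and ef: "e \<in> drop_pairs p S \<union> N" "f \<in> drop_pairs p S \<union> N" "i \<in> e" "i \<in> f"
    show "e = f"
    proof (cases "e \<in> N"; cases "f \<in> N")
      assume "e \<notin> N" "f \<notin> N"
      with ef have "e \<in> p" "f \<in> p" unfolding drop_pairs_def by auto
      then show ?thesis using tb_unique[OF p _ _ ef(3,4) i] by simp
    qed (use un[of i e f] disj[of i e f] disj[of i f e] i ef in auto)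
  qed
  show "drop_pairs p S \<inter> N = {}"
  proof (rule ccontr)
    assume "drop_pairs p S \<inter> N \<noteq> {}"
    then obtain e where e: "e \<in> drop_pairs p S" "e \<in> N" by auto
    obtain i j where "e = {i, j}" "i < j" "j \<le> n + 1" "0 < i \<or> j \<le> n" using N[OF e(2)] by auto
    then show False using disj[of i e e] disj[of j e e] e by (cases "0 < i") auto
  qed
qed

text \<open>No vertex lies between \<open>k\<close> and \<open>k + 1\<close>, so the new pair
  \<open>{a, b}\<close> can follow the two removed pairs closely. When both \<open>a\<close> and
  \<open>b\<close> are boundary points the set \<open>{a, b}\<close> is not a legal pair; it is
  discarded later by \<open>noncrossing_subset\<close>.\<close>

lemma noncrossing_cap:
  assumes p: "noncrossing p" and ka: "{k, a} \<in> p" and kb: "{k + 1, b} \<in> p"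
  shows "noncrossing (drop_pairs p {k, k + 1} \<union> {{k, k + 1}, {a, b}})"
  unfolding noncrossing_iff_nested
proof (intro allI impI)
  fix x y c d
  assume xy: "{x, y} \<in> drop_pairs p {k, k + 1} \<union> {{k, k + 1}, {a, b}}"
    and cd: "{c, d} \<in> drop_pairs p {k, k + 1} \<union> {{k, k + 1}, {a, b}}"
    and lt: "c < x" "x < d"
  have ak: "{a, k} \<in> p" and bk: "{b, k + 1} \<in> p" using ka kb by (auto simp: insert_commute)
  note nest = noncrossing_nested[OF p]
  consider "{x, y} \<in> p \<and> x \<noteq> k \<and> x \<noteq> k + 1 \<and> y \<noteq> k \<and> y \<noteq> k + 1"
    | "{x, y} = {k, k + 1}" | "{x, y} = {a, b}"
    using xy unfolding drop_pairs_def by auto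
  then show "c \<le> y \<and> y \<le> d"
  proof cases
    case 1
    then have yx: "{y, x} \<in> p" by (simp add: insert_commute)
    \<comment> \<open>Confinement of the kept pair \<open>{x, y}\<close>: \<open>f1\<close> and
      \<open>f2\<close> by the removed pair at \<open>k\<close>, \<open>g1\<close> and
      \<open>g2\<close> by the one at \<open>k + 1\<close>, while \<open>h\<close> records how the
      two removed pairs lie relative to each other.\<close>
    have f1: "(a < x \<and> x < k \<longrightarrow> a \<le> y \<and> y \<le> k) \<and> (k < x \<and> x < a \<longrightarrow> k \<le> y \<and> y \<le> a)"
      using nest[of x y a k] nest[of x y k a] ak ka 1 by blast
    have f2: "(a < y \<and> y < k \<longrightarrow> a \<le> x \<and> x \<le> k) \<and> (k < y \<and> y < a \<longrightarrow> k \<le> x \<and> x \<le> a)"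
      using nest[of y x a k] nest[of y x k a] ak ka yx by blast
    have g1: "(b < x \<and> x < k + 1 \<longrightarrow> b \<le> y \<and> y \<le> k + 1) \<and> (k + 1 < x \<and> x < b \<longrightarrow> k + 1 \<le> y \<and> y \<le> b)"
      using nest[of x y b "k + 1"] nest[of x y "k + 1" b] bk kb 1 by blast
    have g2: "(b < y \<and> y < k + 1 \<longrightarrow> b \<le> x \<and> x \<le> k + 1) \<and> (k + 1 < y \<and> y < b \<longrightarrow> k + 1 \<le> x \<and> x \<le> b)"
      using nest[of y x b "k + 1"] nest[of y x "k + 1" b] bk kb yx by blast
    have h: "(a < b \<longrightarrow> k \<le> b) \<and> (k + 1 < a \<longrightarrow> k \<le> b \<and> b \<le> a)"
      using nest[of b "k + 1" a k] nest[of "k + 1" b k a] ak ka bk kb by (auto simp: not_less[symmetric])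
    have xk: "x \<noteq> k" "x \<noteq> k + 1" "y \<noteq> k" "y \<noteq> k + 1" using 1 by auto
    consider "{c, d} \<in> p" | "{c, d} = {k, k + 1}" | "c = a" "d = b" | "c = b" "d = a"
      using cd unfolding drop_pairs_def by (auto simp: doubleton_eq_iff)
    then show ?thesis
    proof cases
      case 1
      then show ?thesis using nest[of x y c d] \<open>{x, y} \<in> p \<and> _\<close> lt by blast
    next
      case 2
      then show ?thesis using lt by (auto simp: doubleton_eq_iff)
    next
      case 3
      then have "k \<le> b" "a \<le> k + 1" using h lt by linarith+
      show ?thesis
      proof (cases "x < k")
        case True
        then have "a \<le> y \<and> y \<le> k" using f1 lt 3 by blast
        then show ?thesis using \<open>k \<le> b\<close> 3 by simp
      next
        case False
        then have "k + 1 \<le> y \<and> y \<le> b" using g1 lt 3 xk by (metis Suc_eq_plus1 Suc_lessI linorder_neqE_nat)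
        then show ?thesis using \<open>a \<le> k + 1\<close> 3 by simp
      qed
    next
      case 4
      show ?thesis
      proof (cases "x < k")
        case True
        then have "a \<le> k + 1" using h lt 4 by linarith
        moreover have "b \<le> y \<and> y < k" using g1 True lt 4 xk by linarith
        ultimately show ?thesis using f2 lt 4 by linarith
      next
        case False
        then have "k \<le> b" using h lt 4 xk by linarith
        moreover have "k + 1 < y \<and> y \<le> a" using f1 False lt 4 xk by linarith
        ultimately show ?thesis using g2 lt 4 by linarith
      qed
    qed
  next
    case 2
    then have xy': "x = k \<and> y = k + 1 \<or> x = k + 1 \<and> y = k" by (auto simp: doubleton_eq_iff)
    consider "c \<noteq> k \<and> d \<noteq> k \<and> c \<noteq> k + 1 \<and> d \<noteq> k + 1" | "{c, d} = {k, k + 1}" | "{c, d} = {a, b}"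
      using cd unfolding drop_pairs_def by auto
    then show ?thesis using xy' lt by cases (auto simp: doubleton_eq_iff)
  next
    case 3
    then have xy': "x = a \<and> y = b \<or> x = b \<and> y = a" by (auto simp: doubleton_eq_iff)
    consider "{c, d} \<in> p \<and> c \<noteq> k \<and> d \<noteq> k \<and> c \<noteq> k + 1 \<and> d \<noteq> k + 1"
      | "{c, d} = {k, k + 1}" | "{c, d} = {a, b}"
      using cd unfolding drop_pairs_def by auto
    then show ?thesis
    proof cases
      case 1
      show ?thesis
        using xy' nest[of a k c d] nest[of b "k + 1" c d] nest[of k a c d] nest[of "k + 1" b c d]
          1 ka kb ak bk lt by auto
    qed (use lt xy' in \<open>auto simp: doubleton_eq_iff\<close>)
  qed
qed

text \<open>A kept pair reaching strictly around \<open>m\<close> must also enclose site 1, hence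
  starts at \<open>0\<close> and cannot cross \<open>{0, m}\<close>. A kept pair with an end
  strictly between 1 and \<open>m\<close> was already confined by \<open>{1, m}\<close>.\<close>

lemma noncrossing_open_left:
  assumes p: "noncrossing p" and m: "{1, m} \<in> p"
  shows "noncrossing (drop_pairs p {1} \<union> {{0, 1}, {0, m}})"
  unfolding noncrossing_iff_nested
proof (intro allI impI)
  fix x y c d
  assume xy: "{x, y} \<in> drop_pairs p {1} \<union> {{0, 1}, {0, m}}"
    and cd: "{c, d} \<in> drop_pairs p {1} \<union> {{0, 1}, {0, m}}" and lt: "c < x" "x < d"
  have m': "{m, 1} \<in> p" using m by (simp add: insert_commute)
  note nest = noncrossing_nested[OF p]
  have "{x, y} \<in> p \<and> x \<noteq> 1 \<and> y \<noteq> 1 \<or> (x = 0 \<and> y = 1 \<or> x = 1 \<and> y = 0) \<or> (x = 0 \<and> y = m \<or> x = m \<and> y = 0)"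
    using xy unfolding drop_pairs_def by (auto simp: doubleton_eq_iff)
  moreover
  have "{c, d} \<in> p \<and> c \<noteq> 1 \<and> d \<noteq> 1 \<or> (c = 0 \<and> d = 1 \<or> c = 1 \<and> d = 0) \<or> (c = 0 \<and> d = m \<or> c = m \<and> d = 0)"
    using cd unfolding drop_pairs_def by (auto simp: doubleton_eq_iff)
  ultimately show "c \<le> y \<and> y \<le> d"
    using nest[of x y c d] nest[of x y 1 m] nest[of m 1 c d] nest[of 1 m c d] m m' lt by auto
qed

text \<open>Mirror image of the left case. There \<open>0\<close> is automatically the least number;
  here \<open>le\<close> supplies that \<open>n + 1\<close> is the greatest vertex.\<close>

lemma noncrossing_open_right:
  assumes p: "noncrossing p" and m: "{n, m} \<in> p" and le: "\<And>e i. e \<in> p \<Longrightarrow> i \<in> e \<Longrightarrow> i \<le> n + 1"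
  shows "noncrossing (drop_pairs p {n} \<union> {{n, n + 1}, {m, n + 1}})"
  unfolding noncrossing_iff_nested
proof (intro allI impI)
  fix x y c d
  assume xy: "{x, y} \<in> drop_pairs p {n} \<union> {{n, n + 1}, {m, n + 1}}"
    and cd: "{c, d} \<in> drop_pairs p {n} \<union> {{n, n + 1}, {m, n + 1}}" and lt: "c < x" "x < d"
  have m': "{m, n} \<in> p" using m by (simp add: insert_commute)
  have mn: "m \<le> n + 1" using le[OF m, of m] by simp
  note nest = noncrossing_nested[OF p]
  have X: "{x, y} \<in> p \<and> x \<noteq> n \<and> y \<noteq> n \<and> x \<le> n + 1 \<and> y \<le> n + 1 \<or>
      (x = n \<and> y = n + 1 \<or> x = n + 1 \<and> y = n) \<or> (x = m \<and> y = n + 1 \<or> x = n + 1 \<and> y = m)"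
    using xy le[of "{x, y}"] unfolding drop_pairs_def by (auto simp: doubleton_eq_iff)
  have C: "{c, d} \<in> p \<and> c \<noteq> n \<and> d \<noteq> n \<and> c \<le> n + 1 \<and> d \<le> n + 1 \<or>
      (c = n \<and> d = n + 1 \<or> c = n + 1 \<and> d = n) \<or> (c = m \<and> d = n + 1 \<or> c = n + 1 \<and> d = m)"
    using cd le[of "{c, d}"] unfolding drop_pairs_def by (auto simp: doubleton_eq_iff)
  from X C show "c \<le> y \<and> y \<le> d"
    using nest[of x y c d] nest[of x y m n] nest[of m n c d] nest[of n m c d] m m' lt mn by auto
qed

section \<open>The coefficients as products over pairs\<close>

text \<open>\<open>u\<close> is the weight of + at a left or - at a right end; \<open>t\<close> that
  of a reversed arc; \<open>x0\<close>, \<open>x1\<close> belong to left links oriented into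
  \<open>0\<close>, and \<open>y0\<close>, \<open>y1\<close> to right links oriented out of
  \<open>n + 1\<close>. Keeping \<open>u\<close> as a variable makes the weight homogeneous linear
  in the six parameters.\<close>

definition edge_wt ::
    "nat \<Rightarrow> complex \<Rightarrow> complex \<Rightarrow> complex \<Rightarrow> complex \<Rightarrow> complex \<Rightarrow> complex \<Rightarrow> nat set \<Rightarrow> bool list \<Rightarrow> complex" where
  "edge_wt n u t x0 x1 y0 y1 e s =
    (let a = Min e; b = Max e in
     if a = 0 then (if s ! (b - 1) then (if even b then x0 else x1) else u)
     else if b = n + 1 then (if s ! (a - 1) then u else if even (n + 1 - a) then y0 else y1)
     else if s ! (a - 1) = s ! (b - 1) then 0 else if s ! (a - 1) then u else t)"

text \<open>For right links the parity here is that of the site, as in \<open>Ln\<close>, whereas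
  \<open>edge_wt\<close> uses the parity of the distance to \<open>n + 1\<close>, as in
  \<open>Nn\<close>.\<close>

definition edge_norm :: "nat \<Rightarrow> complex \<Rightarrow> complex \<Rightarrow> complex \<Rightarrow> complex \<Rightarrow> nat set \<Rightarrow> complex" where
  "edge_norm n m00 m01 mn0 mn1 e =
    (let a = Min e; b = Max e in
     if a = 0 then (if even b then m00 else m01)
     else if b = n + 1 then (if even a then mn0 else mn1) else 1)"

lemma edge_wt_left:
  "edge_wt n u t x0 x1 y0 y1 {0, i} s = (if s ! (i - 1) then (if even i then x0 else x1) else u)"
  "edge_wt n u t x0 x1 y0 y1 {i, 0} s = (if s ! (i - 1) then (if even i then x0 else x1) else u)"
  unfolding edge_wt_def Let_def by simp_all

lemma edge_wt_right:
  assumes "1 \<le> i" "i \<le> n"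
  shows "edge_wt n u t x0 x1 y0 y1 {i, n + 1} s =
      (if s ! (i - 1) then u else if even (n + 1 - i) then y0 else y1)"
    and "edge_wt n u t x0 x1 y0 y1 {n + 1, i} s =
      (if s ! (i - 1) then u else if even (n + 1 - i) then y0 else y1)"
  using assms unfolding edge_wt_def Let_def by (simp_all add: max_def)

lemma edge_wt_arc:
  assumes "1 \<le> i" "i < j" "j \<le> n"
  shows "edge_wt n u t x0 x1 y0 y1 {i, j} s =
      (if s ! (i - 1) = s ! (j - 1) then 0 else if s ! (i - 1) then u else t)"
    and "edge_wt n u t x0 x1 y0 y1 {j, i} s =
      (if s ! (i - 1) = s ! (j - 1) then 0 else if s ! (i - 1) then u else t)"
  using assms unfolding edge_wt_def Let_def by (simp_all add: max_def min_def)

lemma edge_norm_left: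
  "edge_norm n m00 m01 mn0 mn1 {0, i} = (if even i then m00 else m01)"
  "edge_norm n m00 m01 mn0 mn1 {i, 0} = (if even i then m00 else m01)"
  unfolding edge_norm_def Let_def by simp_all

lemma edge_norm_right:
  assumes "1 \<le> i" "i \<le> n"
  shows "edge_norm n m00 m01 mn0 mn1 {i, n + 1} = (if even i then mn0 else mn1)"
    and "edge_norm n m00 m01 mn0 mn1 {n + 1, i} = (if even i then mn0 else mn1)"
  using assms unfolding edge_norm_def Let_def by (simp_all add: max_def min_def)

lemma edge_norm_arc:
  assumes "1 \<le> i" "i \<le> n" "1 \<le> j" "j \<le> n"
  shows "edge_norm n m00 m01 mn0 mn1 {i, j} = 1"
  using assms unfolding edge_norm_def Let_def by (simp add: max_def min_def)

text \<open>Every pair is a left link, a right link or an arc. Arcs are indexed with the larger end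
  first, to agree with the set counted in \<open>orn\<close>.\<close>

lemma prod_tb_matching:
  assumes p: "p \<in> tb_matchings n"
  shows "(\<Prod>e\<in>p. f e) =
      (\<Prod>i\<in>{i. {i, 0} \<in> p \<and> 1 \<le> i \<and> i \<le> n}. f {i, 0}) *
      (\<Prod>i\<in>{i. {i, n + 1} \<in> p \<and> 1 \<le> i \<and> i \<le> n}. f {i, n + 1}) *
      (\<Prod>(j, i)\<in>{(j, i). {j, i} \<in> p \<and> 1 \<le> i \<and> i < j \<and> j \<le> n}. (f {j, i} :: complex))"
proof -
  let ?I0 = "{i. {i, 0} \<in> p \<and> 1 \<le> i \<and> i \<le> n}"
  let ?In = "{i. {i, n + 1} \<in> p \<and> 1 \<le> i \<and> i \<le> n}"
  let ?A = "{(j, i). {j, i} \<in> p \<and> 1 \<le> i \<and> i < j \<and> j \<le> n}"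
  let ?P0 = "(\<lambda>i. {i, 0::nat}) ` ?I0" and ?Pn = "(\<lambda>i. {i, n + 1}) ` ?In"
  let ?PA = "(\<lambda>(j, i). {j, i}) ` ?A"
  have "?A \<subseteq> {0..n} \<times> {0..n}" by auto
  then have finA: "finite ?A" by (rule finite_subset) auto
  have p_eq: "p = (?P0 \<union> ?Pn) \<union> ?PA"
  proof
    show "p \<subseteq> (?P0 \<union> ?Pn) \<union> ?PA"
    proof
      fix e assume e: "e \<in> p"
      then obtain i j where ij: "e = {i, j}" "i < j" "j \<le> n + 1" "0 < i \<or> j \<le> n"
        using tb_edgeE[OF p] by metis
      consider "i = 0" | "0 < i" "j = n + 1" | "0 < i" "j \<le> n" using ij by linarith
      then show "e \<in> (?P0 \<union> ?Pn) \<union> ?PA"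
      proof cases
        case 1
        then have "j \<in> ?I0" "e = {j, 0}" using ij e by (auto simp: insert_commute)
        then show ?thesis by blast
      next
        case 2
        then have "i \<in> ?In" "e = {i, n + 1}" using ij e by auto
        then show ?thesis by blast
      next
        case 3
        then have "(j, i) \<in> ?A" "e = {j, i}" using ij e by (auto simp: insert_commute)
        then show ?thesis by force
      qed
    qed
  qed auto
  have "prod f p = prod f (?P0 \<union> ?Pn) * prod f ?PA"
    by (subst p_eq, rule prod.union_disjoint) (use finA in \<open>auto simp: doubleton_eq_iff\<close>)
  also have "prod f (?P0 \<union> ?Pn) = prod f ?P0 * prod f ?Pn"
    by (rule prod.union_disjoint) (auto simp: doubleton_eq_iff)
  also have "prod f ?P0 = (\<Prod>i\<in>?I0. f {i, 0})"
    by (subst prod.reindex) (auto simp: inj_on_def doubleton_eq_iff)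
  also have "prod f ?Pn = (\<Prod>i\<in>?In. f {i, n + 1})"
    by (subst prod.reindex) (auto simp: inj_on_def doubleton_eq_iff)
  also have "prod f ?PA = (\<Prod>(j, i)\<in>?A. f {j, i})"
    by (subst prod.reindex) (auto simp: inj_on_def doubleton_eq_iff intro!: prod.cong)
  finally show ?thesis .
qed

lemma prod_two_values:
  fixes x y :: complex
  assumes "finite I"
  shows "(\<Prod>i\<in>I. if P i then x else y) = x ^ card {i \<in> I. P i} * y ^ card {i \<in> I. \<not> P i}"
proof -
  have "{i \<in> I. P i} = I \<inter> {i. P i}" "{i \<in> I. \<not> P i} = I \<inter> - {i. P i}" by auto
  then show ?thesis by (simp only: prod.If_cases[OF assms] prod_constant)
qed

lemma prod_three_values:
  fixes x y :: complex
  assumes I: "finite I"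
  shows "(\<Prod>i\<in>I. if P i then (if Q i then x else y) else 1) =
      x ^ card {i \<in> I. P i \<and> Q i} * y ^ card {i \<in> I. P i \<and> \<not> Q i}"
proof -
  have "(\<Prod>i\<in>I. if P i then (if Q i then x else y) else 1) =
      (\<Prod>i\<in>I. (if P i \<and> Q i then x else 1) * (if P i \<and> \<not> Q i then y else 1))"
    by (rule prod.cong) auto
  then show ?thesis using I by (simp add: prod.distrib prod_two_values)
qed

lemma pty_iff: "pty i = 0 \<longleftrightarrow> even i" "pty i = Suc 0 \<longleftrightarrow> odd i"
  unfolding pty_def by presburger+

lemma Mnorm_eq_prod:
  assumes p: "p \<in> tb_matchings n"
  shows "Mnorm n m00 m01 mn0 mn1 p = (\<Prod>e\<in>p. edge_norm n m00 m01 mn0 mn1 e)"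
proof -
  have 1: "(\<Prod>i\<in>{i. {i, 0} \<in> p \<and> 1 \<le> i \<and> i \<le> n}. edge_norm n m00 m01 mn0 mn1 {i, 0}) =
      m00 ^ L0 n 0 p * m01 ^ L0 n 1 p"
    unfolding edge_norm_left
    by (subst prod_two_values) (auto simp: L0_def pty_iff conj_assoc)
  have "(\<Prod>i\<in>{i. {i, n + 1} \<in> p \<and> 1 \<le> i \<and> i \<le> n}. edge_norm n m00 m01 mn0 mn1 {i, n + 1}) =
      (\<Prod>i\<in>{i. {i, n + 1} \<in> p \<and> 1 \<le> i \<and> i \<le> n}. if even i then mn0 else mn1)"
    by (rule prod.cong[OF refl], rule edge_norm_right) auto
  also have "\<dots> = mn0 ^ Ln n 0 p * mn1 ^ Ln n 1 p"
    by (subst prod_two_values) (auto simp: Ln_def pty_iff conj_assoc)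
  finally have 2: "(\<Prod>i\<in>{i. {i, n + 1} \<in> p \<and> 1 \<le> i \<and> i \<le> n}. edge_norm n m00 m01 mn0 mn1 {i, n + 1}) =
      mn0 ^ Ln n 0 p * mn1 ^ Ln n 1 p" .
  have 3: "(\<Prod>(j, i)\<in>{(j, i). {j, i} \<in> p \<and> 1 \<le> i \<and> i < j \<and> j \<le> n}. edge_norm n m00 m01 mn0 mn1 {j, i}) = 1"
    by (rule prod.neutral) (auto intro!: edge_norm_arc)
  show ?thesis
    unfolding prod_tb_matching[OF p] 1 2 3 Mnorm_def by (simp add: mult.assoc)
qed

section \<open>Orientations determined by sign words\<close>

lemma orientation_flip:
  assumes p: "p \<in> tb_matchings n" and op: "op \<in> orientations p" and ab: "{a, b} \<in> p"
  shows "(a, b) \<in> op \<longleftrightarrow> (b, a) \<notin> op"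
proof -
  have ne: "a \<noteq> b" using tb_pairD[OF p ab] by simp
  have "\<exists>!c. c \<in> op \<and> {fst c, snd c} = {a, b}"
    using op ab unfolding orientations_def mem_Collect_eq by (elim conjE) (rule bspec)
  then obtain c where c: "c \<in> op" "{fst c, snd c} = {a, b}"
    "\<And>d. d \<in> op \<Longrightarrow> {fst d, snd d} = {a, b} \<Longrightarrow> d = c" by metis
  have "(a, b) \<in> op \<Longrightarrow> (a, b) = c" "(b, a) \<in> op \<Longrightarrow> (b, a) = c"
    by (rule c(3); simp add: insert_commute)+
  moreover have "c = (a, b) \<or> c = (b, a)"
    using c(2) by (cases c) (simp add: doubleton_eq_iff)
  ultimately show ?thesis using c(1) ne by auto
qed

lemma orientationsI:
  assumes sub: "\<And>a b. (a, b) \<in> op \<Longrightarrow> {a, b} \<in> p"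
    and flip: "\<And>a b. {a, b} \<in> p \<Longrightarrow> (a, b) \<in> op \<longleftrightarrow> (b, a) \<notin> op"
    and pairs: "\<And>e. e \<in> p \<Longrightarrow> \<exists>a b. e = {a, b}"
  shows "op \<in> orientations p"
  unfolding orientations_def mem_Collect_eq
proof
  show "op \<subseteq> {(a, b). {a, b} \<in> p}" using sub by auto
  show "\<forall>e\<in>p. \<exists>!ab. ab \<in> op \<and> {fst ab, snd ab} = e"
  proof
    fix e assume e: "e \<in> p"
    then obtain a b where ab: "e = {a, b}" using pairs by blast
    have "(a, b) \<in> op \<and> (b, a) \<notin> op \<or> (b, a) \<in> op \<and> (a, b) \<notin> op" using flip[of a b] e ab by auto
    then show "\<exists>!ab. ab \<in> op \<and> {fst ab, snd ab} = e"
    proof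
      assume "(a, b) \<in> op \<and> (b, a) \<notin> op"
      then show ?thesis using ab by (intro ex1I[of _ "(a, b)"]) (auto simp: doubleton_eq_iff)
    next
      assume "(b, a) \<in> op \<and> (a, b) \<notin> op"
      then show ?thesis using ab by (intro ex1I[of _ "(b, a)"]) (auto simp: doubleton_eq_iff)
    qed
  qed
qed

text \<open>Boundary points carry no letter, so a pair leaves a boundary point \<open>a\<close>
  exactly when the letter at its other end \<open>b\<close> is -.\<close>

definition word_orientation :: "nat \<Rightarrow> matching \<Rightarrow> bool list \<Rightarrow> (nat \<times> nat) set" where
  "word_orientation n p s =
    {(a, b). {a, b} \<in> p \<and> (if 1 \<le> a \<and> a \<le> n then s ! (a - 1) else \<not> s ! (b - 1))}"

lemma spin_word_eq_iff:
  assumes "length s = n"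
  shows "spin_word n p op = s \<longleftrightarrow> (\<forall>i. 1 \<le> i \<and> i \<le> n \<longrightarrow> (i, partner p i) \<in> op \<longleftrightarrow> s ! (i - 1))"
proof -
  have "spin_word n p op = s \<longleftrightarrow> (\<forall>k<n. (Suc k, partner p (Suc k)) \<in> op \<longleftrightarrow> s ! k)"
    using assms unfolding spin_word_def by (auto simp: list_eq_iff_nth_eq simp del: upt_Suc)
  also have "\<dots> \<longleftrightarrow> (\<forall>i. 1 \<le> i \<and> i \<le> n \<longrightarrow> (i, partner p i) \<in> op \<longleftrightarrow> s ! (i - 1))"
    by (metis One_nat_def Suc_le_eq Suc_pred diff_Suc_1 zero_less_Suc)
  finally show ?thesis .
qed

lemma orientation_eq_word_orientation:
  assumes p: "p \<in> tb_matchings n" and op: "op \<in> orientations p" and s: "length s = n"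
    and w: "spin_word n p op = s"
  shows "op = word_orientation n p s"
proof -
  have site: "(a, b) \<in> op \<longleftrightarrow> s ! (a - 1)" if "{a, b} \<in> p" "1 \<le> a" "a \<le> n" for a b
    using w partner_eq[OF p that] that unfolding spin_word_eq_iff[OF s] by auto
  have "(a, b) \<in> op \<longleftrightarrow> (a, b) \<in> word_orientation n p s" for a b
  proof (cases "{a, b} \<in> p")
    case True
    then have ba: "{b, a} \<in> p" by (simp add: insert_commute)
    show ?thesis
    proof (cases "1 \<le> a \<and> a \<le> n")
      case t: True
      then show ?thesis using site[OF True] True unfolding word_orientation_def by auto
    next
      case False
      then have "1 \<le> b" "b \<le> n" using tb_pairD[OF p True] by auto
      then show ?thesis using site[OF ba] orientation_flip[OF p op True] True False
        unfolding word_orientation_def by auto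
    qed
  next
    case False
    then show ?thesis using op unfolding orientations_def word_orientation_def by auto
  qed
  then show ?thesis by auto
qed

text \<open>Both ends of an arc prescribe a direction, and opposite letters make the prescriptions
  agree. Links impose no condition, having only one lettered end.\<close>

lemma word_orientation_in_orientations:
  assumes p: "p \<in> tb_matchings n" and s: "length s = n"
    and good: "\<And>i j. {j, i} \<in> p \<Longrightarrow> 1 \<le> i \<Longrightarrow> i < j \<Longrightarrow> j \<le> n \<Longrightarrow> s ! (i - 1) \<noteq> s ! (j - 1)"
  shows "word_orientation n p s \<in> orientations p" "spin_word n p (word_orientation n p s) = s"
proof -
  show "word_orientation n p s \<in> orientations p"
  proof (rule orientationsI)
    fix a b assume ab: "{a, b} \<in> p"
    then have ba: "{b, a} \<in> p" by (simp add: insert_commute)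
    show "(a, b) \<in> word_orientation n p s \<longleftrightarrow> (b, a) \<notin> word_orientation n p s"
      using good[of b a] good[of a b] tb_pairD[OF p ab] ab ba
      unfolding word_orientation_def by (cases "a < b") auto
  next
    fix e assume "e \<in> p"
    then show "\<exists>a b. e = {a, b}" using tb_edgeE[OF p] by metis
  qed (auto simp: word_orientation_def)
  show "spin_word n p (word_orientation n p s) = s"
    unfolding spin_word_eq_iff[OF s] using partner_edge[OF p] by (auto simp: word_orientation_def)
qed

text \<open>Origin of the weights: a reversed arc counts once in \<open>orn\<close>, giving
  \<open>- inverse \<kappa>\<close>. A link of even type with nontrivial orientation counts in
  \<open>orn\<close> and in the even count, giving
  \<open>(- inverse \<kappa>) * (- \<kappa>0) * \<psi>0\<close>; one of odd type gives
  \<open>(- inverse \<kappa>0) * \<psi>0\<close>; likewise on the right. If an arc has equal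
  letters, the sum is empty and the product has a zero factor.\<close>

lemma Psi_basis_eq_prod:
  assumes p: "p \<in> tb_matchings n" and s: "length s = n"
    and nz: "\<kappa> \<noteq> 0" "\<kappa>0 \<noteq> 0" "\<kappa>n \<noteq> 0"
  shows "Psi_basis n \<kappa> \<kappa>0 \<kappa>n \<psi>0 \<psi>n m00 m01 mn0 mn1 p s =
    (\<Prod>e\<in>p. edge_norm n m00 m01 mn0 mn1 e *
      edge_wt n 1 (- inverse \<kappa>) (\<kappa>0 * \<psi>0 / \<kappa>) (- \<psi>0 / \<kappa>0) (\<kappa>n * \<psi>n / \<kappa>) (- \<psi>n / \<kappa>n) e s)"
proof -
  let ?w = "\<lambda>op. (- \<kappa>) powi (- int (orn n op)) *
        ((- \<kappa>0) powi (int (N0 n 0 op) - int (N0 n 1 op)) * \<psi>0 ^ (N0 n 0 op + N0 n 1 op)) *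
        ((- \<kappa>n) powi (int (Nn n 0 op) - int (Nn n 1 op)) * \<psi>n ^ (Nn n 0 op + Nn n 1 op))"
  let ?pair_wt = "edge_wt n 1 (- inverse \<kappa>) (\<kappa>0 * \<psi>0 / \<kappa>) (- \<psi>0 / \<kappa>0) (\<kappa>n * \<psi>n / \<kappa>) (- \<psi>n / \<kappa>n)"
  let ?I0 = "{i. {i, 0} \<in> p \<and> 1 \<le> i \<and> i \<le> n}"
  let ?In = "{i. {i, n + 1} \<in> p \<and> 1 \<le> i \<and> i \<le> n}"
  let ?A = "{(j, i). {j, i} \<in> p \<and> 1 \<le> i \<and> i < j \<and> j \<le> n}"
  let ?O = "word_orientation n p s"
  have "?A \<subseteq> {0..n} \<times> {0..n}" by auto
  then have finA: "finite ?A" by (rule finite_subset) auto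
  have "(\<Sum>op\<in>{op \<in> orientations p. spin_word n p op = s}. ?w op) = (\<Prod>e\<in>p. ?pair_wt e s)"
  proof (cases "\<forall>(j, i)\<in>?A. s ! (i - 1) \<noteq> s ! (j - 1)")
    case False
    then obtain j i where ji: "(j, i) \<in> ?A" "s ! (i - 1) = s ! (j - 1)" by auto
    have none: "{op \<in> orientations p. spin_word n p op = s} = {}"
    proof (rule ccontr)
      assume "{op \<in> orientations p. spin_word n p op = s} \<noteq> {}"
      then obtain op where op: "op \<in> orientations p" "spin_word n p op = s" by auto
      have ij: "{j, i} \<in> p" "{i, j} \<in> p" using ji by (auto simp: insert_commute)
      have "partner p i = j" "partner p j = i"
        using partner_eq[OF p ij(1)] partner_eq[OF p ij(2)] ji by auto
      moreover have "(i, partner p i) \<in> op \<longleftrightarrow> s ! (i - 1)" "(j, partner p j) \<in> op \<longleftrightarrow> s ! (j - 1)"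
        using op(2) ji(1) unfolding spin_word_eq_iff[OF s] by auto
      ultimately have "(i, j) \<in> op \<longleftrightarrow> (j, i) \<in> op" using ji(2) by simp
      then show False using orientation_flip[OF p op(1) ij(1)] by simp
    qed
    have "(\<Prod>(j, i)\<in>?A. ?pair_wt {j, i} s) = 0"
    proof (rule prod_zero[OF finA])
      have "?pair_wt {j, i} s = 0" using ji edge_wt_arc(2)[of i j n] by auto
      then show "\<exists>a\<in>?A. (case a of (j, i) \<Rightarrow> ?pair_wt {j, i} s) = 0"
        using ji(1) by (intro bexI[of _ "(j, i)"]) auto
    qed
    then show ?thesis unfolding none prod_tb_matching[OF p] by simp
  next
    case True
    then have good: "\<And>i j. {j, i} \<in> p \<Longrightarrow> 1 \<le> i \<Longrightarrow> i < j \<Longrightarrow> j \<le> n \<Longrightarrow> s ! (i - 1) \<noteq> s ! (j - 1)"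
      by auto
    have single: "{op \<in> orientations p. spin_word n p op = s} = {?O}"
    proof (intro equalityI subsetI)
      fix op assume "op \<in> {op \<in> orientations p. spin_word n p op = s}"
      then show "op \<in> {?O}" using orientation_eq_word_orientation[OF p _ s] by simp
    next
      fix op assume "op \<in> {?O}"
      then show "op \<in> {op \<in> orientations p. spin_word n p op = s}"
        using word_orientation_in_orientations[OF p s good] by simp
    qed
    have card_arc: "card {(j, i). (j, i) \<in> ?O \<and> 1 \<le> i \<and> i < j \<and> j \<le> n} =
        card {ji \<in> ?A. s ! (fst ji - 1)}"
      by (rule arg_cong[of _ _ card]) (auto simp: word_orientation_def)
    have n0: "N0 n 0 ?O = card {i \<in> ?I0. s ! (i - 1) \<and> even i}"
        "N0 n 1 ?O = card {i \<in> ?I0. s ! (i - 1) \<and> odd i}"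
      unfolding N0_def by (rule arg_cong[of _ _ card], auto simp: word_orientation_def pty_iff)+
    have nn: "Nn n 0 ?O = card {i \<in> ?In. \<not> s ! (i - 1) \<and> even (n + 1 - i)}"
        "Nn n 1 ?O = card {i \<in> ?In. \<not> s ! (i - 1) \<and> odd (n + 1 - i)}"
      unfolding Nn_def
      by (rule arg_cong[of _ _ card], auto simp: word_orientation_def pty_iff insert_commute)+
    have a: "(\<Prod>(j, i)\<in>?A. ?pair_wt {j, i} s) = (- inverse \<kappa>) ^ card {ji \<in> ?A. s ! (fst ji - 1)}"
    proof -
      have "(\<Prod>(j, i)\<in>?A. ?pair_wt {j, i} s) = (\<Prod>ji\<in>?A. if s ! (fst ji - 1) then - inverse \<kappa> else 1)"
        by (rule prod.cong[OF refl]) (use good in \<open>auto simp: edge_wt_arc\<close>)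
      then show ?thesis unfolding prod_two_values[OF finA] power_one mult_1_right .
    qed
    have b: "(\<Prod>i\<in>?I0. ?pair_wt {i, 0} s) = (\<kappa>0 * \<psi>0 / \<kappa>) ^ N0 n 0 ?O * (- \<psi>0 / \<kappa>0) ^ N0 n 1 ?O"
      unfolding edge_wt_left n0 by (rule prod_three_values) simp
    have c: "(\<Prod>i\<in>?In. ?pair_wt {i, n + 1} s) = (\<kappa>n * \<psi>n / \<kappa>) ^ Nn n 0 ?O * (- \<psi>n / \<kappa>n) ^ Nn n 1 ?O"
    proof -
      have "(\<Prod>i\<in>?In. ?pair_wt {i, n + 1} s) =
        (\<Prod>i\<in>?In. if \<not> s ! (i - 1) then (if even (n + 1 - i) then \<kappa>n * \<psi>n / \<kappa> else - \<psi>n / \<kappa>n) else 1)"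
        by (rule prod.cong[OF refl], subst edge_wt_right) auto
      also have "\<dots> = (\<kappa>n * \<psi>n / \<kappa>) ^ Nn n 0 ?O * (- \<psi>n / \<kappa>n) ^ Nn n 1 ?O"
        unfolding nn by (rule prod_three_values) simp
      finally show ?thesis .
    qed
    have pw: "(- x) powi (int k - int l) = (- x) ^ k * (- inverse x) ^ l" if "x \<noteq> 0" for x :: complex and k l
      using that by (simp add: power_int_diff power_inverse[symmetric] divide_inverse flip: inverse_minus_eq)
    have pm: "(- \<kappa>) powi (- int k) = (- inverse \<kappa>) ^ k" for k
      by (simp add: power_int_minus power_inverse[symmetric] flip: inverse_minus_eq)
    \<comment> \<open>Splits the even link weights into the factor counted by \<open>orn\<close> and
      the factor carrying \<kappa>0 or \<kappa>n, so that equal bases can be collected.\<close>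
    have c1: "x / \<kappa> = (- inverse \<kappa>) * (- x)" "- x / y = (- inverse y) * x" for x y :: complex
      by (simp_all add: divide_inverse)
    have "(\<Prod>e\<in>p. ?pair_wt e s) = ?w ?O"
      unfolding prod_tb_matching[OF p] a b c pw[OF nz(2)] pw[OF nz(3)] pm orn_def card_arc
      unfolding c1 power_mult_distrib power_add mult_minus_left[symmetric]
      by (simp add: algebra_simps)
    then show ?thesis unfolding single by simp
  qed
  then show ?thesis
    unfolding Psi_basis_def Mnorm_eq_prod[OF p] by (simp add: prod.distrib)
qed

lemma Psi_basis_eq_0:
  assumes "length s \<noteq> n"
  shows "Psi_basis n \<kappa> \<kappa>0 \<kappa>n \<psi>0 \<psi>n m00 m01 mn0 mn1 p s = 0"
proof -
  have "length (spin_word n p op) = n" for op unfolding spin_word_def by simp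
  with assms have none: "{op \<in> orientations p. spin_word n p op = s} = {}" by auto
  show ?thesis unfolding Psi_basis_def none by simp
qed

section \<open>Surgery on matchings\<close>

lemma prod_drop_one:
  fixes f :: "nat set \<Rightarrow> complex"
  assumes p: "p \<in> tb_matchings n" and k: "1 \<le> k" "k \<le> n"
  shows "(\<Prod>e\<in>p. f e) = (\<Prod>e\<in>drop_pairs p {k}. f e) * f {k, partner p k}"
proof -
  have "e \<in> drop_pairs p {k}" if "e \<in> p" "e \<noteq> {k, partner p k}" for e
    using edge_at_site[OF p that(1) _ k] that unfolding drop_pairs_def by blast
  then have "p = insert {k, partner p k} (drop_pairs p {k})"
    using partner_edge[OF p k] by (auto simp: drop_pairs_def)
  moreover have "{k, partner p k} \<notin> drop_pairs p {k}" "finite (drop_pairs p {k})"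
    using finite_tb_matching[OF p] unfolding drop_pairs_def by auto
  ultimately show ?thesis by (metis mult.commute prod.insert)
qed

lemma prod_drop_two:
  fixes f :: "nat set \<Rightarrow> complex"
  assumes p: "p \<in> tb_matchings n" and k: "1 \<le> k" "k < n" and ne: "partner p k \<noteq> k + 1"
  shows "(\<Prod>e\<in>p. f e) =
    (\<Prod>e\<in>drop_pairs p {k, k + 1}. f e) * (f {k, partner p k} * f {k + 1, partner p (k + 1)})"
proof -
  let ?N = "{{k, partner p k}, {k + 1, partner p (k + 1)}}"
  have p_eq: "p = drop_pairs p {k, k + 1} \<union> ?N"
  proof (intro equalityI subsetI)
    fix e assume e: "e \<in> p"
    have k': "1 \<le> k + 1" "k \<le> n" "k + 1 \<le> n" using k by auto
    show "e \<in> drop_pairs p {k, k + 1} \<union> ?N"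
      using edge_at_site[OF p e _ k(1) k'(2)] edge_at_site[OF p e _ k'(1,3)] e
      unfolding drop_pairs_def by (cases "k \<in> e"; cases "k + 1 \<in> e") simp_all
  next
    fix e assume "e \<in> drop_pairs p {k, k + 1} \<union> ?N"
    then show "e \<in> p"
      using partner_edge[OF p, of k] partner_edge[OF p, of "k + 1"] k by (auto simp: drop_pairs_def)
  qed
  have "prod f p = prod f (drop_pairs p {k, k + 1}) * prod f ?N"
    by (subst p_eq, rule prod.union_disjoint)
      (use finite_tb_matching[OF p] in \<open>auto simp: drop_pairs_def\<close>)
  moreover have "{k, partner p k} \<noteq> {k + 1, partner p (k + 1)}"
    using ne by (auto simp: doubleton_eq_iff)
  ultimately show ?thesis by simp
qed

lemma prod_drop_arc:
  fixes f :: "nat set \<Rightarrow> complex"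
  assumes p: "p \<in> tb_matchings n" and k: "1 \<le> k" "k < n" and eq: "partner p k = k + 1"
  shows "(\<Prod>e\<in>p. f e) = (\<Prod>e\<in>drop_pairs p {k, k + 1}. f e) * f {k, k + 1}"
proof -
  have "partner p (k + 1) = k" using partner_partner[OF p, of k] k eq by simp
  then have "drop_pairs p {k, k + 1} = drop_pairs p {k}"
    using edge_at_site[OF p, of _ "k + 1"] k unfolding drop_pairs_def by fastforce
  then show ?thesis using prod_drop_one[OF p, of k f] k eq by simp
qed

lemma edge_wt_update:
  assumes p: "p \<in> tb_matchings n" and e: "e \<in> p" and k: "k \<notin> e" "1 \<le> k"
  shows "edge_wt n u t x0 x1 y0 y1 e (s[k - 1 := c]) = edge_wt n u t x0 x1 y0 y1 e s"
proof -
  obtain i j where ij: "e = {i, j}" "i < j" "j \<le> n + 1" "0 < i \<or> j \<le> n"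
    using tb_edgeE[OF p e] by metis
  \<comment> \<open>The end \<open>i = 0\<close> has to be excluded: by truncated subtraction it
    would read the letter of site 1.\<close>
  have "s[k - 1 := c] ! (i - 1) = s ! (i - 1)" if "0 < i" using that k ij by (intro nth_list_update_neq) auto
  moreover have "s[k - 1 := c] ! (j - 1) = s ! (j - 1)" using k ij by (intro nth_list_update_neq) auto
  ultimately show ?thesis using ij by (auto simp: edge_wt_def min_def max_def)
qed

text \<open>If site 1 is linked to \<open>n + 1\<close>, opening would leave the forbidden pair
  \<open>{0, n + 1}\<close>; it is omitted, and its weight reappears as the coefficient
  \<open>\<beta>0\<close>.\<close>

lemma tb_open_left:
  assumes p: "p \<in> tb_matchings n" and n: "1 \<le> n" and m: "partner p 1 = m" "1 < m"
  shows "drop_pairs p {1} \<union> (if m = n + 1 then {{0, 1}} else {{0, 1}, {0, m}}) \<in> tb_matchings n"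
    and "drop_pairs p {1} \<inter> (if m = n + 1 then {{0, 1}} else {{0, 1}, {0, m}}) = {}"
proof -
  let ?N = "if m = n + 1 then {{0, 1}} else {{0, 1}, {0, m}}"
  have e: "{1, m} \<in> p" using partner_edge[OF p, of 1] n m by simp
  have mn: "m \<le> n + 1" using tb_pairD[OF p e] by simp
  have N: "\<exists>i j. e = {i, j} \<and> i < j \<and> j \<le> n + 1 \<and> (0 < i \<or> j \<le> n)" if "e \<in> ?N" for e
  proof -
    consider "e = {0, 1}" | "e = {0, m}" "m \<noteq> n + 1" using \<open>e \<in> ?N\<close> by (auto split: if_splits)
    then show ?thesis
    proof cases
      case 1 then show ?thesis using n by - (rule exI[of _ 0], rule exI[of _ 1], auto)
    next
      case 2 then show ?thesis using m mn by - (rule exI[of _ 0], rule exI[of _ m], auto)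
    qed
  qed
  have cov: "(\<exists>e\<in>p. i \<in> e \<and> e \<inter> {1} \<noteq> {}) \<longleftrightarrow> (\<exists>e\<in>?N. i \<in> e)" if "1 \<le> i" "i \<le> n" for i
  proof -
    have "(\<exists>e\<in>p. i \<in> e \<and> e \<inter> {1} \<noteq> {}) \<longleftrightarrow> i = 1 \<or> i = m"
    proof
      assume "\<exists>e\<in>p. i \<in> e \<and> e \<inter> {1} \<noteq> {}"
      then obtain e where "e \<in> p" "i \<in> e" "1 \<in> e" by auto
      then show "i = 1 \<or> i = m" using edge_at_site[OF p, of e 1] n m by simp
    next
      assume "i = 1 \<or> i = m"
      then show "\<exists>e\<in>p. i \<in> e \<and> e \<inter> {1} \<noteq> {}" using e by (intro bexI[OF _ e]) auto
    qed
    then show ?thesis using that by auto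
  qed
  have un: "e = f" if "1 \<le> i" "i \<le> n" "e \<in> ?N" "f \<in> ?N" "i \<in> e" "i \<in> f" for i e f
    using that m(2) by (auto split: if_splits)
  have nc: "noncrossing (drop_pairs p {1} \<union> ?N)"
    by (rule noncrossing_subset[OF noncrossing_open_left[OF tb_noncrossing[OF p] e]]) auto
  show "drop_pairs p {1} \<union> ?N \<in> tb_matchings n"
    by (rule tb_surgery(1)[OF p _ _ _ nc], fact N, fact cov, fact un)
  show "drop_pairs p {1} \<inter> ?N = {}"
    by (rule tb_surgery(2)[OF p _ _ _ nc], fact N, fact cov, fact un)
qed

lemma tb_open_right:
  assumes p: "p \<in> tb_matchings n" and n: "1 \<le> n" and m: "partner p n = m" "m < n"
  shows "drop_pairs p {n} \<union> (if m = 0 then {{n, n + 1}} else {{n, n + 1}, {m, n + 1}}) \<in> tb_matchings n"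
    and "drop_pairs p {n} \<inter> (if m = 0 then {{n, n + 1}} else {{n, n + 1}, {m, n + 1}}) = {}"
proof -
  let ?N = "if m = 0 then {{n, n + 1}} else {{n, n + 1}, {m, n + 1}}"
  have e: "{n, m} \<in> p" using partner_edge[OF p, of n] n m by simp
  have N: "\<exists>i j. e = {i, j} \<and> i < j \<and> j \<le> n + 1 \<and> (0 < i \<or> j \<le> n)" if "e \<in> ?N" for e
  proof -
    consider "e = {n, n + 1}" | "e = {m, n + 1}" "m \<noteq> 0" using \<open>e \<in> ?N\<close> by (auto split: if_splits)
    then show ?thesis
    proof cases
      case 1 then show ?thesis using n by - (rule exI[of _ n], rule exI[of _ "n + 1"], auto)
    next
      case 2 then show ?thesis using m by - (rule exI[of _ m], rule exI[of _ "n + 1"], auto)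
    qed
  qed
  have cov: "(\<exists>e\<in>p. i \<in> e \<and> e \<inter> {n} \<noteq> {}) \<longleftrightarrow> (\<exists>e\<in>?N. i \<in> e)" if "1 \<le> i" "i \<le> n" for i
  proof -
    have "(\<exists>e\<in>p. i \<in> e \<and> e \<inter> {n} \<noteq> {}) \<longleftrightarrow> i = n \<or> i = m"
    proof
      assume "\<exists>e\<in>p. i \<in> e \<and> e \<inter> {n} \<noteq> {}"
      then obtain e where "e \<in> p" "i \<in> e" "n \<in> e" by auto
      then show "i = n \<or> i = m" using edge_at_site[OF p, of e n] n m by simp
    next
      assume "i = n \<or> i = m"
      then show "\<exists>e\<in>p. i \<in> e \<and> e \<inter> {n} \<noteq> {}" using e by (intro bexI[OF _ e]) auto
    qed
    then show ?thesis using that by auto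
  qed
  have un: "e = f" if "1 \<le> i" "i \<le> n" "e \<in> ?N" "f \<in> ?N" "i \<in> e" "i \<in> f" for i e f
    using that m(2) by (auto split: if_splits)
  have le: "i \<le> n + 1" if "e \<in> p" "i \<in> e" for e i using tb_subset_Pow[OF p] that by fastforce
  have nc: "noncrossing (drop_pairs p {n} \<union> ?N)"
    by (rule noncrossing_subset[OF noncrossing_open_right[OF tb_noncrossing[OF p] e le]]) auto
  show "drop_pairs p {n} \<union> ?N \<in> tb_matchings n"
    by (rule tb_surgery(1)[OF p _ _ _ nc], fact N, fact cov, fact un)
  show "drop_pairs p {n} \<inter> ?N = {}"
    by (rule tb_surgery(2)[OF p _ _ _ nc], fact N, fact cov, fact un)
qed

text \<open>One construction serves all clauses of a bulk generator: the pair \<open>{a, b}\<close>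
  is omitted exactly when both loose ends are boundary points, where a scalar takes its
  place.\<close>

lemma tb_cap:
  assumes p: "p \<in> tb_matchings n" and k: "1 \<le> k" "k < n"
    and ab: "partner p k = a" "partner p (k + 1) = b" "a \<noteq> k + 1"
    and N_def: "N = (if a \<in> {0, n + 1} \<and> b \<in> {0, n + 1} then {{k, k + 1}} else {{k, k + 1}, {a, b}})"
  shows "drop_pairs p {k, k + 1} \<union> N \<in> tb_matchings n" and "drop_pairs p {k, k + 1} \<inter> N = {}"
proof -
  have ka: "{k, a} \<in> p" and kb: "{k + 1, b} \<in> p"
    using partner_edge[OF p, of k] partner_edge[OF p, of "k + 1"] k ab by auto
  have bnd: "a \<le> n + 1" "b \<le> n + 1" "a \<noteq> k" "b \<noteq> k + 1"
    using tb_pairD[OF p ka] tb_pairD[OF p kb] by auto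
  have bk: "b \<noteq> k"
    using partner_eq[OF p _ k(1), of "k + 1"] kb k ab by (auto simp: insert_commute)
  have N: "\<exists>i j. e = {i, j} \<and> i < j \<and> j \<le> n + 1 \<and> (0 < i \<or> j \<le> n)" if "e \<in> N" for e
  proof -
    consider "e = {k, k + 1}" | "e = {a, b}" "\<not> (a \<in> {0, n + 1} \<and> b \<in> {0, n + 1})"
      using \<open>e \<in> N\<close> by (auto simp: N_def split: if_splits)
    then show ?thesis
    proof cases
      case 1 then show ?thesis using k by - (rule exI[of _ k], rule exI[of _ "k + 1"], auto)
    next
      case 2
      have "a \<noteq> b"
      proof
        assume "a = b"
        then have "{k, a} = {k + 1, a}" using tb_unique[OF p ka, of "{k + 1, a}" a] kb 2(2) bnd by auto
        then show False using ab(3) by (auto simp: doubleton_eq_iff)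
      qed
      then consider "a < b" | "b < a" by linarith
      then show ?thesis
      proof cases
        assume "a < b"
        with 2 bnd show ?thesis by - (rule exI[of _ a], rule exI[of _ b], auto)
      next
        assume "b < a"
        with 2 bnd show ?thesis by - (rule exI[of _ b], rule exI[of _ a], auto simp: insert_commute)
      qed
    qed
  qed
  have cov: "(\<exists>e\<in>p. i \<in> e \<and> e \<inter> {k, k + 1} \<noteq> {}) \<longleftrightarrow> (\<exists>e\<in>N. i \<in> e)" if i: "1 \<le> i" "i \<le> n" for i
  proof -
    have "(\<exists>e\<in>p. i \<in> e \<and> e \<inter> {k, k + 1} \<noteq> {}) \<longleftrightarrow> i \<in> {k, a} \<or> i \<in> {k + 1, b}"
    proof
      assume "\<exists>e\<in>p. i \<in> e \<and> e \<inter> {k, k + 1} \<noteq> {}"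
      then obtain e where "e \<in> p" "i \<in> e" "k \<in> e \<or> k + 1 \<in> e" by auto
      then show "i \<in> {k, a} \<or> i \<in> {k + 1, b}"
        using edge_at_site[OF p, of e k] edge_at_site[OF p, of e "k + 1"] k ab by fastforce
    next
      assume "i \<in> {k, a} \<or> i \<in> {k + 1, b}"
      then show "\<exists>e\<in>p. i \<in> e \<and> e \<inter> {k, k + 1} \<noteq> {}" using ka kb by blast
    qed
    then show ?thesis using i by (auto simp: N_def)
  qed
  have un: "e = f" if "1 \<le> i" "i \<le> n" "e \<in> N" "f \<in> N" "i \<in> e" "i \<in> f" for i e f
    using that ab(3) bk bnd by (auto simp: N_def split: if_splits)
  have nc: "noncrossing (drop_pairs p {k, k + 1} \<union> N)"
    by (rule noncrossing_subset[OF noncrossing_cap[OF tb_noncrossing[OF p] ka kb]]) (auto simp: N_def)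
  show "drop_pairs p {k, k + 1} \<union> N \<in> tb_matchings n"
    by (rule tb_surgery(1)[OF p _ _ _ nc], fact N, fact cov, fact un)
  show "drop_pairs p {k, k + 1} \<inter> N = {}"
    by (rule tb_surgery(2)[OF p _ _ _ nc], fact N, fact cov, fact un)
qed

text \<open>By planarity, two pairs leaving \<open>k\<close> and \<open>k + 1\<close> on the same
  side are nested, or both end at that boundary; on different sides, \<open>k\<close> goes left and
  \<open>k + 1\<close> goes right. The first three configurations give scalars, the other seven join
  two loose ends.\<close>

lemma adjacent_partners_cases:
  assumes p: "p \<in> tb_matchings n" and k: "1 \<le> k" "k < n"
    and ab: "partner p k = a" "partner p (k + 1) = b" "a \<noteq> k + 1"
  obtains "a = 0" "b = 0" | "a = n + 1" "b = n + 1" | "a = 0" "b = n + 1"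
    | "a = 0" "k + 1 < b" "b \<le> n" | "1 \<le> a" "a < k" "b = 0"
    | "a = n + 1" "k + 1 < b" "b \<le> n" | "1 \<le> a" "a < k" "b = n + 1"
    | "1 \<le> a" "a < k" "k + 1 < b" "b \<le> n"
    | "k + 1 < b" "b < a" "a \<le> n" | "1 \<le> b" "b < a" "a < k"
proof -
  have ka: "{k, a} \<in> p" "{a, k} \<in> p" and kb: "{k + 1, b} \<in> p" "{b, k + 1} \<in> p"
    using partner_edge[OF p, of k] partner_edge[OF p, of "k + 1"] k ab by (auto simp: insert_commute)
  have bnd: "a \<le> n + 1" "b \<le> n + 1" "a \<noteq> k" "b \<noteq> k + 1"
    using tb_pairD[OF p ka(1)] tb_pairD[OF p kb(1)] by auto
  have bk: "b \<noteq> k"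
    using partner_eq[OF p kb(2)] k ab by auto
  have ne: "a \<noteq> b \<or> a = 0 \<or> a = n + 1"
  proof (rule ccontr)
    assume "\<not> ?thesis"
    then have "{k, a} = {k + 1, a}" using tb_unique[OF p ka(1), of "{k + 1, a}" a] kb bnd by auto
    then show False using ab(3) by (auto simp: doubleton_eq_iff)
  qed
  note nest = noncrossing_nested[OF tb_noncrossing[OF p]]
  have 1: "\<not> (a < b \<and> b < k)" using nest[OF kb(2) ka(2)] by auto
  have 2: "k + 1 < a \<Longrightarrow> k < b \<and> b \<le> a" using nest[OF kb(1) ka(1)] bk by auto
  show thesis
    using 1 2 bnd bk ne ab(3) that by (smt (verit) Suc_eq_plus1 le_SucE le_antisym linorder_not_less nat_neq_iff not_less_eq_eq less_one One_nat_def)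
qed

section \<open>The intertwining relations\<close>

text \<open>The hypotheses of the theorem in solved form: \<open>M00\<close> and \<open>Mn1\<close>
  stay free, \<open>M01\<close> and \<open>Mn0\<close> are eliminated, and \<open>\<beta>0\<close>,
  \<open>\<beta>1\<close> are given separately. \<open>D0\<close> and \<open>Dn\<close> stand for
  the boundary denominators, defined by equations without division to suit
  \<open>field_simps\<close>.\<close>

locale intertwiner =
  fixes n :: nat
    and \<kappa> \<kappa>0 \<kappa>n \<psi>0 \<psi>n \<beta>0 \<beta>1 M00 M01 Mn0 Mn1 D0 Dn :: complex
  assumes n: "1 \<le> n"
    and nz: "\<kappa> \<noteq> 0" "\<kappa>0 \<noteq> 0" "\<kappa>n \<noteq> 0" "\<psi>0 \<noteq> 0" "\<psi>n \<noteq> 0" "D0 \<noteq> 0" "Dn \<noteq> 0" "M00 \<noteq> 0" "Mn1 \<noteq> 0"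
    and D0: "D0 * (\<kappa> * \<kappa>0) = \<kappa>\<^sup>2 + \<kappa>0\<^sup>2"
    and Dn: "Dn * (\<kappa> * \<kappa>n) = \<kappa>\<^sup>2 + \<kappa>n\<^sup>2"
    and M01: "M01 = 1 / (\<psi>0 * D0 * M00)"
    and Mn0: "Mn0 = 1 / (\<psi>n * Dn * Mn1)"
    and \<beta>0: "\<beta>0 = (if odd n then 1 + \<kappa>0 * \<psi>0 * \<psi>n / \<kappa>n else 1 - \<kappa>0 * \<kappa>n * \<psi>0 * \<psi>n / \<kappa>) * M00 * Mn1"
    and \<beta>1: "\<beta>1 = (if odd n then 1 + \<kappa>n * \<psi>0 * \<psi>n / \<kappa>0 else 1 - \<kappa> * \<psi>0 * \<psi>n / (\<kappa>0 * \<kappa>n)) * M01 * Mn0"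
begin

definition pair_wt :: "nat set \<Rightarrow> bool list \<Rightarrow> complex" where
  "pair_wt e s = edge_norm n M00 M01 Mn0 Mn1 e *
     edge_wt n 1 (- inverse \<kappa>) (\<kappa>0 * \<psi>0 / \<kappa>) (- \<psi>0 / \<kappa>0) (\<kappa>n * \<psi>n / \<kappa>) (- \<psi>n / \<kappa>n) e s"

definition left_wt :: "nat \<Rightarrow> bool \<Rightarrow> complex" where
  "left_wt i b = (if even i then M00 * (if b then \<kappa>0 * \<psi>0 / \<kappa> else 1) else M01 * (if b then - \<psi>0 / \<kappa>0 else 1))"

definition right_wt :: "nat \<Rightarrow> bool \<Rightarrow> complex" where
  "right_wt i b = (if even i then Mn0 else Mn1) *
     (if b then 1 else if even (n + 1 - i) then \<kappa>n * \<psi>n / \<kappa> else - \<psi>n / \<kappa>n)"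

definition arc_wt :: "bool \<Rightarrow> bool \<Rightarrow> complex" where
  "arc_wt b c = (if b = c then 0 else if b then 1 else - inverse \<kappa>)"

lemma pair_wt_left: "pair_wt {0, i} s = left_wt i (s ! (i - 1))" "pair_wt {i, 0} s = left_wt i (s ! (i - 1))"
  by (simp_all add: pair_wt_def left_wt_def edge_norm_left edge_wt_left)

lemma pair_wt_right:
  assumes "1 \<le> i" "i \<le> n"
  shows "pair_wt {i, n + 1} s = right_wt i (s ! (i - 1))" "pair_wt {n + 1, i} s = right_wt i (s ! (i - 1))"
  unfolding pair_wt_def right_wt_def edge_norm_right[OF assms] edge_wt_right[OF assms] by simp_all

lemma pair_wt_arc:
  assumes "1 \<le> i" "i < j" "j \<le> n"
  shows "pair_wt {i, j} s = arc_wt (s ! (i - 1)) (s ! (j - 1))" "pair_wt {j, i} s = arc_wt (s ! (i - 1)) (s ! (j - 1))"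
  using assms unfolding pair_wt_def arc_wt_def edge_wt_arc[OF assms] by (simp_all add: edge_norm_arc)

lemma pair_wt_update:
  assumes "p \<in> tb_matchings n" "e \<in> p" "k \<notin> e" "1 \<le> k"
  shows "pair_wt e (s[k - 1 := c]) = pair_wt e s"
  unfolding pair_wt_def edge_wt_update[OF assms] ..

definition matching_wt :: "matching \<Rightarrow> bool list \<Rightarrow> complex" where
  "matching_wt p s = (\<Prod>e\<in>p. pair_wt e s)"

lemma matching_wt_update_one:
  assumes p: "p \<in> tb_matchings n" and k: "1 \<le> k" "k \<le> n"
  shows "matching_wt p (s[k - 1 := b]) = matching_wt (drop_pairs p {k}) s * pair_wt {k, partner p k} (s[k - 1 := b])"
proof -
  have "matching_wt (drop_pairs p {k}) (s[k - 1 := b]) = matching_wt (drop_pairs p {k}) s"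
    unfolding matching_wt_def
  proof (rule prod.cong[OF refl])
    fix e assume "e \<in> drop_pairs p {k}"
    then have "e \<in> p" "k \<notin> e" unfolding drop_pairs_def by auto
    then show "pair_wt e (s[k - 1 := b]) = pair_wt e s" by (rule pair_wt_update[OF p _ _ k(1)])
  qed
  then show ?thesis unfolding matching_wt_def prod_drop_one[OF p k] by simp
qed

lemma matching_wt_drop_two_update:
  assumes p: "p \<in> tb_matchings n" and k: "1 \<le> k"
  shows "matching_wt (drop_pairs p {k, k + 1}) (s[k - 1 := b, k := c]) = matching_wt (drop_pairs p {k, k + 1}) s"
  unfolding matching_wt_def
proof (rule prod.cong[OF refl])
  fix e assume "e \<in> drop_pairs p {k, k + 1}"
  then have e: "e \<in> p" "k \<notin> e" "k + 1 \<notin> e" unfolding drop_pairs_def by auto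
  show "pair_wt e (s[k - 1 := b, k := c]) = pair_wt e s"
    using pair_wt_update[OF p e(1,3), of "s[k - 1 := b]" c] pair_wt_update[OF p e(1,2) k, of s b] by simp
qed

lemma matching_wt_union:
  assumes "q = drop_pairs p S \<union> N" "drop_pairs p S \<inter> N = {}" "p \<in> tb_matchings n" "finite N"
  shows "matching_wt q s = matching_wt (drop_pairs p S) s * (\<Prod>e\<in>N. pair_wt e s)"
proof -
  have "finite (drop_pairs p S)" using finite_tb_matching[OF assms(3)] unfolding drop_pairs_def by simp
  then show ?thesis unfolding matching_wt_def assms(1) by (rule prod.union_disjoint) fact+
qed

abbreviation "\<delta> \<equiv> - (\<kappa> + inverse \<kappa>)"
abbreviation "\<delta>0 \<equiv> - (\<kappa>0 + inverse \<kappa>0) / D0"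
abbreviation "\<delta>n \<equiv> - (\<kappa>n + inverse \<kappa>n) / Dn"
abbreviation "gen \<equiv> mm_gen n \<delta> \<delta>0 \<delta>n \<beta>0 \<beta>1"

text \<open>The matrix of each generator has rank one, its image being spanned by the vector of the arc
  or link which the generator creates. So each intertwining relation reduces to a scalar identity.\<close>

lemma left_boundary_factors:
  "inverse D0 * mat2 (- inverse \<kappa>0) \<psi>0 (inverse \<psi>0) (- \<kappa>0) r c =
    left_wt 1 r * (\<psi>0 * M00 * (if c then inverse \<psi>0 else - \<kappa>0))"
  using nz unfolding left_wt_def unfolding M01 by (cases r; cases c) (auto simp: mat2_def field_simps)

text \<open>The image vector \<open>right_wt n\<close> carries \<open>Mn0\<close> or
  \<open>Mn1\<close> according to the parity of \<open>n\<close>. The functional takes the other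
  one, because \<open>Mn0 * Mn1 * \<psi>n\<close> equals \<open>inverse Dn\<close>. On the left no
  case distinction arises, site 1 being odd.\<close>

lemma right_boundary_factors:
  "inverse Dn * mat2 (- \<kappa>n) (inverse \<psi>n) \<psi>n (- inverse \<kappa>n) r c =
    right_wt n r * ((if even n then Mn1 else Mn0) * \<psi>n * (if c then - \<kappa>n else inverse \<psi>n))"
  using nz unfolding right_wt_def unfolding Mn0 by (cases r; cases c; cases "even n") (auto simp: mat2_def field_simps)

lemma bulk_factors:
  "tl_mat \<kappa> (r, r') (c, c') = arc_wt r r' * (if c = c' then 0 else if c then - \<kappa> else 1)"
  using nz by (cases r; cases r'; cases c; cases c') (auto simp: tl_mat_def arc_wt_def)

text \<open>Origin of the formula for \<open>\<beta>0\<close>: the left functional is evaluated on a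
  right link at site 1, whose distance to \<open>n + 1\<close> is \<open>n\<close>. This is why the
  parity of \<open>n\<close> decides between the two forms.\<close>

lemma left_link_right:
  assumes "1 \<le> n"
  shows "\<beta>0 = \<psi>0 * M00 * (inverse \<psi>0 * right_wt 1 True - \<kappa>0 * right_wt 1 False)"
  using nz assms by (auto simp: \<beta>0 right_wt_def field_simps)

text \<open>A rank one matrix has as eigenvalue on its image the value of its functional on its
  image vector, that is, its trace.\<close>

lemma left_link_left:
  "\<delta>0 = \<psi>0 * M00 * (inverse \<psi>0 * left_wt 1 True - \<kappa>0 * left_wt 1 False)"
  using nz unfolding left_wt_def unfolding M01 by (auto simp: field_simps)

text \<open>The functional contributes \<open>M00\<close>, so the new link at \<open>m\<close> has
  the right normalization only for even \<open>m\<close>. The same parity selects the letter weight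
  \<open>\<kappa>0 * \<psi>0 / \<kappa>\<close>.\<close>

lemma left_link_arc:
  assumes "even m"
  shows "left_wt m b = \<psi>0 * M00 * (inverse \<psi>0 * arc_wt True b - \<kappa>0 * arc_wt False b)"
  using nz assms by (auto simp: left_wt_def arc_wt_def field_simps)

text \<open>For even \<open>n\<close> this recovers the same \<open>\<beta>0\<close> as the left
  generator does; for odd \<open>n\<close> it involves the complementary product
  \<open>M01 * Mn0\<close> and gives \<open>\<beta>1\<close>.\<close>

lemma right_link_left:
  "(if even n then \<beta>0 else \<beta>1) = (if even n then Mn1 else Mn0) * \<psi>n * (- \<kappa>n * left_wt n True + inverse \<psi>n * left_wt n False)"
  using nz by (auto simp: \<beta>0 \<beta>1 left_wt_def field_simps)

lemma right_link_right:
  "\<delta>n = (if even n then Mn1 else Mn0) * \<psi>n * (- \<kappa>n * right_wt n True + inverse \<psi>n * right_wt n False)"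
  using nz unfolding right_wt_def unfolding Mn0 by (auto simp: field_simps)

lemma right_link_arc:
  assumes "1 \<le> m" "m \<le> n" "even n \<longleftrightarrow> odd m"
  shows "right_wt m b = (if even n then Mn1 else Mn0) * \<psi>n * (- \<kappa>n * arc_wt b True + inverse \<psi>n * arc_wt b False)"
  using nz assms by (auto simp: right_wt_def arc_wt_def field_simps)

text \<open>Neighbouring sites have opposite parity, so \<open>M00 * M01\<close> factors out. For
  odd \<open>k\<close> the rest is \<open>\<psi>0 * D0\<close>, which cancels to 1; for even
  \<open>k\<close> it is \<open>- \<psi>0 * (\<kappa>0 + inverse \<kappa>0)\<close>, which gives
  \<open>\<delta>0\<close>.\<close>

lemma bulk_left_left:
  "\<delta>0 ^ pty (k - 1) = - \<kappa> * (left_wt k True * left_wt (k + 1) False) + left_wt k False * left_wt (k + 1) True" if "1 \<le> k"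
proof -
  have "pty (k - 1) = (if even k then 1 else 0)" using that by (auto simp: pty_def) presburger
  then show ?thesis using nz D0 unfolding left_wt_def unfolding M01
    by (auto simp: field_simps power2_eq_square)
qed

lemma bulk_right_right:
  assumes "1 \<le> k" "k < n"
  shows "\<delta>n ^ pty (n + 1 - k) = - \<kappa> * (right_wt k True * right_wt (k + 1) False) + right_wt k False * right_wt (k + 1) True"
proof -
  have E: "even (n + 1 - k) \<longleftrightarrow> (even n \<longleftrightarrow> odd k)" "even (n + 1 - (k + 1)) \<longleftrightarrow> (even n \<longleftrightarrow> even k)"
    using assms by auto
  have "pty (n + 1 - k) = (if even n \<longleftrightarrow> odd k then 0 else 1)"
    unfolding E[symmetric] by (simp add: pty_def) presburger
  \<comment> \<open>The defining equation of \<open>Dn\<close> multiplied by \<psi>n, in the shape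
    to which \<open>field_simps\<close> brings the goal.\<close>
  moreover have "Dn * (\<kappa> * (\<kappa>n * \<psi>n)) = \<kappa> * (\<kappa> * \<psi>n) + \<kappa>n * (\<kappa>n * \<psi>n)"
    using arg_cong[OF Dn, of "\<lambda>z. z * \<psi>n"] by (simp add: algebra_simps power2_eq_square)
  ultimately show ?thesis using nz Dn unfolding right_wt_def E unfolding Mn0
    by (auto simp: field_simps power2_eq_square)
qed

text \<open>Even \<open>k\<close> pairs \<open>M00\<close> with \<open>Mn1\<close>, odd
  \<open>k\<close> pairs \<open>M01\<close> with \<open>Mn0\<close>. Hence the coefficient depends
  only on the parity of \<open>k\<close>, and both values of \<beta> arise from the same
  computation.\<close>

lemma bulk_left_right:
  assumes "1 \<le> k" "k < n"
  shows "(if pty k = 0 then \<beta>0 else \<beta>1) = - \<kappa> * (left_wt k True * right_wt (k + 1) False) + left_wt k False * right_wt (k + 1) True"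
proof -
  have "even (n + 1 - (k + 1)) \<longleftrightarrow> (even n \<longleftrightarrow> even k)" using assms by auto
  then show ?thesis using nz unfolding pty_iff by (auto simp: \<beta>0 \<beta>1 left_wt_def right_wt_def field_simps)
qed

text \<open>Zigzag identity: contracting the functional of a generator with one end of an arc
  carries \<open>f\<close> to the other end. As \<open>f\<close> is arbitrary, it covers links and
  arcs alike.\<close>

lemma arc_wt_pull_right: "- \<kappa> * (f True * arc_wt False z) + f False * arc_wt True z = f z"
  using nz by (simp add: arc_wt_def)

lemma arc_wt_pull_left: "- \<kappa> * (arc_wt z True * f False) + arc_wt z False * f True = f z"
  using nz by (simp add: arc_wt_def)

text \<open>Needed when a link is carried along an arc: the ends of the arc have opposite parity and
  \<open>k\<close>, \<open>k + 1\<close> are adjacent, so the link moves between sites of equal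
  parity.\<close>

lemma left_wt_cong: "(even i \<longleftrightarrow> even j) \<Longrightarrow> left_wt i = left_wt j"
  by (simp add: left_wt_def fun_eq_iff)

lemma right_wt_cong: "(even i \<longleftrightarrow> even j) \<Longrightarrow> i \<le> n \<Longrightarrow> j \<le> n \<Longrightarrow> right_wt i = right_wt j"
  by (auto simp: right_wt_def fun_eq_iff)

section \<open>The generators act compatibly on single matchings\<close>

text \<open>The factor \<open>R\<close> of the pairs away from site 1 and the image vector
  \<open>left_wt 1\<close> split off. What remains is the functional of
  \<open>left_boundary_factors\<close> applied to the pair at site 1: a left link, a right link or
  an arc, one for each clause of the generator.\<close>

lemma gen_left:
  assumes p: "p \<in> tb_matchings n" and s: "length s = n"
  shows "snd (gen 0 p) \<in> tb_matchings n"
    and "fst (gen 0 p) * matching_wt (snd (gen 0 p)) s =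
      leg1 n 1 (\<lambda>r c. inverse D0 * mat2 (- inverse \<kappa>0) \<psi>0 (inverse \<psi>0) (- \<kappa>0) r c) (matching_wt p) s"
proof -
  define m where "m = partner p 1"
  define R where "R = matching_wt (drop_pairs p {1}) s"
  have n': "1 \<le> (1::nat)" by simp
  have s0: "s[0 := b] ! 0 = b" for b using s n by simp
  have e: "{1, m} \<in> p" unfolding m_def by (rule partner_edge[OF p n' n])
  have bnd: "m \<noteq> 1" "m \<le> n + 1" using tb_pairD[OF p e] by auto
  have upd: "matching_wt p (s[0 := b]) = R * pair_wt {1, m} (s[0 := b])" for b
    using matching_wt_update_one[OF p n' n, of s b] unfolding R_def m_def by simp
  have leg: "leg1 n 1 (\<lambda>r c. inverse D0 * mat2 (- inverse \<kappa>0) \<psi>0 (inverse \<psi>0) (- \<kappa>0) r c) (matching_wt p) s =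
      R * left_wt 1 (s ! 0) * (\<psi>0 * M00 * (inverse \<psi>0 * pair_wt {1, m} (s[0 := True]) - \<kappa>0 * pair_wt {1, m} (s[0 := False])))"
    unfolding leg1_def left_boundary_factors using s by (simp add: UNIV_bool upd algebra_simps)
  consider "m = 0" | "m = n + 1" | "1 < m" "m \<le> n" using bnd by linarith
  then have "snd (gen 0 p) \<in> tb_matchings n \<and> fst (gen 0 p) * matching_wt (snd (gen 0 p)) s =
      leg1 n 1 (\<lambda>r c. inverse D0 * mat2 (- inverse \<kappa>0) \<psi>0 (inverse \<psi>0) (- \<kappa>0) r c) (matching_wt p) s"
  proof cases
    case 1
    have g: "gen 0 p = (\<delta>0, p)" using 1 unfolding m_def mm_gen_def by simp
    have "matching_wt p s = R * left_wt 1 (s ! 0)" using upd[of "s ! 0"] 1 by (simp add: pair_wt_left)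
    then show ?thesis unfolding g leg using p left_link_left 1 by (simp add: pair_wt_left s0)
  next
    case 2
    let ?q = "drop_pairs p {1} \<union> {{0, 1}}"
    have g: "gen 0 p = (\<beta>0, ?q)" using 2 unfolding m_def mm_gen_def by simp
    have q: "?q \<in> tb_matchings n" "drop_pairs p {1} \<inter> {{0, 1}} = {}"
      using tb_open_left[OF p n m_def[symmetric]] 2 n by auto
    have "matching_wt ?q s = R * left_wt 1 (s ! 0)"
      using matching_wt_union[OF refl q(2) p] by (simp add: R_def pair_wt_left)
    moreover have "pair_wt {1, m} (s[0 := b]) = right_wt 1 b" for b using pair_wt_right(1)[OF n' n] s0 2 by simp
    ultimately show ?thesis unfolding g leg using q(1) left_link_right[OF n] by simp
  next
    case 3
    let ?q = "drop_pairs p {1} \<union> {{0, 1}, {0, m}}"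
    have g: "gen 0 p = (1, ?q)" using 3 unfolding m_def mm_gen_def by simp
    have q: "?q \<in> tb_matchings n" "drop_pairs p {1} \<inter> {{0, 1}, {0, m}} = {}"
      using tb_open_left[OF p n m_def[symmetric]] 3 by auto
    have "{0::nat, 1} \<noteq> {0, m}" using 3 by (auto simp: doubleton_eq_iff)
    then have "matching_wt ?q s = R * (left_wt 1 (s ! 0) * left_wt m (s ! (m - 1)))"
      using matching_wt_union[OF refl q(2) p] by (simp add: R_def pair_wt_left)
    moreover have "pair_wt {1, m} (s[0 := b]) = arc_wt b (s ! (m - 1))" for b
      using pair_wt_arc(1)[of 1 m "s[0 := b]"] s0 3 by simp
    moreover have "even m" using arc_parity[OF p e] 3 by auto
    ultimately show ?thesis unfolding g leg using q(1) left_link_arc[of m "s ! (m - 1)"] by simp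
  qed
  then show "snd (gen 0 p) \<in> tb_matchings n"
    and "fst (gen 0 p) * matching_wt (snd (gen 0 p)) s =
      leg1 n 1 (\<lambda>r c. inverse D0 * mat2 (- inverse \<kappa>0) \<psi>0 (inverse \<psi>0) (- \<kappa>0) r c) (matching_wt p) s"
    by blast+
qed

lemma gen_right:
  assumes p: "p \<in> tb_matchings n" and s: "length s = n"
  shows "snd (gen n p) \<in> tb_matchings n"
    and "fst (gen n p) * matching_wt (snd (gen n p)) s =
      leg1 n n (\<lambda>r c. inverse Dn * mat2 (- \<kappa>n) (inverse \<psi>n) \<psi>n (- inverse \<kappa>n) r c) (matching_wt p) s"
proof -
  define m where "m = partner p n"
  define R where "R = matching_wt (drop_pairs p {n}) s"
  define Z where "Z = (if even n then Mn1 else Mn0) * \<psi>n"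
  have n': "n \<noteq> 0" "n - 1 < n" using n by auto
  have s0: "s[n - 1 := b] ! (n - 1) = b" for b using s n by simp
  have e: "{n, m} \<in> p" unfolding m_def by (rule partner_edge[OF p n order_refl])
  have bnd: "m \<noteq> n" "m \<le> n + 1" using tb_pairD[OF p e] by auto
  have upd: "matching_wt p (s[n - 1 := b]) = R * pair_wt {n, m} (s[n - 1 := b])" for b
    using matching_wt_update_one[OF p n order_refl, of s b] unfolding R_def m_def by simp
  have leg: "leg1 n n (\<lambda>r c. inverse Dn * mat2 (- \<kappa>n) (inverse \<psi>n) \<psi>n (- inverse \<kappa>n) r c) (matching_wt p) s =
      R * right_wt n (s ! (n - 1)) * (Z * (- \<kappa>n * pair_wt {n, m} (s[n - 1 := True]) + inverse \<psi>n * pair_wt {n, m} (s[n - 1 := False])))"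
    unfolding leg1_def right_boundary_factors Z_def[symmetric] using s
    by (simp add: UNIV_bool upd[unfolded One_nat_def] algebra_simps)
  consider "m = n + 1" | "m = 0" | "1 \<le> m" "m < n" using bnd by linarith
  then have "snd (gen n p) \<in> tb_matchings n \<and> fst (gen n p) * matching_wt (snd (gen n p)) s =
      leg1 n n (\<lambda>r c. inverse Dn * mat2 (- \<kappa>n) (inverse \<psi>n) \<psi>n (- inverse \<kappa>n) r c) (matching_wt p) s"
  proof cases
    case 1
    have g: "gen n p = (\<delta>n, p)" using 1 n' unfolding m_def mm_gen_def by simp
    have w: "pair_wt {n, m} t = right_wt n (t ! (n - 1))" for t using pair_wt_right(1)[OF n order_refl] 1 by simp
    have "matching_wt p s = R * right_wt n (s ! (n - 1))" using upd[of "s ! (n - 1)"] w by simp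
    then show ?thesis
      unfolding g leg w s0 Z_def using p right_link_right by simp
  next
    case 2
    let ?q = "drop_pairs p {n} \<union> {{n, n + 1}}"
    have g: "gen n p = ((if even n then \<beta>0 else \<beta>1), ?q)"
      using 2 n' unfolding m_def mm_gen_def Let_def by (simp add: pty_iff)
    have q: "?q \<in> tb_matchings n" "drop_pairs p {n} \<inter> {{n, n + 1}} = {}"
      using tb_open_right[OF p n m_def[symmetric]] 2 n by auto
    have w: "pair_wt {n, m} t = left_wt n (t ! (n - 1))" for t using pair_wt_left 2 by simp
    have "matching_wt ?q s = R * right_wt n (s ! (n - 1))"
      using matching_wt_union[OF refl q(2) p] pair_wt_right(1)[OF n order_refl] by (simp add: R_def)
    then show ?thesis unfolding g leg w s0 Z_def using q(1) right_link_left by simp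
  next
    case 3
    let ?q = "drop_pairs p {n} \<union> {{n, n + 1}, {m, n + 1}}"
    have g: "gen n p = (1, ?q)" using 3 n' unfolding m_def mm_gen_def by simp
    have q: "?q \<in> tb_matchings n" "drop_pairs p {n} \<inter> {{n, n + 1}, {m, n + 1}} = {}"
      using tb_open_right[OF p n m_def[symmetric]] 3 by auto
    have "{n, n + 1} \<noteq> {m, n + 1}" using 3 by (auto simp: doubleton_eq_iff)
    then have "matching_wt ?q s = R * (right_wt n (s ! (n - 1)) * right_wt m (s ! (m - 1)))"
      using matching_wt_union[OF refl q(2) p] pair_wt_right(1)[OF n order_refl] pair_wt_right(1)[of m] 3
      by (simp add: R_def)
    moreover have "pair_wt {n, m} (s[n - 1 := b]) = arc_wt (s ! (m - 1)) b" for b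
      using pair_wt_arc(2)[of m n "s[n - 1 := b]"] s0 3 by simp
    moreover have "even n \<longleftrightarrow> odd m" using arc_parity[OF p, of m n] e 3 by (auto simp: insert_commute)
    ultimately show ?thesis unfolding g leg Z_def
      using q(1) right_link_arc[of m "s ! (m - 1)"] 3 by simp
  qed
  then show "snd (gen n p) \<in> tb_matchings n"
    and "fst (gen n p) * matching_wt (snd (gen n p)) s =
      leg1 n n (\<lambda>r c. inverse Dn * mat2 (- \<kappa>n) (inverse \<psi>n) \<psi>n (- inverse \<kappa>n) r c) (matching_wt p) s"
    by blast+
qed

text \<open>Only the words \<open>t True False\<close> and \<open>t False True\<close> contribute,
  \<open>t x y\<close> being \<open>s\<close> with the letters at \<open>k\<close> and
  \<open>k + 1\<close> replaced. With \<open>R\<close> and the new arc's weight \<open>X\<close>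
  split off, each configuration becomes an identity for the weight \<open>G\<close> of the two
  removed pairs.\<close>

lemma gen_bulk:
  assumes p: "p \<in> tb_matchings n" and s: "length s = n" and k: "1 \<le> k" "k < n"
  shows "snd (gen k p) \<in> tb_matchings n"
    and "fst (gen k p) * matching_wt (snd (gen k p)) s = leg2 n k (tl_mat \<kappa>) (matching_wt p) s"
proof -
  define a where "a = partner p k"
  define b where "b = partner p (k + 1)"
  define R where "R = matching_wt (drop_pairs p {k, k + 1}) s"
  define t where "t = (\<lambda>x y. s[k - 1 := x, k := y])"
  define X where "X = arc_wt (s ! (k - 1)) (s ! k)"
  have tk: "t x y ! (k - 1) = x" "t x y ! k = y" for x y
    using s k by (auto simp: t_def nth_list_update)
  have tj: "t x y ! (j - 1) = s ! (j - 1)" if "1 \<le> j" "j < k \<or> k + 1 < j" for x y j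
    using that k by (auto simp: t_def nth_list_update_neq)
  have kk: "k \<noteq> 0" "k \<noteq> n" using k by auto
  have ka: "{k, a} \<in> p" "{a, k} \<in> p" and kb: "{k + 1, b} \<in> p" "{b, k + 1} \<in> p"
    using partner_edge[OF p, of k] partner_edge[OF p, of "k + 1"] k a_def b_def by (auto simp: insert_commute)
  have leg: "leg2 n k (tl_mat \<kappa>) (matching_wt p) s = X * (- \<kappa> * matching_wt p (t True False) + matching_wt p (t False True))"
    unfolding leg2_def bulk_factors using s by (simp add: UNIV_bool X_def t_def algebra_simps)
  have Xw: "pair_wt {k, k + 1} s = X" using pair_wt_arc(1)[of k "k + 1" s] k by (simp add: X_def)
  have "snd (gen k p) \<in> tb_matchings n \<and>
    fst (gen k p) * matching_wt (snd (gen k p)) s = leg2 n k (tl_mat \<kappa>) (matching_wt p) s"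
  proof (cases "a = k + 1")
    \<comment> \<open>The arc is already present. Its two admissible letter patterns contribute
      \<open>- \<kappa> * 1\<close> and \<open>- inverse \<kappa>\<close>, which add up to the loop
      value \<delta>.\<close>
    case True
    have g: "gen k p = (\<delta>, p)" using True kk unfolding a_def mm_gen_def by simp
    have pr: "matching_wt p u = matching_wt (drop_pairs p {k, k + 1}) u * arc_wt (u ! (k - 1)) (u ! k)" for u
      using prod_drop_arc[OF p k] True pair_wt_arc(1)[of k "k + 1" u] k unfolding matching_wt_def a_def by simp
    have "matching_wt p (t x y) = R * arc_wt x y" for x y
      using pr[of "t x y"] matching_wt_drop_two_update[OF p k(1), of s x y] tk by (simp add: R_def t_def)
    then show ?thesis unfolding g leg
      using p pr[of s] nz by (simp add: R_def X_def arc_wt_def algebra_simps)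
  next
    case ne: False
    have mwp: "matching_wt p (t x y) = R * (pair_wt {k, a} (t x y) * pair_wt {k + 1, b} (t x y))" for x y
      using prod_drop_two[OF p k] ne matching_wt_drop_two_update[OF p k(1), of s x y]
      unfolding matching_wt_def a_def b_def by (simp add: R_def t_def matching_wt_def)
    define G where "G = (\<lambda>x y. pair_wt {k, a} (t x y) * pair_wt {k + 1, b} (t x y))"
    have leg': "leg2 n k (tl_mat \<kappa>) (matching_wt p) s = R * X * (- \<kappa> * G True False + G False True)"
      unfolding leg mwp G_def by (simp add: algebra_simps)
    let ?q1 = "drop_pairs p {k, k + 1} \<union> {{k, k + 1}}"
    let ?q2 = "drop_pairs p {k, k + 1} \<union> {{k, k + 1}, {a, b}}"
    \<comment> \<open>Both loose ends lie on the boundary: no pair is created and the contraction of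
      \<open>G\<close> must be the scalar coefficient.\<close>
    have case1: ?thesis
      if "a \<in> {0, n + 1}" "b \<in> {0, n + 1}" "gen k p = (c, ?q1)" "c = - \<kappa> * G True False + G False True" for c
    proof -
      have q: "?q1 \<in> tb_matchings n" "drop_pairs p {k, k + 1} \<inter> {{k, k + 1}} = {}"
        using tb_cap[OF p k a_def[symmetric] b_def[symmetric] ne refl] that by auto
      have "matching_wt ?q1 s = R * X" using matching_wt_union[OF refl q(2) p] Xw by (simp add: R_def)
      then show ?thesis using that(3,4) q(1) leg' by simp
    qed
    \<comment> \<open>At least one loose end is a site: the coefficient is 1 and the contraction of
      \<open>G\<close> must be the weight of the joined pair.\<close>
    have case2: ?thesis
      if i: "1 \<le> a \<and> a \<le> n \<or> 1 \<le> b \<and> b \<le> n"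
        and G: "pair_wt {a, b} s = - \<kappa> * G True False + G False True"
    proof -
      have g: "gen k p = (1, ?q2)" using i ne kk unfolding a_def b_def mm_gen_def by auto
      have q: "?q2 \<in> tb_matchings n" "drop_pairs p {k, k + 1} \<inter> {{k, k + 1}, {a, b}} = {}"
        using tb_cap[OF p k a_def[symmetric] b_def[symmetric] ne refl] i by auto
      have "{k, k + 1} \<noteq> {a, b}" using ne tb_pairD[OF p ka(1)] by (auto simp: doubleton_eq_iff)
      then have "matching_wt ?q2 s = R * (X * pair_wt {a, b} s)" using matching_wt_union[OF refl q(2) p] Xw by (simp add: R_def)
      then show ?thesis using g q(1) leg' G by simp
    qed
    have wkR: "pair_wt {k, n + 1} u = right_wt k (u ! (k - 1))" "pair_wt {k + 1, n + 1} u = right_wt (k + 1) (u ! k)" for u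
      using pair_wt_right(1)[of k u] pair_wt_right(1)[of "k + 1" u] k by simp_all
    have wkL: "pair_wt {k, 0} u = left_wt k (u ! (k - 1))" "pair_wt {k + 1, 0} u = left_wt (k + 1) (u ! k)" for u
      using pair_wt_left(2)[of k u] pair_wt_left(2)[of "k + 1" u] by simp_all
    from p k a_def[symmetric] b_def[symmetric] ne show ?thesis
    proof (rule adjacent_partners_cases)
      assume ab: "a = 0" "b = 0"
      have g: "gen k p = (\<delta>0 ^ pty (k - 1), ?q1)"
        using ab ne kk unfolding a_def b_def mm_gen_def by simp
      show ?thesis
        by (rule case1[OF _ _ g], simp add: ab, simp add: ab, simp only: ab G_def wkL tk bulk_left_left[OF k(1)])
    next
      assume ab: "a = n + 1" "b = n + 1"
      have g: "gen k p = (\<delta>n ^ pty (n + 1 - k), ?q1)"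
        using ab ne kk unfolding a_def b_def mm_gen_def by simp
      show ?thesis
        by (rule case1[OF _ _ g], simp add: ab, simp add: ab, simp only: ab G_def wkR tk bulk_right_right[OF k])
    next
      assume ab: "a = 0" "b = n + 1"
      have g: "gen k p = ((if pty k = 0 then \<beta>0 else \<beta>1), ?q1)"
        using ab ne kk unfolding a_def b_def mm_gen_def Let_def by simp
      show ?thesis
        by (rule case1[OF _ _ g], simp add: ab, simp add: ab,
            simp only: ab G_def wkR wkL tk bulk_left_right[OF k])
    next
      assume ab: "a = 0" "k + 1 < b" "b \<le> n"
      have w: "pair_wt {k + 1, b} u = arc_wt (u ! k) (u ! (b - 1))" for u using pair_wt_arc(1)[of "k + 1" b u] ab by simp
      have "even (k + 1) \<longleftrightarrow> odd b" using arc_parity[OF p kb(1)] ab by simp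
      then have par: "left_wt k = left_wt b" by (intro left_wt_cong) auto
      have "G x y = left_wt k x * arc_wt y (s ! (b - 1))" for x y unfolding G_def ab(1) w wkL tk using ab by (simp add: tj[unfolded One_nat_def])
      then show ?thesis
        using ab by (intro case2) (simp_all only: arc_wt_pull_right pair_wt_left par, simp)
    next
      assume ab: "1 \<le> a" "a < k" "b = 0"
      have w: "pair_wt {k, a} u = arc_wt (u ! (a - 1)) (u ! (k - 1))" for u using pair_wt_arc(2)[of a k u] ab k by simp
      have "even a \<longleftrightarrow> odd k" using arc_parity[OF p ka(2)] ab k by simp
      then have par: "left_wt (k + 1) = left_wt a" by (intro left_wt_cong) auto
      have "G x y = arc_wt (s ! (a - 1)) x * left_wt (k + 1) y" for x y unfolding G_def ab(3) w wkL tk using ab by (simp add: tj[unfolded One_nat_def])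
      then show ?thesis
        using ab k by (intro case2) (simp_all only: arc_wt_pull_left pair_wt_left par, simp)
    next
      assume ab: "a = n + 1" "k + 1 < b" "b \<le> n"
      have w: "pair_wt {k + 1, b} u = arc_wt (u ! k) (u ! (b - 1))" for u using pair_wt_arc(1)[of "k + 1" b u] ab by simp
      have "even (k + 1) \<longleftrightarrow> odd b" using arc_parity[OF p kb(1)] ab by simp
      then have par: "right_wt k = right_wt b" using k ab by (intro right_wt_cong) auto
      have G: "G x y = right_wt k x * arc_wt y (s ! (b - 1))" for x y
        unfolding G_def ab(1) w wkR tk using ab by (simp add: tj[unfolded One_nat_def])
      show ?thesis
      proof (rule case2)
        show "pair_wt {a, b} s = - \<kappa> * G True False + G False True"
          unfolding G arc_wt_pull_right ab(1) par using pair_wt_right(2)[of b s] ab by simp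
      qed (use ab in auto)
    next
      assume ab: "1 \<le> a" "a < k" "b = n + 1"
      have w: "pair_wt {k, a} u = arc_wt (u ! (a - 1)) (u ! (k - 1))" for u using pair_wt_arc(2)[of a k u] ab k by simp
      have "even a \<longleftrightarrow> odd k" using arc_parity[OF p ka(2)] ab k by simp
      then have par: "right_wt (k + 1) = right_wt a" using k ab by (intro right_wt_cong) auto
      have G: "G x y = arc_wt (s ! (a - 1)) x * right_wt (k + 1) y" for x y
        unfolding G_def ab(3) w wkR tk using ab by (simp add: tj[unfolded One_nat_def])
      show ?thesis
      proof (rule case2)
        show "pair_wt {a, b} s = - \<kappa> * G True False + G False True"
          unfolding G arc_wt_pull_left ab(3) par using pair_wt_right(1)[of a s] ab k by simp
      qed (use ab k in auto)
    next
      assume ab: "1 \<le> a" "a < k" "k + 1 < b" "b \<le> n"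
      have w: "pair_wt {k, a} u = arc_wt (u ! (a - 1)) (u ! (k - 1))" for u using pair_wt_arc(2)[of a k u] ab k by simp
      have w': "pair_wt {k + 1, b} u = arc_wt (u ! k) (u ! (b - 1))" for u using pair_wt_arc(1)[of "k + 1" b u] ab by simp
      have G: "G x y = arc_wt (s ! (a - 1)) x * arc_wt y (s ! (b - 1))" for x y
        unfolding G_def w w' tk using ab by (simp add: tj[unfolded One_nat_def])
      show ?thesis
      proof (rule case2)
        show "pair_wt {a, b} s = - \<kappa> * G True False + G False True"
          unfolding G arc_wt_pull_left[where f = "\<lambda>y. arc_wt y (s ! (b - 1))"] using pair_wt_arc(1)[of a b s] ab by simp
      qed (use ab k in auto)
    next
      assume ab: "k + 1 < b" "b < a" "a \<le> n"
      have w: "pair_wt {k, a} u = arc_wt (u ! (k - 1)) (u ! (a - 1))" for u using pair_wt_arc(1)[of k a u] ab k by simp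
      have w': "pair_wt {k + 1, b} u = arc_wt (u ! k) (u ! (b - 1))" for u using pair_wt_arc(1)[of "k + 1" b u] ab by simp
      have G: "G x y = arc_wt x (s ! (a - 1)) * arc_wt y (s ! (b - 1))" for x y
        unfolding G_def w w' tk using ab by (simp add: tj[unfolded One_nat_def])
      show ?thesis
      proof (rule case2)
        show "pair_wt {a, b} s = - \<kappa> * G True False + G False True"
          unfolding G arc_wt_pull_right[where f = "\<lambda>x. arc_wt x (s ! (a - 1))"] using pair_wt_arc(2)[of b a s] ab by simp
      qed (use ab k in auto)
    next
      assume ab: "1 \<le> b" "b < a" "a < k"
      have w: "pair_wt {k, a} u = arc_wt (u ! (a - 1)) (u ! (k - 1))" for u using pair_wt_arc(2)[of a k u] ab k by simp
      have w': "pair_wt {k + 1, b} u = arc_wt (u ! (b - 1)) (u ! k)" for u using pair_wt_arc(2)[of b "k + 1" u] ab k by simp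
      have G: "G x y = arc_wt (s ! (a - 1)) x * arc_wt (s ! (b - 1)) y" for x y
        unfolding G_def w w' tk using ab by (simp add: tj[unfolded One_nat_def])
      show ?thesis
      proof (rule case2)
        show "pair_wt {a, b} s = - \<kappa> * G True False + G False True"
          unfolding G arc_wt_pull_left[where f = "arc_wt (s ! (b - 1))"] using pair_wt_arc(2)[of b a s] ab k by simp
      qed (use ab k in auto)
    qed
  qed
  then show "snd (gen k p) \<in> tb_matchings n"
    and "fst (gen k p) * matching_wt (snd (gen k p)) s = leg2 n k (tl_mat \<kappa>) (matching_wt p) s"
    by blast+
qed

end

section \<open>Matchings and sign words\<close>

definition matching_word :: "nat \<Rightarrow> matching \<Rightarrow> bool list" where
  "matching_word n p = map (\<lambda>i. i < partner p i) [1..<n + 1]"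

lemma length_matching_word: "length (matching_word n p) = n"
  by (simp add: matching_word_def)

lemma nth_matching_word:
  assumes "1 \<le> i" "i \<le> n"
  shows "matching_word n p ! (i - 1) \<longleftrightarrow> i < partner p i"
proof -
  have "[1..<n + 1] ! (i - 1) = i" using assms by (subst nth_upt) auto
  then show ?thesis using assms by (simp add: matching_word_def del: upt_Suc)
qed

text \<open>Induction on the length of the arc: below it, \<open>q\<close> already agrees with
  \<open>p\<close>, so in \<open>q\<close> neither \<open>i\<close> nor \<open>j\<close> has its
  partner strictly inside. The letters send \<open>i\<close> to the right and \<open>j\<close> to
  the left, hence to at least \<open>j\<close> and at most \<open>i\<close>; without crossings they
  can only be matched to each other.\<close>

lemma arc_determined_by_word:
  assumes p: "p \<in> tb_matchings n" and q: "q \<in> tb_matchings n"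
    and w: "matching_word n p = matching_word n q"
  shows "{i, j} \<in> p \<Longrightarrow> 1 \<le> i \<Longrightarrow> i < j \<Longrightarrow> j \<le> n \<Longrightarrow> {i, j} \<in> q"
proof (induction "j - i" arbitrary: i j rule: less_induct)
  case less
  note ij = less.prems
  have sgn: "x < partner p x \<longleftrightarrow> x < partner q x" if "1 \<le> x" "x \<le> n" for x
    using nth_matching_word[OF that] w by metis
  have ji: "{j, i} \<in> p" using ij by (simp add: insert_commute)
  have inside: "i < partner q x \<and> partner q x < j" if x: "i < x" "x < j" for x
  proof -
    define y where "y = partner p x"
    have xy: "{x, y} \<in> p" "{y, x} \<in> p"
      using partner_edge[OF p, of x] x ij by (auto simp: y_def insert_commute)
    have y: "i < y" "y < j" using partner_inside_arc[OF p ij x] by (auto simp: y_def)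
    have "x \<noteq> y" using tb_pairD[OF p xy(1)] by simp
    then have "{x, y} \<in> q"
      using less.hyps[of y x] less.hyps[of x y] xy x y ij by (cases "x < y") (auto simp: insert_commute)
    then have "partner q x = y" using partner_eq[OF q, of x y] x ij by simp
    with y show ?thesis by simp
  qed
  define a where "a = partner q i"
  define b where "b = partner q j"
  have ia: "{i, a} \<in> q" "{a, i} \<in> q" and jb: "{j, b} \<in> q" "{b, j} \<in> q"
    using partner_edge[OF q, of i] partner_edge[OF q, of j] ij by (auto simp: a_def b_def insert_commute)
  have "i < a" using sgn[of i] partner_eq[OF p ij(1)] ij by (simp add: a_def)
  moreover have "b < j"
    using sgn[of j] partner_eq[OF p ji] tb_pairD[OF q jb(1)] ij by (auto simp: b_def)
  moreover have "\<not> (i < a \<and> a < j)"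
    using inside[of a] partner_eq[OF q ia(2)] ij by auto
  moreover have "\<not> (i < b \<and> b < j)"
    using inside[of b] partner_eq[OF q jb(2)] ij by auto
  ultimately have ab: "j \<le> a" "b \<le> i" by auto
  have "a = j"
  proof (rule ccontr)
    assume "a \<noteq> j"
    then have "i \<le> b" using noncrossing_nested[OF tb_noncrossing[OF q] jb(1) ia(1)] ab ij by simp
    with ab have "b = i" by simp
    then show False using partner_eq[OF q jb(2)] ij \<open>a \<noteq> j\<close> by (simp add: a_def)
  qed
  then show ?case using ia by simp
qed

text \<open>For a link at \<open>x\<close>, the partner of \<open>x\<close> in \<open>q\<close>
  cannot be a site, because an arc of \<open>q\<close> would by symmetry be an arc of
  \<open>p\<close>. The letter at \<open>x\<close> then decides which boundary point it is.\<close>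

lemma matching_word_subset:
  assumes p: "p \<in> tb_matchings n" and q: "q \<in> tb_matchings n"
    and w: "matching_word n p = matching_word n q"
  shows "p \<subseteq> q"
proof
  fix e assume e: "e \<in> p"
  obtain i j where ij: "e = {i, j}" "i < j" "j \<le> n + 1" "0 < i \<or> j \<le> n"
    using tb_edgeE[OF p e] by metis
  have link: "{x, m} \<in> q" if x: "1 \<le> x" "x \<le> n" and m: "{x, m} \<in> p" "m = 0 \<or> m = n + 1" for x m
  proof -
    have xm: "partner p x = m" by (rule partner_eq[OF p m(1) x])
    define y where "y = partner q x"
    have xy: "{x, y} \<in> q" "{y, x} \<in> q" using partner_edge[OF q x] by (auto simp: y_def insert_commute)
    have y: "x \<noteq> y" "y \<le> n + 1" using tb_pairD[OF q xy(1)] by auto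
    have sgn: "x < m \<longleftrightarrow> x < y"
      using nth_matching_word[OF x] w xm unfolding y_def by metis
    have "\<not> (1 \<le> y \<and> y \<le> n)"
    proof
      assume yn: "1 \<le> y \<and> y \<le> n"
      have "{x, y} \<in> p"
        using arc_determined_by_word[OF q p w[symmetric], of x y]
          arc_determined_by_word[OF q p w[symmetric], of y x] xy x yn y
        by (cases "x < y") (auto simp: insert_commute)
      then show False using partner_eq[OF p _ x, of y] xm m yn by auto
    qed
    then have "y = m" using sgn m x y by auto
    then show ?thesis using xy by simp
  qed
  consider "i = 0" "1 \<le> j" "j \<le> n" | "1 \<le> i" "i \<le> n" "j = n + 1" | "1 \<le> i" "j \<le> n" using ij by linarith
  then show "e \<in> q"
  proof cases
    case 1 then show ?thesis using link[of j 0] ij e by (simp add: insert_commute)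
  next
    case 2 then show ?thesis using link[of i "n + 1"] ij e by simp
  next
    case 3 then show ?thesis using arc_determined_by_word[OF p q w, of i j] ij e by simp
  qed
qed

lemma inj_on_matching_word: "inj_on (matching_word n) (tb_matchings n)"
  using matching_word_subset by (intro inj_onI equalityI) metis+

text \<open>Allows an arbitrary set \<open>S\<close> of sites in place of all of them, so that an
  induction can delete two sites without renumbering. The signs are built in: only + or
  \<open>0\<close> is a left end, only - or \<open>n + 1\<close> a right end.\<close>

definition sign_matching :: "nat \<Rightarrow> (nat \<Rightarrow> bool) \<Rightarrow> nat set \<Rightarrow> matching \<Rightarrow> bool" where
  "sign_matching n \<sigma> S p \<longleftrightarrow>
    (\<forall>e\<in>p. \<exists>i j. e = {i, j} \<and> i < j \<and> j \<le> n + 1 \<and> (0 < i \<or> j \<le> n) \<and>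
        (i \<in> S \<and> \<sigma> i \<or> i = 0) \<and> (j \<in> S \<and> \<not> \<sigma> j \<or> j = n + 1)) \<and>
      (\<forall>i\<in>S. \<exists>e\<in>p. i \<in> e) \<and>
      (\<forall>i\<in>S. \<forall>e\<in>p. \<forall>f\<in>p. i \<in> e \<longrightarrow> i \<in> f \<longrightarrow> e = f) \<and> noncrossing p"

lemma sign_matchingD:
  assumes "sign_matching n \<sigma> S p"
  shows "e \<in> p \<Longrightarrow> \<exists>i j. e = {i, j} \<and> i < j \<and> j \<le> n + 1 \<and> (0 < i \<or> j \<le> n) \<and>
        (i \<in> S \<and> \<sigma> i \<or> i = 0) \<and> (j \<in> S \<and> \<not> \<sigma> j \<or> j = n + 1)"
    and "i \<in> S \<Longrightarrow> \<exists>e\<in>p. i \<in> e"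
    and "i \<in> S \<Longrightarrow> e \<in> p \<Longrightarrow> f \<in> p \<Longrightarrow> i \<in> e \<Longrightarrow> i \<in> f \<Longrightarrow> e = f"
    and "noncrossing p"
  using assms unfolding sign_matching_def by simp_all

text \<open>Reading + as an opening and - as a closing bracket, an innermost matched pair is removed;
  words without any matched pair consist of - signs followed by + signs.\<close>

lemma matching_of_signs:
  fixes \<sigma> :: "nat \<Rightarrow> bool"
  assumes "finite S" "S \<subseteq> {1..n}"
  shows "\<exists>p. sign_matching n \<sigma> S p"
  using assms
proof (induction S rule: finite_psubset_induct)
  case (psubset S)
  note S = psubset.prems
  show ?case
  proof (cases "\<exists>d i j. i \<in> S \<and> j \<in> S \<and> i < j \<and> \<sigma> i \<and> \<not> \<sigma> j \<and> d = j - i")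
    case True
    define d where "d = (LEAST d. \<exists>i j. i \<in> S \<and> j \<in> S \<and> i < j \<and> \<sigma> i \<and> \<not> \<sigma> j \<and> d = j - i)"
    obtain i j where ij: "i \<in> S" "j \<in> S" "i < j" "\<sigma> i" "\<not> \<sigma> j" "d = j - i"
      using LeastI_ex[OF True] unfolding d_def by blast
    have min: "d \<le> j' - i'" if "i' \<in> S" "j' \<in> S" "i' < j'" "\<sigma> i'" "\<not> \<sigma> j'" for i' j'
      unfolding d_def using that by (intro Least_le) blast
    \<comment> \<open>A remaining site in between would give a closer pair of brackets: with
      \<open>j\<close> if its sign is +, with \<open>i\<close> if it is -.\<close>
    have gap: "x \<notin> S" if "i < x" "x < j" for x
      using min[of i x] min[of x j] that ij by (cases "\<sigma> x") auto
    have sub: "S - {i, j} \<subset> S" "S - {i, j} \<subseteq> {1..n}" using ij S by auto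
    obtain p where "sign_matching n \<sigma> (S - {i, j}) p" using psubset.IH[OF sub] by blast
    note p = sign_matchingD(1)[OF this] and cov = sign_matchingD(2)[OF this]
      and un = sign_matchingD(3)[OF this] and nc = sign_matchingD(4)[OF this]
    have out: "x \<in> S - {i, j} \<or> x = 0 \<or> x = n + 1" if "e \<in> p" "x \<in> e" for x e
      using p[OF that(1)] that(2) by blast
    have ij_n: "1 \<le> i" "j \<le> n" using ij S by auto
    have ne: "i \<notin> e" "j \<notin> e" if "e \<in> p" for e
      using out[OF that, of i] out[OF that, of j] ij ij_n by auto
    \<comment> \<open>No other pair has an end between \<open>i\<close> and \<open>j\<close>, so
      inserting \<open>{i, j}\<close> creates no crossing.\<close>
    have skip: "x < i \<or> j < x" if "e \<in> p" "x \<in> e" for x e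
    proof -
      have "x \<noteq> i" "x \<noteq> j" using ne[OF that(1)] that(2) by auto
      then show ?thesis
        using out[OF that] gap[of x] ij_n by (cases "i < x"; cases "x < j") auto
    qed
    have nc': "noncrossing (insert {i, j} p)"
      unfolding noncrossing_iff_nested
    proof (intro allI impI)
      fix x y c d
      assume xy: "{x, y} \<in> insert {i, j} p" and cd: "{c, d} \<in> insert {i, j} p" and lt: "c < x" "x < d"
      consider "{x, y} \<in> p" "{c, d} \<in> p" | "{x, y} \<in> p" "{c, d} = {i, j}" | "{x, y} = {i, j}" "{c, d} \<in> p"
        | "{x, y} = {i, j}" "{c, d} = {i, j}" using xy cd by blast
      then show "c \<le> y \<and> y \<le> d"
      proof cases
        case 1 then show ?thesis using noncrossing_nested[OF nc] lt by blast
      next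
        case 2 then show ?thesis using skip[OF 2(1), of x] lt ij by (auto simp: doubleton_eq_iff)
      next
        case 3 then show ?thesis using skip[OF 3(2), of c] skip[OF 3(2), of d] lt ij by (auto simp: doubleton_eq_iff)
      next
        case 4 then show ?thesis using lt by (auto simp: doubleton_eq_iff)
      qed
    qed
    have un': "e = f" if x: "x \<in> S" "e \<in> insert {i, j} p" "f \<in> insert {i, j} p" "x \<in> e" "x \<in> f" for x e f
    proof (cases "x \<in> {i, j}")
      case True
      then have "e \<notin> p" "f \<notin> p" using ne[of e] ne[of f] x by auto
      then show ?thesis using x by auto
    next
      case False
      then have "e \<in> p" "f \<in> p" using x by auto
      then show ?thesis using un[of x e f] False x by auto
    qed
    have ed: "\<exists>a b. e = {a, b} \<and> a < b \<and> b \<le> n + 1 \<and> (0 < a \<or> b \<le> n) \<and>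
        (a \<in> S \<and> \<sigma> a \<or> a = 0) \<and> (b \<in> S \<and> \<not> \<sigma> b \<or> b = n + 1)" if "e \<in> insert {i, j} p" for e
    proof (cases "e \<in> p")
      case True
      obtain a b where "e = {a, b}" "a < b" "b \<le> n + 1" "0 < a \<or> b \<le> n"
        "a \<in> S - {i, j} \<and> \<sigma> a \<or> a = 0" "b \<in> S - {i, j} \<and> \<not> \<sigma> b \<or> b = n + 1"
        using p[OF True] by (elim exE conjE)
      then show ?thesis by - (rule exI[of _ a], rule exI[of _ b], auto)
    next
      case False
      then have "e = {i, j}" using that by simp
      then show ?thesis using ij ij_n by - (rule exI[of _ i], rule exI[of _ j], auto)
    qed
    have cov': "\<exists>e\<in>insert {i, j} p. x \<in> e" if "x \<in> S" for x
      using cov[of x] that by (cases "x \<in> {i, j}") auto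
    show ?thesis
      unfolding sign_matching_def
    proof (rule exI[of _ "insert {i, j} p"], intro conjI ballI impI)
      show "noncrossing (insert {i, j} p)" by (rule nc')
    qed (erule ed cov' | rule un'; assumption)+
  next
    case False
    \<comment> \<open>All - signs precede all + signs, so linking every - to \<open>0\<close> and
      every + to \<open>n + 1\<close> is planar.\<close>
    then have mono: "\<not> \<sigma> i" if "i \<in> S" "j \<in> S" "i < j" "\<not> \<sigma> j" for i j using that by blast
    let ?m = "\<lambda>i. if \<sigma> i then {i, n + 1} else {0, i}"
    have site: "1 \<le> x" "x \<le> n" if "x \<in> S" for x using that S by auto
    show ?thesis
      unfolding sign_matching_def
    proof (rule exI[of _ "?m ` S"], intro conjI ballI impI)
      fix e assume "e \<in> ?m ` S"
      then obtain x where x: "x \<in> S" "e = ?m x" by auto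
      show "\<exists>i j. e = {i, j} \<and> i < j \<and> j \<le> n + 1 \<and> (0 < i \<or> j \<le> n) \<and>
        (i \<in> S \<and> \<sigma> i \<or> i = 0) \<and> (j \<in> S \<and> \<not> \<sigma> j \<or> j = n + 1)"
      proof (cases "\<sigma> x")
        case True
        then show ?thesis using x site[OF x(1)] by - (rule exI[of _ x], rule exI[of _ "n + 1"], auto)
      next
        case False
        then show ?thesis using x site[OF x(1)] by - (rule exI[of _ 0], rule exI[of _ x], auto)
      qed
    next
      fix i assume "i \<in> S"
      then show "\<exists>e\<in>?m ` S. i \<in> e" by (intro bexI[of _ "?m i"]) auto
    next
      fix i e f assume i: "i \<in> S" and ef: "e \<in> ?m ` S" "f \<in> ?m ` S" "i \<in> e" "i \<in> f"
      obtain x y where xy: "e = ?m x" "f = ?m y" using ef by blast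
      have "x = i" "y = i" using ef xy site[OF i] by (auto split: if_splits)
      then show "e = f" using xy by simp
    next
      show "noncrossing (?m ` S)"
        unfolding noncrossing_iff_nested
      proof (intro allI impI)
        fix x y c d
        assume xy: "{x, y} \<in> ?m ` S" and cd: "{c, d} \<in> ?m ` S" and lt: "c < x" "x < d"
        obtain v where v: "v \<in> S" "{x, y} = ?m v" using xy by blast
        obtain w where w: "w \<in> S" "{c, d} = ?m w" using cd by blast
        show "c \<le> y \<and> y \<le> d"
          using v w lt site[OF v(1)] site[OF w(1)] mono[OF v(1) w(1)] mono[OF w(1) v(1)]
          by (cases "\<sigma> v"; cases "\<sigma> w") (auto simp: doubleton_eq_iff)
      qed
    qed
  qed
qed

lemma surj_matching_word:
  assumes s: "length s = n"
  shows "\<exists>p\<in>tb_matchings n. matching_word n p = s"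
proof -
  obtain p where "sign_matching n (\<lambda>i. s ! (i - 1)) {1..n} p"
    using matching_of_signs[of "{1..n}" n] by blast
  note p = sign_matchingD(1)[OF this] and cov = sign_matchingD(2)[OF this]
    and un = sign_matchingD(3)[OF this] and nc = sign_matchingD(4)[OF this]
  have tb: "p \<in> tb_matchings n"
  proof (rule tb_matchingsI[OF _ _ _ nc])
    show "\<exists>i j. e = {i, j} \<and> i < j \<and> j \<le> n + 1 \<and> (0 < i \<or> j \<le> n)" if "e \<in> p" for e
      using p[OF that] by (elim exE conjE) (intro exI conjI)
    show "\<exists>e\<in>p. i \<in> e" if "1 \<le> i" "i \<le> n" for i using cov that by simp
    show "e = f" if "1 \<le> i" "i \<le> n" "e \<in> p" "f \<in> p" "i \<in> e" "i \<in> f" for i e f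
      using un that by simp
  qed
  have "i < partner p i \<longleftrightarrow> s ! (i - 1)" if i: "1 \<le> i" "i \<le> n" for i
  proof -
    obtain a b where "{i, partner p i} = {a, b}" "a < b"
      "a \<in> {1..n} \<and> s ! (a - 1) \<or> a = 0" "b \<in> {1..n} \<and> \<not> s ! (b - 1) \<or> b = n + 1"
      using p[OF partner_edge[OF tb i]] by (elim exE conjE)
    then show ?thesis using i by (auto simp: doubleton_eq_iff)
  qed
  then have "matching_word n p = s"
    using s by (intro nth_equalityI) (auto simp: length_matching_word nth_matching_word[of "Suc _", simplified])
  with tb show ?thesis by blast
qed

lemma bij_betw_matching_word: "bij_betw (matching_word n) (tb_matchings n) {s. length s = n}"
  unfolding bij_betw_def
proof
  show "inj_on (matching_word n) (tb_matchings n)" by (rule inj_on_matching_word)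
  show "matching_word n ` tb_matchings n = {s. length s = n}"
    using surj_matching_word length_matching_word by (auto simp: image_iff) metis
qed

text \<open>With only \<open>u\<close> alive, each pair enforces + at its left and - at its right
  end. As every site lies in some pair, the product is the indicator of one word.\<close>

lemma leading_weight:
  assumes p: "p \<in> tb_matchings n" and s: "length s = n"
  shows "(\<Prod>e\<in>p. edge_wt n 1 0 0 0 0 0 e s) = (if s = matching_word n p then 1 else 0)"
proof -
  have val: "edge_wt n 1 0 0 0 0 0 e s =
      (if \<forall>i\<in>e. 1 \<le> i \<and> i \<le> n \<longrightarrow> (s ! (i - 1) \<longleftrightarrow> i < partner p i) then 1 else 0)" if e: "e \<in> p" for e
  proof -
    obtain i j where ij: "e = {i, j}" "i < j" "j \<le> n + 1" "0 < i \<or> j \<le> n"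
      using tb_edgeE[OF p e] by metis
    have e': "{i, j} \<in> p" "{j, i} \<in> p" using e ij by (auto simp: insert_commute)
    consider "i = 0" "1 \<le> j" "j \<le> n" | "1 \<le> i" "i \<le> n" "j = n + 1" | "1 \<le> i" "j \<le> n" using ij by linarith
    then show ?thesis
    proof cases
      case 1
      then show ?thesis using partner_eq[OF p e'(2)] by (simp add: ij(1) edge_wt_left)
    next
      case 2
      then show ?thesis unfolding ij(1) using partner_eq[OF p e'(1)] edge_wt_right(1)[of i n] by simp
    next
      case 3
      then show ?thesis unfolding ij(1)
        using partner_eq[OF p e'(1)] partner_eq[OF p e'(2)] edge_wt_arc(1)[of i j n] ij by auto
    qed
  qed
  show ?thesis
  proof (cases "s = matching_word n p")
    case True
    have "edge_wt n 1 0 0 0 0 0 e s = 1" if "e \<in> p" for e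
      unfolding val[OF that] using nth_matching_word[of _ n p] True by simp
    then have "(\<Prod>e\<in>p. edge_wt n 1 0 0 0 0 0 e s) = 1" by (intro prod.neutral) blast
    then show ?thesis using True by simp
  next
    case False
    then obtain k where k: "k < n" "s ! k \<noteq> matching_word n p ! k"
      using s nth_equalityI[of s "matching_word n p"] length_matching_word[of n p] by metis
    then have "s ! (Suc k - 1) \<noteq> (Suc k < partner p (Suc k))"
      using nth_matching_word[of "Suc k" n p] by simp
    moreover have e: "{Suc k, partner p (Suc k)} \<in> p" using partner_edge[OF p, of "Suc k"] k by simp
    ultimately have "edge_wt n 1 0 0 0 0 0 {Suc k, partner p (Suc k)} s = 0"
      using val[OF e] k by auto
    then have "(\<Prod>e\<in>p. edge_wt n 1 0 0 0 0 0 e s) = 0"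
      using e finite_tb_matching[OF p] by (intro prod_zero) auto
    then show ?thesis using False by simp
  qed
qed

section \<open>Polynomial functions and the determinant\<close>

lemma poly_fun_monom:
  assumes "\<And>i. k \<le> i \<Longrightarrow> \<alpha> i = 0"
  shows "poly_fun k (\<lambda>x. c * (\<Prod>i<k. x i ^ \<alpha> i))"
  unfolding poly_fun_def using assms by (intro exI[of _ "{\<alpha>}"] exI[of _ "\<lambda>_. c"]) auto

lemma poly_fun_const: "poly_fun k (\<lambda>x. c)"
  using poly_fun_monom[of k "\<lambda>_. 0" c] by simp

lemma poly_fun_var:
  assumes "j < k"
  shows "poly_fun k (\<lambda>x. x j)"
proof -
  have "(\<Prod>i<k. x i ^ (if i = j then 1 else 0)) = x j" for x :: "nat \<Rightarrow> complex"
  proof -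
    have "(\<Prod>i<k. x i ^ (if i = j then 1 else 0)) = (\<Prod>i<k. if i = j then x i else 1)"
      by (rule prod.cong) auto
    then show ?thesis using assms by simp
  qed
  then show ?thesis using poly_fun_monom[of k "\<lambda>i. if i = j then 1 else 0" 1] assms by simp
qed

lemma poly_fun_add:
  assumes "poly_fun k P" "poly_fun k Q"
  shows "poly_fun k (\<lambda>x. P x + Q x)"
proof -
  obtain A c where A: "finite A" "\<forall>\<alpha>\<in>A. \<forall>i\<ge>k. \<alpha> i = 0"
    and P: "\<And>x. P x = (\<Sum>\<alpha>\<in>A. c \<alpha> * (\<Prod>i<k. x i ^ \<alpha> i))"
    using assms(1) unfolding poly_fun_def by blast
  obtain B d where B: "finite B" "\<forall>\<alpha>\<in>B. \<forall>i\<ge>k. \<alpha> i = 0"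
    and Q: "\<And>x. Q x = (\<Sum>\<alpha>\<in>B. d \<alpha> * (\<Prod>i<k. x i ^ \<alpha> i))"
    using assms(2) unfolding poly_fun_def by blast
  let ?e = "\<lambda>\<alpha>. (if \<alpha> \<in> A then c \<alpha> else 0) + (if \<alpha> \<in> B then d \<alpha> else 0)"
  have "P x + Q x = (\<Sum>\<alpha>\<in>A \<union> B. ?e \<alpha> * (\<Prod>i<k. x i ^ \<alpha> i))" for x
  proof -
    have "P x = (\<Sum>\<alpha>\<in>A \<union> B. (if \<alpha> \<in> A then c \<alpha> else 0) * (\<Prod>i<k. x i ^ \<alpha> i))"
      unfolding P by (rule sum.mono_neutral_cong_left) (use A B in auto)
    moreover have "Q x = (\<Sum>\<alpha>\<in>A \<union> B. (if \<alpha> \<in> B then d \<alpha> else 0) * (\<Prod>i<k. x i ^ \<alpha> i))"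
      unfolding Q by (rule sum.mono_neutral_cong_left) (use A B in auto)
    ultimately show ?thesis by (simp only: sum.distrib[symmetric] distrib_right)
  qed
  moreover have "finite (A \<union> B)" "\<forall>\<alpha>\<in>A \<union> B. \<forall>i\<ge>k. \<alpha> i = 0" using A B by auto
  ultimately show ?thesis
    unfolding poly_fun_def by (intro exI[of _ "A \<union> B"] exI[of _ ?e] conjI allI)
qed

lemma poly_fun_sum:
  assumes "finite I" "\<And>i. i \<in> I \<Longrightarrow> poly_fun k (P i)"
  shows "poly_fun k (\<lambda>x. \<Sum>i\<in>I. P i x)"
  using assms by (induction I rule: finite_induct) (simp_all add: poly_fun_const poly_fun_add)

lemma poly_fun_mult:
  assumes "poly_fun k P" "poly_fun k Q"
  shows "poly_fun k (\<lambda>x. P x * Q x)"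
proof -
  obtain A c where A: "finite A" "\<forall>\<alpha>\<in>A. \<forall>i\<ge>k. \<alpha> i = 0"
    and P: "\<And>x. P x = (\<Sum>\<alpha>\<in>A. c \<alpha> * (\<Prod>i<k. x i ^ \<alpha> i))"
    using assms(1) unfolding poly_fun_def by blast
  obtain B d where B: "finite B" "\<forall>\<alpha>\<in>B. \<forall>i\<ge>k. \<alpha> i = 0"
    and Q: "\<And>x. Q x = (\<Sum>\<alpha>\<in>B. d \<alpha> * (\<Prod>i<k. x i ^ \<alpha> i))"
    using assms(2) unfolding poly_fun_def by blast
  \<comment> \<open>Different \<alpha>, \<beta> may have the same sum, so the product is kept as a
    sum of monomials rather than given one exponent set.\<close>
  have "P x * Q x = (\<Sum>\<alpha>\<in>A. \<Sum>\<beta>\<in>B. (c \<alpha> * d \<beta>) * (\<Prod>i<k. x i ^ (\<alpha> i + \<beta> i)))" for x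
    unfolding P Q sum_product by (simp add: power_add prod.distrib mult_ac)
  moreover have "poly_fun k (\<lambda>x. \<Sum>\<alpha>\<in>A. \<Sum>\<beta>\<in>B. (c \<alpha> * d \<beta>) * (\<Prod>i<k. x i ^ (\<alpha> i + \<beta> i)))"
    by (intro poly_fun_sum poly_fun_monom A(1) B(1)) (use A(2) B(2) in auto)
  ultimately show ?thesis by simp
qed

lemma poly_fun_prod:
  assumes "finite I" "\<And>i. i \<in> I \<Longrightarrow> poly_fun k (P i)"
  shows "poly_fun k (\<lambda>x. \<Prod>i\<in>I. P i x)"
  using assms by (induction I rule: finite_induct) (simp_all add: poly_fun_const poly_fun_mult)

lemma poly_fun_uminus: "poly_fun k P \<Longrightarrow> poly_fun k (\<lambda>x. - P x)"
  using poly_fun_mult[OF poly_fun_const[of k "- 1"], of P] by simp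

text \<open>Each letter pattern selects at most one of the six parameters. This yields both
  polynomiality and continuity of the matrix entries.\<close>

lemma edge_wt_linear:
  "edge_wt n u t x0 x1 y0 y1 e s =
    edge_wt n 1 0 0 0 0 0 e s * u + edge_wt n 0 1 0 0 0 0 e s * t +
    edge_wt n 0 0 1 0 0 0 e s * x0 + edge_wt n 0 0 0 1 0 0 e s * x1 +
    edge_wt n 0 0 0 0 1 0 e s * y0 + edge_wt n 0 0 0 0 0 1 e s * y1"
  by (simp add: edge_wt_def Let_def)

lemma poly_fun_edge_wt:
  assumes "poly_fun k u" "poly_fun k t" "poly_fun k x0" "poly_fun k x1" "poly_fun k y0" "poly_fun k y1"
  shows "poly_fun k (\<lambda>z. edge_wt n (u z) (t z) (x0 z) (x1 z) (y0 z) (y1 z) e s)"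
  by (subst edge_wt_linear, intro poly_fun_add poly_fun_mult poly_fun_const assms)

text \<open>Homogeneity is what allows denominators to be cleared pair by pair.\<close>

lemma edge_wt_scale:
  "edge_wt n (c * u) (c * t) (c * x0) (c * x1) (c * y0) (c * y1) e s = c * edge_wt n u t x0 x1 y0 y1 e s"
  by (simp add: edge_wt_def Let_def)

text \<open>Rows are indexed by \<open>U\<close> through \<open>g\<close>, columns by
  \<open>T\<close> through \<open>f\<close>. The factors \<open>c\<close> form an invertible
  diagonal matrix, absorbed into the vector \<open>V x\<close>; this keeps the normalization out of
  the determinant.\<close>

lemma bij_betw_of_nonzero_det:
  fixes B :: "'a \<Rightarrow> 'b \<Rightarrow> 'c :: field"
  assumes f: "bij_betw f {0..<N} T" and g: "bij_betw g {0..<N} U"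
    and det: "det (mat N N (\<lambda>(i, j). B (f j) (g i))) \<noteq> 0"
    and c: "\<And>p. p \<in> T \<Longrightarrow> c p \<noteq> 0"
    and L: "\<And>x s. L x s = (if s \<in> U then \<Sum>p\<in>T. x p * (c p * B p s) else 0)"
  shows "bij_betw L {x. \<forall>p. p \<notin> T \<longrightarrow> x p = 0} {y. \<forall>s. s \<notin> U \<longrightarrow> y s = 0}"
proof -
  define A where "A = mat N N (\<lambda>(i, j). B (f j) (g i))"
  have A: "A \<in> carrier_mat N N" unfolding A_def by simp
  have "A \<in> Units (ring_mat TYPE('c) N ())"
    by (rule det_non_zero_imp_unit[OF A]) (use det in \<open>simp add: A_def\<close>)
  then obtain C where C: "C \<in> carrier_mat N N" "C * A = 1\<^sub>m N" "A * C = 1\<^sub>m N"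
    unfolding Units_def ring_mat_def by auto
  define V where "V = (\<lambda>x. vec N (\<lambda>j. c (f j) * x (f j)))"
  have V: "V x \<in> carrier_vec N" for x unfolding V_def by simp
  have fT: "f j \<in> T" if "j < N" for j using f that unfolding bij_betw_def by auto
  have gU: "g j \<in> U" if "j < N" for j using g that unfolding bij_betw_def by auto
  have AV: "(A *\<^sub>v V x) $ i = L x (g i)" if i: "i < N" for x i
  proof -
    have "(A *\<^sub>v V x) $ i = (\<Sum>j = 0..<N. B (f j) (g i) * (c (f j) * x (f j)))"
      using i by (simp add: A_def V_def scalar_prod_def)
    also have "\<dots> = (\<Sum>j\<in>{0..<N}. (\<lambda>p. x p * (c p * B p (g i))) (f j))"
      by (rule sum.cong) (auto simp: mult_ac)
    also have "\<dots> = (\<Sum>p\<in>T. x p * (c p * B p (g i)))" by (rule sum.reindex_bij_betw[OF f])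
    finally show ?thesis using gU[OF i] by (simp add: L)
  qed
  have cancel: "C *\<^sub>v (A *\<^sub>v v) = v" "A *\<^sub>v (C *\<^sub>v v) = v" if "v \<in> carrier_vec N" for v
    using assoc_mult_mat_vec[OF C(1) A that] assoc_mult_mat_vec[OF A C(1) that] C that by simp_all
  show ?thesis
    unfolding bij_betw_def
  proof
    show "inj_on L {x. \<forall>p. p \<notin> T \<longrightarrow> x p = 0}"
    proof (rule inj_onI)
      fix x x' assume x: "x \<in> {x. \<forall>p. p \<notin> T \<longrightarrow> x p = 0}" "x' \<in> {x. \<forall>p. p \<notin> T \<longrightarrow> x p = 0}" and eq: "L x = L x'"
      have "A *\<^sub>v V x = A *\<^sub>v V x'"
      proof (rule eq_vecI)
        fix i assume "i < dim_vec (A *\<^sub>v V x')"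
        then have i: "i < N" using A by simp
        show "(A *\<^sub>v V x) $ i = (A *\<^sub>v V x') $ i" unfolding AV[OF i] eq ..
      qed simp
      then have VV: "V x = V x'" using cancel(1)[OF V[of x]] cancel(1)[OF V[of x']] by metis
      show "x = x'"
      proof
        fix p
        show "x p = x' p"
        proof (cases "p \<in> T")
          case True
          then obtain j where j: "j < N" "p = f j" using f unfolding bij_betw_def by auto
          have "V x $ j = V x' $ j" using VV by simp
          then show ?thesis using j c[OF True] by (simp add: V_def)
        qed (use x in auto)
      qed
    qed
    show "L ` {x. \<forall>p. p \<notin> T \<longrightarrow> x p = 0} = {y. \<forall>s. s \<notin> U \<longrightarrow> y s = 0}"
    proof (intro equalityI subsetI)
      fix y assume "y \<in> L ` {x. \<forall>p. p \<notin> T \<longrightarrow> x p = 0}"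
      then show "y \<in> {y. \<forall>s. s \<notin> U \<longrightarrow> y s = 0}" by (auto simp: L)
    next
      fix y :: "'b \<Rightarrow> 'c" assume y: "y \<in> {y. \<forall>s. s \<notin> U \<longrightarrow> y s = 0}"
      define w where "w = vec N (\<lambda>i. y (g i))"
      define v where "v = C *\<^sub>v w"
      define x where "x = (\<lambda>p. if p \<in> T then v $ (inv_into {0..<N} f p) / c p else 0)"
      have w: "w \<in> carrier_vec N" unfolding w_def by simp
      have "V x = v"
      proof (rule eq_vecI)
        fix j assume "j < dim_vec v"
        then have j: "j < N" using C by (simp add: v_def)
        have "inv_into {0..<N} f (f j) = j" using f j by (intro inv_into_f_f) (auto simp: bij_betw_def)
        then show "V x $ j = v $ j" using j fT[OF j] c[OF fT[OF j]] by (simp add: V_def x_def)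
      qed (use C in \<open>simp add: V_def v_def\<close>)
      then have Aw: "A *\<^sub>v V x = w" using cancel(2)[OF w] by (simp add: v_def)
      have "L x = y"
      proof
        fix s
        show "L x s = y s"
        proof (cases "s \<in> U")
          case True
          then obtain i where i: "i < N" "s = g i" using g unfolding bij_betw_def by auto
          show ?thesis using AV[OF i(1), of x] i unfolding Aw by (simp add: w_def)
        qed (use y in \<open>auto simp: L\<close>)
      qed
      moreover have "x \<in> {x. \<forall>p. p \<notin> T \<longrightarrow> x p = 0}" by (simp add: x_def)
      ultimately show "y \<in> L ` {x. \<forall>p. p \<notin> T \<longrightarrow> x p = 0}" by blast
    qed
  qed
qed

text \<open>The words are enumerated through the same \<open>f\<close> as the matchings, so that the
  leading matrix is the identity and not merely a permutation matrix.\<close>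

definition weight_matrix ::
    "nat \<Rightarrow> (nat \<Rightarrow> matching) \<Rightarrow> complex \<Rightarrow> complex \<Rightarrow> complex \<Rightarrow> complex \<Rightarrow> complex \<Rightarrow> complex \<Rightarrow> complex mat" where
  "weight_matrix n f u t x0 x1 y0 y1 = mat (card (tb_matchings n)) (card (tb_matchings n))
    (\<lambda>(i, j). \<Prod>e\<in>f j. edge_wt n u t x0 x1 y0 y1 e (matching_word n (f i)))"

text \<open>The Leibniz expansion lets polynomiality and limits pass from the entries to the
  determinant by rules for sums and products.\<close>

lemma det_weight_matrix:
  "det (weight_matrix n f u t x0 x1 y0 y1) =
    (\<Sum>\<pi>\<in>{\<pi>. \<pi> permutes {0..<card (tb_matchings n)}}. signof \<pi> *
      (\<Prod>i = 0..<card (tb_matchings n). \<Prod>e\<in>f (\<pi> i). edge_wt n u t x0 x1 y0 y1 e (matching_word n (f i))))"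
proof -
  have "weight_matrix n f u t x0 x1 y0 y1 \<in> carrier_mat (card (tb_matchings n)) (card (tb_matchings n))"
    by (simp add: weight_matrix_def)
  note det_def'[OF this]
  also have "(\<Sum>\<pi>\<in>{\<pi>. \<pi> permutes {0..<card (tb_matchings n)}}. signof \<pi> *
      (\<Prod>i = 0..<card (tb_matchings n). weight_matrix n f u t x0 x1 y0 y1 $$ (i, \<pi> i))) =
    (\<Sum>\<pi>\<in>{\<pi>. \<pi> permutes {0..<card (tb_matchings n)}}. signof \<pi> *
      (\<Prod>i = 0..<card (tb_matchings n). \<Prod>e\<in>f (\<pi> i). edge_wt n u t x0 x1 y0 y1 e (matching_word n (f i))))"
  proof (intro sum.cong refl arg_cong2[of _ _ _ _ "(*)"] prod.cong)
    fix \<pi> i assume "\<pi> \<in> {\<pi>. \<pi> permutes {0..<card (tb_matchings n)}}" and i: "i \<in> {0..<card (tb_matchings n)}"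
    then have "\<pi> i \<in> {0..<card (tb_matchings n)}" using permutes_in_image[of \<pi> "{0..<card (tb_matchings n)}" i] by simp
    with i show "weight_matrix n f u t x0 x1 y0 y1 $$ (i, \<pi> i) =
        (\<Prod>e\<in>f (\<pi> i). edge_wt n u t x0 x1 y0 y1 e (matching_word n (f i)))"
      by (simp add: weight_matrix_def)
  qed
  finally show ?thesis .
qed

lemma poly_fun_det_weight_matrix:
  assumes "poly_fun k u" "poly_fun k t" "poly_fun k x0" "poly_fun k x1" "poly_fun k y0" "poly_fun k y1"
    and f: "\<And>i. i < card (tb_matchings n) \<Longrightarrow> f i \<in> tb_matchings n"
  shows "poly_fun k (\<lambda>z. det (weight_matrix n f (u z) (t z) (x0 z) (x1 z) (y0 z) (y1 z)))"
  unfolding det_weight_matrix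
proof (intro poly_fun_sum poly_fun_mult poly_fun_const poly_fun_prod poly_fun_edge_wt assms(1-6))
  show "finite {\<pi>. \<pi> permutes {0..<card (tb_matchings n)}}" by (simp add: finite_permutations)
next
  fix \<pi> i assume "\<pi> \<in> {\<pi>. \<pi> permutes {0..<card (tb_matchings n)}}" and i: "i \<in> {0..<card (tb_matchings n)}"
  then have "\<pi> i \<in> {0..<card (tb_matchings n)}" using permutes_in_image[of \<pi> "{0..<card (tb_matchings n)}" i] by simp
  then show "finite (f (\<pi> i))" using f finite_tb_matching by auto
qed simp

lemma det_weight_matrix_leading:
  assumes f: "bij_betw f {0..<card (tb_matchings n)} (tb_matchings n)"
  shows "det (weight_matrix n f 1 0 0 0 0 0) = 1"
proof -
  have "weight_matrix n f 1 0 0 0 0 0 = 1\<^sub>m (card (tb_matchings n))"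
  proof (rule eq_matI)
    fix i j assume "i < dim_row (1\<^sub>m (card (tb_matchings n)) :: complex mat)"
      "j < dim_col (1\<^sub>m (card (tb_matchings n)) :: complex mat)"
    then have ij: "i < card (tb_matchings n)" "j < card (tb_matchings n)" by auto
    then have fij: "f i \<in> tb_matchings n" "f j \<in> tb_matchings n" using f unfolding bij_betw_def by auto
    have "matching_word n (f i) = matching_word n (f j) \<longleftrightarrow> i = j"
      using inj_on_eq_iff[OF inj_on_matching_word fij] f ij unfolding bij_betw_def inj_on_def by auto
    then show "weight_matrix n f 1 0 0 0 0 0 $$ (i, j) = 1\<^sub>m (card (tb_matchings n)) $$ (i, j)"
      using leading_weight[OF fij(2) length_matching_word] ij by (simp add: weight_matrix_def)
  qed (simp_all add: weight_matrix_def)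
  then show ?thesis by simp
qed

text \<open>The leading point itself is not attained: after scaling,
  \<open>u = \<kappa> * \<kappa>0 * \<kappa>n\<close> and
  \<open>t = - (\<kappa>0 * \<kappa>n)\<close>, so \<open>u = 1\<close> excludes
  \<open>t = 0\<close>. Continuity at 0 supplies a nearby nonzero \<tau> instead.\<close>

lemma det_weight_matrix_nonzero:
  assumes f: "bij_betw f {0..<card (tb_matchings n)} (tb_matchings n)"
  shows "\<exists>\<tau>. \<tau> \<noteq> 0 \<and> det (weight_matrix n f 1 \<tau> 0 0 0 0) \<noteq> 0"
proof -
  have pair_wt: "((\<lambda>\<tau>. edge_wt n 1 \<tau> 0 0 0 0 e s) \<longlongrightarrow> edge_wt n 1 0 0 0 0 0 e s) (at 0)" for e s
  proof -
    have "((\<lambda>\<tau>. edge_wt n 1 0 0 0 0 0 e s + edge_wt n 0 1 0 0 0 0 e s * \<tau>) \<longlongrightarrow>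
        edge_wt n 1 0 0 0 0 0 e s + edge_wt n 0 1 0 0 0 0 e s * 0) (at 0)"
      by (intro tendsto_intros)
    moreover have "(\<lambda>\<tau>. edge_wt n 1 \<tau> 0 0 0 0 e s) =
        (\<lambda>\<tau>. edge_wt n 1 0 0 0 0 0 e s + edge_wt n 0 1 0 0 0 0 e s * \<tau>)"
      by (rule ext, subst edge_wt_linear, simp)
    ultimately show ?thesis by (simp only: mult_zero_right add_0_right)
  qed
  have "((\<lambda>\<tau>. det (weight_matrix n f 1 \<tau> 0 0 0 0)) \<longlongrightarrow> det (weight_matrix n f 1 0 0 0 0 0)) (at 0)"
    unfolding det_weight_matrix by (intro tendsto_sum tendsto_mult tendsto_const tendsto_prod pair_wt)
  then have "eventually (\<lambda>\<tau>. det (weight_matrix n f 1 \<tau> 0 0 0 0) \<noteq> 0) (at 0)"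
    unfolding det_weight_matrix_leading[OF f] by (rule tendsto_imp_eventually_ne) simp
  moreover have "eventually (\<lambda>\<tau>::complex. \<tau> \<noteq> 0) (at 0)" by (rule eventually_neq_at_within)
  ultimately have "eventually (\<lambda>\<tau>. \<tau> \<noteq> 0 \<and> det (weight_matrix n f 1 \<tau> 0 0 0 0) \<noteq> 0) (at 0)"
    by eventually_elim simp
  then show ?thesis by (rule eventually_happens'[rotated]) simp
qed

section \<open>From single matchings to the linear map\<close>

lemma leg1_sum:
  assumes "\<And>s. length s = n \<Longrightarrow> y s = (\<Sum>p\<in>P. x p * G p s)"
  shows "leg1 n i A y s = (\<Sum>p\<in>P. x p * leg1 n i A (G p) s)"
  using assms by (simp add: leg1_def UNIV_bool sum_distrib_left sum.distrib[symmetric] algebra_simps)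

lemma leg2_sum:
  assumes "\<And>s. length s = n \<Longrightarrow> y s = (\<Sum>p\<in>P. x p * G p s)"
  shows "leg2 n i A y s = (\<Sum>p\<in>P. x p * leg2 n i A (G p) s)"
  using assms by (simp add: leg2_def UNIV_bool sum_distrib_left sum.distrib[symmetric] algebra_simps)

context intertwiner
begin

lemma Psi_eq_mw:
  assumes "length s = n"
  shows "Psi n \<kappa> \<kappa>0 \<kappa>n \<psi>0 \<psi>n M00 M01 Mn0 Mn1 x s = (\<Sum>p\<in>tb_matchings n. x p * matching_wt p s)"
  unfolding Psi_def matching_wt_def pair_wt_def using Psi_basis_eq_prod[OF _ assms nz(1-3)] by simp

lemma Psi_eq_0: "length s \<noteq> n \<Longrightarrow> Psi n \<kappa> \<kappa>0 \<kappa>n \<psi>0 \<psi>n M00 M01 Mn0 Mn1 x s = 0"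
  unfolding Psi_def using Psi_basis_eq_0 by simp

lemma D0_eq: "\<kappa> * inverse \<kappa>0 + inverse \<kappa> * \<kappa>0 = D0"
  using D0 nz by (simp add: field_simps power2_eq_square)

lemma Dn_eq: "\<kappa> * inverse \<kappa>n + inverse \<kappa> * \<kappa>n = Dn"
  using Dn nz by (simp add: field_simps power2_eq_square)

lemma gen_intertwines:
  assumes "k \<le> n" "p \<in> tb_matchings n" "length s = n"
  shows "snd (gen k p) \<in> tb_matchings n"
    and "fst (gen k p) * matching_wt (snd (gen k p)) s = spin_rep n \<kappa> \<kappa>0 \<kappa>n \<psi>0 \<psi>n k (matching_wt p) s"
proof -
  consider "k = 0" | "k = n" "k \<noteq> 0" | "1 \<le> k" "k < n" using assms by linarith
  then have "snd (gen k p) \<in> tb_matchings n \<and>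
    fst (gen k p) * matching_wt (snd (gen k p)) s = spin_rep n \<kappa> \<kappa>0 \<kappa>n \<psi>0 \<psi>n k (matching_wt p) s"
  proof cases
    case 1
    then show ?thesis using gen_left[OF assms(2,3)] unfolding spin_rep_def D0_eq by simp
  next
    case 2
    then show ?thesis using gen_right[OF assms(2,3)] unfolding spin_rep_def Dn_eq by simp
  next
    case 3
    then show ?thesis using gen_bulk[OF assms(2,3) 3] unfolding spin_rep_def by simp
  qed
  then show "snd (gen k p) \<in> tb_matchings n"
    and "fst (gen k p) * matching_wt (snd (gen k p)) s = spin_rep n \<kappa> \<kappa>0 \<kappa>n \<psi>0 \<psi>n k (matching_wt p) s" by blast+
qed

lemma spin_rep_sum:
  assumes "\<And>s. length s = n \<Longrightarrow> y s = (\<Sum>p\<in>P. x p * G p s)"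
  shows "spin_rep n \<kappa> \<kappa>0 \<kappa>n \<psi>0 \<psi>n k y s = (\<Sum>p\<in>P. x p * spin_rep n \<kappa> \<kappa>0 \<kappa>n \<psi>0 \<psi>n k (G p) s)"
proof -
  have "leg1 n i A y s = (\<Sum>p\<in>P. x p * leg1 n i A (G p) s)" for i A by (rule leg1_sum) (rule assms)
  moreover have "leg2 n i A y s = (\<Sum>p\<in>P. x p * leg2 n i A (G p) s)" for i A by (rule leg2_sum) (rule assms)
  ultimately show ?thesis unfolding spin_rep_def by (cases "k = 0"; cases "k = n") simp_all
qed

lemma Psi_intertwines:
  assumes k: "k \<le> n"
  shows "Psi n \<kappa> \<kappa>0 \<kappa>n \<psi>0 \<psi>n M00 M01 Mn0 Mn1 (mm_rep n \<delta> \<delta>0 \<delta>n \<beta>0 \<beta>1 k x) =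
    spin_rep n \<kappa> \<kappa>0 \<kappa>n \<psi>0 \<psi>n k (Psi n \<kappa> \<kappa>0 \<kappa>n \<psi>0 \<psi>n M00 M01 Mn0 Mn1 x)"
proof
  fix s :: "bool list"
  let ?T = "tb_matchings n"
  show "Psi n \<kappa> \<kappa>0 \<kappa>n \<psi>0 \<psi>n M00 M01 Mn0 Mn1 (mm_rep n \<delta> \<delta>0 \<delta>n \<beta>0 \<beta>1 k x) s =
    spin_rep n \<kappa> \<kappa>0 \<kappa>n \<psi>0 \<psi>n k (Psi n \<kappa> \<kappa>0 \<kappa>n \<psi>0 \<psi>n M00 M01 Mn0 Mn1 x) s"
  proof (cases "length s = n")
    case False
    then show ?thesis by (simp add: Psi_eq_0 spin_rep_def leg1_def leg2_def)
  next
    case True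
    have "Psi n \<kappa> \<kappa>0 \<kappa>n \<psi>0 \<psi>n M00 M01 Mn0 Mn1 (mm_rep n \<delta> \<delta>0 \<delta>n \<beta>0 \<beta>1 k x) s =
        (\<Sum>q\<in>?T. \<Sum>p\<in>?T. (if snd (gen k p) = q then fst (gen k p) * x p else 0) * matching_wt q s)"
      unfolding Psi_eq_mw[OF True] mm_rep_def sum_distrib_right ..
    also have "\<dots> = (\<Sum>p\<in>?T. \<Sum>q\<in>?T. (if snd (gen k p) = q then fst (gen k p) * x p else 0) * matching_wt q s)"
      by (rule sum.swap)
    also have "\<dots> = (\<Sum>p\<in>?T. x p * spin_rep n \<kappa> \<kappa>0 \<kappa>n \<psi>0 \<psi>n k (matching_wt p) s)"
    proof (rule sum.cong[OF refl])
      fix p assume p: "p \<in> ?T"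
      have "(\<Sum>q\<in>?T. (if snd (gen k p) = q then fst (gen k p) * x p else 0) * matching_wt q s) =
          (\<Sum>q\<in>?T. if snd (gen k p) = q then fst (gen k p) * x p * matching_wt q s else 0)"
        by (rule sum.cong) auto
      \<comment> \<open>The sum collapses to one term because the generator sends a matching to a
        matching, so the index \<open>snd (gen k p)\<close> does occur.\<close>
      also have "\<dots> = fst (gen k p) * x p * matching_wt (snd (gen k p)) s"
        by (subst sum.delta'[OF finite_tb_matchings]) (simp only: gen_intertwines(1)[OF k p True] if_True)
      also have "\<dots> = x p * spin_rep n \<kappa> \<kappa>0 \<kappa>n \<psi>0 \<psi>n k (matching_wt p) s"
        unfolding gen_intertwines(2)[OF k p True, symmetric] by (simp only: mult_ac)
      finally show "(\<Sum>q\<in>?T. (if snd (gen k p) = q then fst (gen k p) * x p else 0) * matching_wt q s) =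
          x p * spin_rep n \<kappa> \<kappa>0 \<kappa>n \<psi>0 \<psi>n k (matching_wt p) s" .
    qed
    also have "\<dots> = spin_rep n \<kappa> \<kappa>0 \<kappa>n \<psi>0 \<psi>n k (Psi n \<kappa> \<kappa>0 \<kappa>n \<psi>0 \<psi>n M00 M01 Mn0 Mn1 x) s"
      by (rule spin_rep_sum[symmetric], rule Psi_eq_mw)
    finally show ?thesis .
  qed
qed

text \<open>One factor \<open>\<kappa> * \<kappa>0 * \<kappa>n\<close> per pair clears every
  denominator in the letter weights. The compensating inverse joins the normalization in a factor
  that does not depend on the word.\<close>

lemma matching_wt_eq_scaled:
  "matching_wt p s = (\<Prod>e\<in>p. edge_norm n M00 M01 Mn0 Mn1 e / (\<kappa> * \<kappa>0 * \<kappa>n)) *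
    (\<Prod>e\<in>p. edge_wt n (\<kappa> * \<kappa>0 * \<kappa>n) (- (\<kappa>0 * \<kappa>n)) (\<kappa>0 * \<kappa>0 * \<kappa>n * \<psi>0)
      (- (\<kappa> * \<kappa>n * \<psi>0)) (\<kappa>0 * \<kappa>n * \<kappa>n * \<psi>n) (- (\<kappa> * \<kappa>0 * \<psi>n)) e s)"
proof -
  let ?K = "\<kappa> * \<kappa>0 * \<kappa>n"
  have K: "edge_wt n ?K (- (\<kappa>0 * \<kappa>n)) (\<kappa>0 * \<kappa>0 * \<kappa>n * \<psi>0)
      (- (\<kappa> * \<kappa>n * \<psi>0)) (\<kappa>0 * \<kappa>n * \<kappa>n * \<psi>n) (- (\<kappa> * \<kappa>0 * \<psi>n)) e s =
    ?K * edge_wt n 1 (- inverse \<kappa>) (\<kappa>0 * \<psi>0 / \<kappa>) (- \<psi>0 / \<kappa>0) (\<kappa>n * \<psi>n / \<kappa>) (- \<psi>n / \<kappa>n) e s" for e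
    unfolding edge_wt_scale[symmetric] using nz by (simp add: field_simps)
  show ?thesis
    unfolding matching_wt_def pair_wt_def K prod.distrib[symmetric] using nz by simp
qed

lemma edge_norm_nonzero: "edge_norm n M00 M01 Mn0 Mn1 e \<noteq> 0"
  using nz by (auto simp: edge_norm_def Let_def M01 Mn0)

lemma bij_betw_Psi:
  assumes f: "bij_betw f {0..<card (tb_matchings n)} (tb_matchings n)"
    and det: "det (weight_matrix n f (\<kappa> * \<kappa>0 * \<kappa>n) (- (\<kappa>0 * \<kappa>n)) (\<kappa>0 * \<kappa>0 * \<kappa>n * \<psi>0)
      (- (\<kappa> * \<kappa>n * \<psi>0)) (\<kappa>0 * \<kappa>n * \<kappa>n * \<psi>n) (- (\<kappa> * \<kappa>0 * \<psi>n))) \<noteq> 0"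
  shows "bij_betw (Psi n \<kappa> \<kappa>0 \<kappa>n \<psi>0 \<psi>n M00 M01 Mn0 Mn1) (mm_space n) (spin_space n)"
proof -
  let ?B = "\<lambda>p s. \<Prod>e\<in>p. edge_wt n (\<kappa> * \<kappa>0 * \<kappa>n) (- (\<kappa>0 * \<kappa>n)) (\<kappa>0 * \<kappa>0 * \<kappa>n * \<psi>0)
      (- (\<kappa> * \<kappa>n * \<psi>0)) (\<kappa>0 * \<kappa>n * \<kappa>n * \<psi>n) (- (\<kappa> * \<kappa>0 * \<psi>n)) e s"
  let ?c = "\<lambda>p. \<Prod>e\<in>p. edge_norm n M00 M01 Mn0 Mn1 e / (\<kappa> * \<kappa>0 * \<kappa>n)"
  have g: "bij_betw (\<lambda>i. matching_word n (f i)) {0..<card (tb_matchings n)} {s. length s = n}"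
    using bij_betw_trans[OF f bij_betw_matching_word] by (simp add: comp_def)
  have c: "?c p \<noteq> 0" if "p \<in> tb_matchings n" for p
    using finite_tb_matching[OF that] edge_norm_nonzero nz by simp
  have L: "Psi n \<kappa> \<kappa>0 \<kappa>n \<psi>0 \<psi>n M00 M01 Mn0 Mn1 x s =
      (if s \<in> {s. length s = n} then \<Sum>p\<in>tb_matchings n. x p * (?c p * ?B p s) else 0)" for x s
  proof (cases "length s = n")
    case True
    then show ?thesis by (simp only: mem_Collect_eq simp_thms if_True Psi_eq_mw[OF True] matching_wt_eq_scaled)
  next
    case False
    then show ?thesis by (simp only: mem_Collect_eq if_False Psi_eq_0[OF False])
  qed
  have "bij_betw (Psi n \<kappa> \<kappa>0 \<kappa>n \<psi>0 \<psi>n M00 M01 Mn0 Mn1)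
      {x. \<forall>p. p \<notin> tb_matchings n \<longrightarrow> x p = 0} {y. \<forall>s. s \<notin> {s. length s = n} \<longrightarrow> y s = 0}"
    by (rule bij_betw_of_nonzero_det[where B = ?B and c = ?c, OF f g det[unfolded weight_matrix_def] c L])
  then show ?thesis unfolding mm_space_def spin_space_def by simp
qed

end

theorem mainTheorem5:
  fixes n :: nat
  assumes "n \<ge> 1"
  shows "\<exists>Q. poly_fun 6 Q \<and> (\<exists>z. Q z \<noteq> 0) \<and>
    (\<forall>\<kappa> \<kappa>0 \<kappa>n \<psi>0 \<psi>n \<beta>0 \<beta>1 M00 M01 Mn0 Mn1 :: complex.
       \<kappa> \<noteq> 0 \<and> \<kappa>0 \<noteq> 0 \<and> \<kappa>n \<noteq> 0 \<and> \<psi>0 \<noteq> 0 \<and> \<psi>n \<noteq> 0 \<and>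
       Q (\<lambda>i. [\<kappa>, \<kappa>0, \<kappa>n, \<psi>0, \<psi>n, \<beta>0] ! i) \<noteq> 0 \<and>
       \<beta>0 * \<beta>1 = inverse \<psi>0 * inverse \<psi>n *
         (if odd n then
            (1 + \<kappa>0 * inverse \<kappa>n * \<psi>0 * \<psi>n) * (1 + inverse \<kappa>0 * \<kappa>n * \<psi>0 * \<psi>n) /
            ((\<kappa> * inverse \<kappa>0 + inverse \<kappa> * \<kappa>0) * (\<kappa> * inverse \<kappa>n + inverse \<kappa> * \<kappa>n))
          else
            (1 - inverse \<kappa> * \<kappa>0 * \<kappa>n * \<psi>0 * \<psi>n) * (1 - \<kappa> * inverse \<kappa>0 * inverse \<kappa>n * \<psi>0 * \<psi>n) /
            ((\<kappa> * inverse \<kappa>0 + inverse \<kappa> * \<kappa>0) * (\<kappa> * inverse \<kappa>n + inverse \<kappa> * \<kappa>n))) \<and>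
       M00 \<noteq> 0 \<and> M01 \<noteq> 0 \<and> Mn0 \<noteq> 0 \<and> Mn1 \<noteq> 0 \<and>
       M00 * M01 = inverse \<psi>0 * inverse (\<kappa> * inverse \<kappa>0 + inverse \<kappa> * \<kappa>0) \<and>
       Mn0 * Mn1 = inverse \<psi>n * inverse (\<kappa> * inverse \<kappa>n + inverse \<kappa> * \<kappa>n) \<and>
       M00 * Mn1 = (if odd n then \<beta>0 * inverse (1 + \<kappa>0 * inverse \<kappa>n * \<psi>0 * \<psi>n)
                    else \<beta>0 * inverse (1 - inverse \<kappa> * \<kappa>0 * \<kappa>n * \<psi>0 * \<psi>n))
     \<longrightarrow> is_TL_iso n
           (- (\<kappa> + inverse \<kappa>))
           (- (\<kappa>0 + inverse \<kappa>0) / (\<kappa> * inverse \<kappa>0 + inverse \<kappa> * \<kappa>0))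
           (- (\<kappa>n + inverse \<kappa>n) / (\<kappa> * inverse \<kappa>n + inverse \<kappa> * \<kappa>n))
           \<beta>0 \<beta>1 \<kappa> \<kappa>0 \<kappa>n \<psi>0 \<psi>n
           (Psi n \<kappa> \<kappa>0 \<kappa>n \<psi>0 \<psi>n M00 M01 Mn0 Mn1))"
proof -
  obtain f where f: "bij_betw f {0..<card (tb_matchings n)} (tb_matchings n)"
    using ex_bij_betw_nat_finite[OF finite_tb_matchings] by blast
  \<comment> \<open>The determinant of the scaled weights, with \<open>z 0\<close> to
    \<open>z 4\<close> standing for \<kappa>, \<kappa>0, \<kappa>n, \<psi>0, \<psi>n.\<close>
  define Q where "Q = (\<lambda>z :: nat \<Rightarrow> complex. det (weight_matrix n f (z 0 * z 1 * z 2) (- (z 1 * z 2))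
      (z 1 * z 1 * z 2 * z 3) (- (z 0 * z 2 * z 3)) (z 1 * z 2 * z 2 * z 4) (- (z 0 * z 1 * z 4))))"
  have poly: "poly_fun 6 Q"
    unfolding Q_def
    by (intro poly_fun_det_weight_matrix poly_fun_mult poly_fun_uminus poly_fun_var)
      (use f in \<open>auto simp: bij_betw_def\<close>)
  have nontrivial: "\<exists>z. Q z \<noteq> 0"
  proof -
    obtain \<tau> where \<tau>: "\<tau> \<noteq> 0" "det (weight_matrix n f 1 \<tau> 0 0 0 0) \<noteq> 0"
      using det_weight_matrix_nonzero[OF f] by blast
    \<comment> \<open>Chosen so that the scaled parameters are \<open>u = 1\<close> and
      \<open>t = \<tau>\<close>, while all four link parameters vanish with \<psi>0 and \<psi>n. The
      point need not be admissible in the theorem: it only shows that \<open>Q\<close> is not the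
      zero polynomial.\<close>
    then have "Q (\<lambda>i. [- inverse \<tau>, - \<tau>, 1, 0, 0, 0] ! i) \<noteq> 0" by (simp add: Q_def)
    then show ?thesis by blast
  qed
  have iso: "is_TL_iso n (- (\<kappa> + inverse \<kappa>))
      (- (\<kappa>0 + inverse \<kappa>0) / (\<kappa> * inverse \<kappa>0 + inverse \<kappa> * \<kappa>0))
      (- (\<kappa>n + inverse \<kappa>n) / (\<kappa> * inverse \<kappa>n + inverse \<kappa> * \<kappa>n))
      \<beta>0 \<beta>1 \<kappa> \<kappa>0 \<kappa>n \<psi>0 \<psi>n (Psi n \<kappa> \<kappa>0 \<kappa>n \<psi>0 \<psi>n M00 M01 Mn0 Mn1)"
    if nz: "\<kappa> \<noteq> 0" "\<kappa>0 \<noteq> 0" "\<kappa>n \<noteq> 0" "\<psi>0 \<noteq> 0" "\<psi>n \<noteq> 0"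
      and Qnz: "Q (\<lambda>i. [\<kappa>, \<kappa>0, \<kappa>n, \<psi>0, \<psi>n, \<beta>0] ! i) \<noteq> 0"
      and \<beta>\<beta>: "\<beta>0 * \<beta>1 = inverse \<psi>0 * inverse \<psi>n *
         (if odd n then
            (1 + \<kappa>0 * inverse \<kappa>n * \<psi>0 * \<psi>n) * (1 + inverse \<kappa>0 * \<kappa>n * \<psi>0 * \<psi>n) /
            ((\<kappa> * inverse \<kappa>0 + inverse \<kappa> * \<kappa>0) * (\<kappa> * inverse \<kappa>n + inverse \<kappa> * \<kappa>n))
          else
            (1 - inverse \<kappa> * \<kappa>0 * \<kappa>n * \<psi>0 * \<psi>n) * (1 - \<kappa> * inverse \<kappa>0 * inverse \<kappa>n * \<psi>0 * \<psi>n) /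
            ((\<kappa> * inverse \<kappa>0 + inverse \<kappa> * \<kappa>0) * (\<kappa> * inverse \<kappa>n + inverse \<kappa> * \<kappa>n)))"
      and Mnz: "M00 \<noteq> 0" "M01 \<noteq> 0" "Mn0 \<noteq> 0" "Mn1 \<noteq> 0"
      and M0: "M00 * M01 = inverse \<psi>0 * inverse (\<kappa> * inverse \<kappa>0 + inverse \<kappa> * \<kappa>0)"
      and Mn: "Mn0 * Mn1 = inverse \<psi>n * inverse (\<kappa> * inverse \<kappa>n + inverse \<kappa> * \<kappa>n)"
      and MM: "M00 * Mn1 = (if odd n then \<beta>0 * inverse (1 + \<kappa>0 * inverse \<kappa>n * \<psi>0 * \<psi>n)
                    else \<beta>0 * inverse (1 - inverse \<kappa> * \<kappa>0 * \<kappa>n * \<psi>0 * \<psi>n))"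
    for \<kappa> \<kappa>0 \<kappa>n \<psi>0 \<psi>n \<beta>0 \<beta>1 M00 M01 Mn0 Mn1 :: complex
  proof -
    define D0 where "D0 = \<kappa> * inverse \<kappa>0 + inverse \<kappa> * \<kappa>0"
    define Dn where "Dn = \<kappa> * inverse \<kappa>n + inverse \<kappa> * \<kappa>n"
    define X where "X = (if odd n then 1 + \<kappa>0 * inverse \<kappa>n * \<psi>0 * \<psi>n else 1 - inverse \<kappa> * \<kappa>0 * \<kappa>n * \<psi>0 * \<psi>n)"
    define Y where "Y = (if odd n then 1 + inverse \<kappa>0 * \<kappa>n * \<psi>0 * \<psi>n else 1 - \<kappa> * inverse \<kappa>0 * inverse \<kappa>n * \<psi>0 * \<psi>n)"
    have M0': "M00 * M01 = inverse \<psi>0 * inverse D0" using M0 unfolding D0_def .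
    have Mn': "Mn0 * Mn1 = inverse \<psi>n * inverse Dn" using Mn unfolding Dn_def .
    \<comment> \<open>As \<open>inverse 0 = 0\<close>, a vanishing denominator would make a product
      of nonzero normalization constants zero. The same argument gives \<open>X \<noteq> 0\<close>
      below.\<close>
    have D: "D0 \<noteq> 0" "Dn \<noteq> 0" using M0' Mn' Mnz by auto
    have MM': "M00 * Mn1 = \<beta>0 * inverse X" using MM unfolding X_def by simp
    have X: "X \<noteq> 0" using MM' Mnz by auto
    have b0: "\<beta>0 = X * M00 * Mn1" using MM' X by (simp add: field_simps)
    \<comment> \<open>The right side regroups into \<open>X * M00 * Mn1\<close>, which is
      \<open>\<beta>0\<close>, times \<open>Y * M01 * Mn0\<close>. Cancelling the nonzero
      \<open>\<beta>0\<close> determines \<open>\<beta>1\<close>.\<close>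
    have "\<beta>0 * \<beta>1 = (inverse \<psi>0 * inverse D0) * (inverse \<psi>n * inverse Dn) * (X * Y)"
      using \<beta>\<beta> D unfolding D0_def[symmetric] Dn_def[symmetric] X_def Y_def
      by (simp add: field_simps split: if_splits)
    also have "\<dots> = \<beta>0 * (Y * M01 * Mn0)"
      unfolding M0'[symmetric] Mn'[symmetric] b0 by (simp add: mult_ac)
    finally have b1: "\<beta>1 = Y * M01 * Mn0" using b0 X Mnz by simp
    interpret intertwiner n \<kappa> \<kappa>0 \<kappa>n \<psi>0 \<psi>n \<beta>0 \<beta>1 M00 M01 Mn0 Mn1 D0 Dn
    proof
      show "D0 * (\<kappa> * \<kappa>0) = \<kappa>\<^sup>2 + \<kappa>0\<^sup>2" "Dn * (\<kappa> * \<kappa>n) = \<kappa>\<^sup>2 + \<kappa>n\<^sup>2"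
        using nz by (simp_all add: D0_def Dn_def field_simps power2_eq_square)
      show "M01 = 1 / (\<psi>0 * D0 * M00)" "Mn0 = 1 / (\<psi>n * Dn * Mn1)"
        using M0' Mn' nz D Mnz by (simp_all add: field_simps)
      show "\<beta>0 = (if odd n then 1 + \<kappa>0 * \<psi>0 * \<psi>n / \<kappa>n else 1 - \<kappa>0 * \<kappa>n * \<psi>0 * \<psi>n / \<kappa>) * M00 * Mn1"
        unfolding b0 X_def by (simp add: divide_inverse mult_ac)
      show "\<beta>1 = (if odd n then 1 + \<kappa>n * \<psi>0 * \<psi>n / \<kappa>0 else 1 - \<kappa> * \<psi>0 * \<psi>n / (\<kappa>0 * \<kappa>n)) * M01 * Mn0"
        unfolding b1 Y_def by (simp add: divide_inverse mult_ac)
    qed (use assms nz D Mnz in auto)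
    have det: "det (weight_matrix n f (\<kappa> * \<kappa>0 * \<kappa>n) (- (\<kappa>0 * \<kappa>n)) (\<kappa>0 * \<kappa>0 * \<kappa>n * \<psi>0)
      (- (\<kappa> * \<kappa>n * \<psi>0)) (\<kappa>0 * \<kappa>n * \<kappa>n * \<psi>n) (- (\<kappa> * \<kappa>0 * \<psi>n))) \<noteq> 0"
      using Qnz by (simp add: Q_def)
    show ?thesis
      unfolding is_TL_iso_def D0_def[symmetric] Dn_def[symmetric]
    proof (intro conjI ballI)
      show "bij_betw (Psi n \<kappa> \<kappa>0 \<kappa>n \<psi>0 \<psi>n M00 M01 Mn0 Mn1) (mm_space n) (spin_space n)"
        by (rule bij_betw_Psi[OF f det])
    qed (rule Psi_intertwines, simp)
  qed
  show ?thesis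
  proof (intro exI[of _ Q] conjI allI impI)
    show "poly_fun 6 Q" by (rule poly)
    show "\<exists>z. Q z \<noteq> 0" by (rule nontrivial)
  qed (elim conjE, rule iso; assumption)
qed

end
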